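(* Let $N\ge 2$, $k\ge 1$, $0\le m\le k$, let $\lambda=m\lambda_1$ be a multiple of the first fundamental weight of $A_{N-1}$, let $\mu=a_1\lambda_1+\dots+a_{N-1}\lambda_{N-1}\in P_k^+$ be any weight of level $k$, and let $[\lambda],[\mu]$ be the corresponding $S_k$-orbits in $\mathbb{Z}_N^k$. Then for every weight $\nu\in P_k^+$ of level $k$, $$N_{\mu,\lambda}^{(k)\nu}=M_{[\mu],[\lambda]}^{(k)[\nu]}.$$
   Context: Weights: $\lambda_1,\dots,\lambda_{N-1}$ are the fundamental weights of $sl_N$ (type $A_{N-1}$), and the weights of level $k$ are $P_k^+=\{\sum_{j=1}^{N-1}a_j\lambda_j : a_j\in\mathbb{Z}_{\ge 0},\ \sum_{j=1}^{N-1} a_j\le k\}$. Orbits: $S_k$ acts on $\mathbb{Z}_N^k$ (where $\mathbb{Z}_N=\mathbb{Z}/N\mathbb{Z}$) by permuting coordinates; $[x]$ is the orbit of $x$. A weight $\lambda=\sum_{j=1}^{N-1} a_j\lambda_j\in P_k^+$ corresponds to the orbit $[\lambda]=[((N-1)^{a_{N-1}},\dots,1^{a_1},0^{a_0})]$, $a_0=k-\sum_{j\ge1}a_j$, where exponents denote numbers of repetitions. This is a bijection between $P_k^+$ and the set of orbits. For orbits $[a],[b],[c]$ let $T([a],[b],[c])=\{(x,y,z)\in[a]\times[b]\times[c] : x+y=z\}$, with $S_k$ acting by $\sigma(x,y,z)=(\sigma x,\sigma y,\sigma z)$; $M_{[a],[b]}^{(k)[c]}$ is the number of $S_k$-orbits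 of $T([a],[b],[c])$. Fusion coefficients: Let $\Lambda_N=\mathbb{Q}[x_1,\dots,x_N]^{S_N}$, with $h_m$ the complete homogeneous symmetric polynomials ($h_0=1$, $h_m=0$ for $m<0$), and for a partition $(\mu)=(\mu_1,\dots,\mu_N)$ of length at most $N$ let $S_{(\mu)}=\det(h_{\mu_i-i+j})_{i,j=1}^N$ be the Schur polynomial. Let $I^{(N,k)}$ be the ideal of $\Lambda_N$ generated by $S_{(1^N)}-1$ and all $S_{(\mu)}$ with $\mu_1-\mu_N=k+1$. To $\lambda=\sum a_j\lambda_j\in P_k^+$ associate the partition $(\lambda)=(\sum_{j\ge1}a_j,\sum_{j\ge2}a_j,\dots,a_{N-1})$. The fusion algebra $\mathcal{F}(A_{N-1},k)$ is $\Lambda_N/I^{(N,k)}$ (Goodman–Wenzl); the classes of $S_{(\lambda)}$, $\lambda\in P_k^+$, form a $\mathbb{Q}$-basis, and the fusion coefficients $N_{\mu,\lambda}^{(k)\nu}$ are the structure constants: $S_{(\mu)}S_{(\lambda)}=\sum_{\nu\in P_k^+}N_{\mu,\lambda}^{(k)\nu}S_{(\nu)}$ in $\Lambda_N/I^{(N,k)}$. *)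

theory Defs
  imports
    "HOL-Library.Poly_Mapping"
    "HOL-Algebra.QuotRing"
    "HOL-Algebra.Product_Groups"
    "HOL-Algebra.Group_Action"
    "HOL-Algebra.Sym_Groups"
    "Jordan_Normal_Form.Determinant"
begin

section \<open>Weights of level $k$ for type $A_{N-1}$\<close>

text \<open>
  An integral combination of the fundamental weights is given by its coefficients:
  the weight with coefficient \<open>a\<^sub>j\<close> at the \<open>j\<close>-th fundamental weight is the
  finitely supported function \<open>j \<mapsto> a\<^sub>j\<close>.  Only indices \<open>1 \<le> j \<le> N - 1\<close> are used.
\<close>

type_synonym weight = "nat \<Rightarrow>\<^sub>0 nat"

definition fundamental_multiple :: "nat \<Rightarrow> nat \<Rightarrow> weight" where
  "fundamental_multiple m j = Poly_Mapping.single j m"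

definition weights :: "nat \<Rightarrow> nat \<Rightarrow> weight set" where
  "weights N k = {\<kappa>. Poly_Mapping.keys \<kappa> \<subseteq> {1..N - 1} \<and>
                     (\<Sum>j = 1..N - 1. Poly_Mapping.lookup \<kappa> j) \<le> k}"


section \<open>Orbits in $\mathbf{Z}_N^k$ and the numbers $M$\<close>

definition ZNk :: "nat \<Rightarrow> nat \<Rightarrow> (nat \<Rightarrow> int) monoid" where
  "ZNk N k = product_group {1..k} (\<lambda>_. integer_mod_group N)"

text \<open>A permutation of \<open>{1..k}\<close> fixes all other indices, so this preserves
  the extensional functions that represent vectors.\<close>

definition permute_vec :: "(nat \<Rightarrow> nat) \<Rightarrow> (nat \<Rightarrow> int) \<Rightarrow> nat \<Rightarrow> int" where
  "permute_vec \<sigma> x = x \<circ> Hilbert_Choice.inv \<sigma>"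

definition vec_orbit :: "nat \<Rightarrow> (nat \<Rightarrow> int) \<Rightarrow> (nat \<Rightarrow> int) set" where
  "vec_orbit k x = orbit (sym_group k) permute_vec x"

text \<open>The entries $(N-1)^{a_{N-1}}, \ldots, 1^{a_1}, 0^{a_0}$.\<close>

definition weight_entries :: "nat \<Rightarrow> nat \<Rightarrow> weight \<Rightarrow> int list" where
  "weight_entries N k \<kappa> =
     concat (map (\<lambda>j. replicate (Poly_Mapping.lookup \<kappa> j) (int j)) (rev [1..<N]))
     @ replicate (k - (\<Sum>j = 1..N - 1. Poly_Mapping.lookup \<kappa> j)) 0"

definition weight_vec :: "nat \<Rightarrow> nat \<Rightarrow> weight \<Rightarrow> nat \<Rightarrow> int" where
  "weight_vec N k \<kappa> = (\<lambda>i\<in>{1..k}. weight_entries N k \<kappa> ! (i - 1))"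

definition weight_orbit :: "nat \<Rightarrow> nat \<Rightarrow> weight \<Rightarrow> (nat \<Rightarrow> int) set" where
  "weight_orbit N k \<kappa> = vec_orbit k (weight_vec N k \<kappa>)"

definition sum_triples ::
  "nat \<Rightarrow> nat \<Rightarrow> (nat \<Rightarrow> int) set \<Rightarrow> (nat \<Rightarrow> int) set \<Rightarrow> (nat \<Rightarrow> int) set
     \<Rightarrow> ((nat \<Rightarrow> int) \<times> (nat \<Rightarrow> int) \<times> (nat \<Rightarrow> int)) set" where
  "sum_triples N k A B C = {(x, y, z). x \<in> A \<and> y \<in> B \<and> z \<in> C \<and> x \<otimes>\<^bsub>ZNk N k\<^esub> y = z}"

definition permute_triple ::
  "(nat \<Rightarrow> nat) \<Rightarrow> (nat \<Rightarrow> int) \<times> (nat \<Rightarrow> int) \<times> (nat \<Rightarrow> int)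
     \<Rightarrow> (nat \<Rightarrow> int) \<times> (nat \<Rightarrow> int) \<times> (nat \<Rightarrow> int)" where
  "permute_triple \<sigma> = (\<lambda>(x, y, z). (permute_vec \<sigma> x, permute_vec \<sigma> y, permute_vec \<sigma> z))"

definition orbit_coeff ::
  "nat \<Rightarrow> nat \<Rightarrow> (nat \<Rightarrow> int) set \<Rightarrow> (nat \<Rightarrow> int) set \<Rightarrow> (nat \<Rightarrow> int) set \<Rightarrow> nat" where
  "orbit_coeff N k A B C = card (orbits (sym_group k) (sum_triples N k A B C) permute_triple)"


section \<open>Symmetric polynomials\<close>

text \<open>
  Polynomials over the rationals: the outer finitely supported function maps a monomial,
  given by its exponents, to its coefficient.  The variables \<open>x\<^sub>1, \<dots>, x\<^sub>N\<close> carry the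
  indices \<open>0, \<dots>, N - 1\<close>, which are also the indices of matrix rows and list entries below.
\<close>

type_synonym rat_mpoly = "(nat \<Rightarrow>\<^sub>0 nat) \<Rightarrow>\<^sub>0 rat"

definition permute_vars :: "(nat \<Rightarrow> nat) \<Rightarrow> rat_mpoly \<Rightarrow> rat_mpoly" where
  "permute_vars \<pi> f = Poly_Mapping.map_key (Poly_Mapping.map_key \<pi>) f"

definition sym_ring :: "nat \<Rightarrow> rat_mpoly ring" where
  "sym_ring N =
     \<lparr>carrier = {f. (\<forall>m\<in>Poly_Mapping.keys f. Poly_Mapping.keys m \<subseteq> {..<N}) \<and>
                    (\<forall>\<pi>. \<pi> permutes {..<N} \<longrightarrow> permute_vars \<pi> f = f)},
      monoid.mult = (*), one = 1, zero = 0, add = (+)\<rparr>"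

definition complete_homogeneous :: "nat \<Rightarrow> int \<Rightarrow> rat_mpoly" where
  "complete_homogeneous N d =
     (if d < 0 then 0
      else \<Sum>m \<in> {m. Poly_Mapping.keys m \<subseteq> {..<N} \<and>
                        int (\<Sum>i<N. Poly_Mapping.lookup m i) = d}. Poly_Mapping.single m 1)"

text \<open>Partitions of length at most \<open>N\<close> are padded with zeros to lists of length exactly \<open>N\<close>.\<close>

definition partitions :: "nat \<Rightarrow> nat list set" where
  "partitions N = {\<mu>. length \<mu> = N \<and> sorted_wrt (\<ge>) \<mu>}"

definition schur :: "nat \<Rightarrow> nat list \<Rightarrow> rat_mpoly" where
  "schur N \<mu> = det (mat N N (\<lambda>(i, j). complete_homogeneous N (int (\<mu> ! i) - int i + int j)))"


section \<open>The fusion algebra and its structure constants\<close>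

definition fusion_ideal :: "nat \<Rightarrow> nat \<Rightarrow> rat_mpoly set" where
  "fusion_ideal N k =
     Idl\<^bsub>sym_ring N\<^esub> (insert (schur N (replicate N 1) - 1)
       {schur N \<mu> | \<mu>. \<mu> \<in> partitions N \<and> \<mu> ! 0 = \<mu> ! (N - 1) + (k + 1)})"

definition fusion_algebra :: "nat \<Rightarrow> nat \<Rightarrow> rat_mpoly set ring" where
  "fusion_algebra N k = sym_ring N Quot fusion_ideal N k"

definition fusion_class :: "nat \<Rightarrow> nat \<Rightarrow> rat_mpoly \<Rightarrow> rat_mpoly set" where
  "fusion_class N k f = fusion_ideal N k +>\<^bsub>sym_ring N\<^esub> f"

text \<open>The \<open>i\<close>-th part is $\sum_{j \ge i} a_j$; the \<open>N\<close>-th part is the empty sum.\<close>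

definition weight_partition :: "nat \<Rightarrow> weight \<Rightarrow> nat list" where
  "weight_partition N \<kappa> = map (\<lambda>i. \<Sum>j = i..N - 1. Poly_Mapping.lookup \<kappa> j) [1..<N + 1]"

text \<open>
  The coefficients of the product of two basis elements of the fusion algebra with respect
  to the basis of classes of Schur polynomials of weights of level \<open>k\<close>; multiplication by
  the constant polynomial \<open>Poly_Mapping.single 0 q\<close> is scaling by the rational number \<open>q\<close>.
  The side condition outside \<open>weights N k\<close> only serves to make the description unique.
\<close>

definition fusion_coeff :: "nat \<Rightarrow> nat \<Rightarrow> weight \<Rightarrow> weight \<Rightarrow> weight \<Rightarrow> rat" where
  "fusion_coeff N k \<mu> \<kappa> =
     (THE c. (\<forall>\<nu>. \<nu> \<notin> weights N k \<longrightarrow> c \<nu> = 0) \<and>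
        fusion_class N k (schur N (weight_partition N \<mu>))
          \<otimes>\<^bsub>fusion_algebra N k\<^esub> fusion_class N k (schur N (weight_partition N \<kappa>))
        = fusion_class N k
            (\<Sum>\<nu>\<in>weights N k. Poly_Mapping.single 0 (c \<nu>) * schur N (weight_partition N \<nu>)))"

end

theory Submission
  imports Defs "HOL-Computational_Algebra.Formal_Power_Series"
begin

text \<open>
  For \<open>\<lambda> = m\<lambda>\<^sub>1\<close> the polynomial \<open>S\<^bsub>(\<lambda>)\<^esub>\<close> is the complete homogeneous polynomial \<open>h\<^sub>m\<close>, so the
  fusion coefficients in question are those of a Pieri rule modulo the fusion ideal.  Both
  sides turn out to be \<open>1\<close> or \<open>0\<close>, according to whether the multiplicities \<open>a\<^sub>j\<close>, \<open>c\<^sub>j\<close> of the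
  residues \<open>j\<close> in \<open>[\<mu>]\<close>, \<open>[\<nu>]\<close> admit numbers \<open>0 \<le> b\<^sub>j \<le> a\<^sub>j\<close> of total \<open>m\<close> with
  \<open>c\<^sub>j = a\<^sub>j - b\<^sub>j + b\<^bsub>j-1\<^esub>\<close> for all \<open>j\<close> modulo \<open>N\<close> (\<open>pieri_vector\<close>).

  Reading off coefficients.  Put \<open>n = N + k\<close>, \<open>\<rho> = (N-1, \<dots>, 0)\<close>, and let \<open>a\<^sub>\<alpha>\<close> be the alternating
  sum of the monomials \<open>x\<^bsup>\<pi>\<alpha>\<^esup>\<close>.  Since \<open>S\<^bsub>(\<mu>)\<^esub> a\<^sub>\<rho> = a\<^bsub>\<mu>+\<rho>\<^esub>\<close> (\<open>schur_mult_alternant_staircase\<close>),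
  a symmetric polynomial acts on alternants by adding its exponents to theirs
  (\<open>sym_ring_mult_alternant\<close>).  Consider the group generated by the permutations of coordinates,
  the translation by \<open>(1, \<dots>, 1)\<close> and the translations by those multiples of \<open>n\<close> whose coordinates
  have sum zero.  For a weight \<open>\<nu>\<close>, let \<open>F\<^sub>\<nu>\<close> be the signed indicator function of the orbit of
  \<open>\<nu> + \<rho>\<close>; it can be written as a determinant of congruence conditions
  (\<open>fusion_functional\<close>).  The linear functional that \<open>F\<^sub>\<nu>\<close> defines on \<open>f a\<^sub>\<rho>\<close> vanishes for \<open>f\<close> in the
  fusion ideal: invariance under \<open>(1, \<dots>, 1)\<close> takes care of \<open>S\<^bsub>(1^N)\<^esub> - 1\<close>, and if
  \<open>\<mu>\<^sub>1 - \<mu>\<^sub>N = k + 1\<close>, then \<open>\<mu> + \<rho>\<close> is fixed by a reflection of the group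
  (\<open>fusion_ideal_annihilated\<close>).  These functionals separate the Schur polynomials of the weights
  (\<open>weight_functional_shifted_partition\<close>), which proves that the coefficients are unique.  They
  exist because multiplication by an elementary symmetric polynomial adds a vertical strip, which
  leads from a weight of level \<open>k\<close> at worst to a generator of the ideal; so the span of the weights
  modulo the ideal is closed under multiplication by the elementary symmetric polynomials, hence
  by \<open>h\<^sub>m\<close> (\<open>spanned_complete_sum_mult\<close>).  Therefore the coefficient at \<open>\<nu>\<close> is the sum of
  \<open>F\<^sub>\<nu>(\<mu> + \<rho> + \<beta>)\<close> over all exponents \<open>\<beta>\<close> of degree \<open>m\<close> (\<open>fusion_coeff_eq_sum\<close>).

  Evaluating the sum.  It is the coefficient of \<open>q\<^sup>m\<close> in the determinant of \<open>q\<close> to the powers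
  \<open>d(\<alpha>\<^sub>i, B\<^sub>j)\<close>, where \<open>\<alpha> = \<mu> + \<rho>\<close>, where \<open>B\<close> is a translate of \<open>\<nu> + \<rho>\<close>, and where \<open>d\<close> is the distance
  in the positive direction on a circle with \<open>n\<close> points.  A walk from \<open>\<alpha>\<^sub>i\<close> to \<open>B\<^sub>j\<close> passes through the
  last \<open>\<alpha>\<^sub>l\<close> before \<open>B\<^sub>j\<close>, so this matrix is the product of the matrix of the \<open>q\<^bsup>d(\<alpha>\<^sub>i, \<alpha>\<^sub>l)\<^esup>\<close> and a matrix
  with one nonzero entry in each column.  The determinant of the first factor is \<open>1\<close>
  modulo \<open>q\<^sup>n\<close>, and \<open>m < n\<close>; what remains is \<open>1\<close> or \<open>0\<close> according to whether \<open>B\<close> interlaces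
  \<open>\<alpha>\<close> (\<open>sum_congruence_det_eq_interlaces\<close>).  Rewritten in multiplicities, interlacing is the
  existence of the numbers \<open>b\<^sub>j\<close>.

  Counting orbits.  In a triple \<open>(x, y, z)\<close> the vector \<open>y\<close> has \<open>m\<close> entries \<open>1\<close> and otherwise zeros;
  let \<open>b\<^sub>j\<close> be the number of positions with \<open>x\<^sub>i = j\<close> and \<open>y\<^sub>i = 1\<close>.  The conditions above say
  exactly that \<open>x + y \<in> [\<nu>]\<close>.  They determine the \<open>b\<^sub>j\<close>, because they determine all differences
  \<open>b\<^sub>j - b\<^bsub>j-1\<^esub>\<close> and the sum, and triples with the same \<open>b\<^sub>j\<close> are conjugate; so there is at most one
  orbit (\<open>orbit_coeff_eq_pieri\<close>).
\<close>

section \<open>The bialternant formula\<close>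

definition var :: "nat \<Rightarrow> rat_mpoly" where
  "var i = Poly_Mapping.single (Poly_Mapping.single i 1) 1"

definition exponents :: "nat set \<Rightarrow> nat \<Rightarrow> (nat \<Rightarrow>\<^sub>0 nat) set" where
  "exponents A d = {m. Poly_Mapping.keys m \<subseteq> A \<and> (\<Sum>i\<in>A. Poly_Mapping.lookup m i) = d}"

definition complete_sum :: "nat set \<Rightarrow> nat \<Rightarrow> rat_mpoly" where
  "complete_sum A d = (\<Sum>m\<in>exponents A d. Poly_Mapping.single m 1)"

lemma finite_exponents:
  assumes "finite A" shows "finite (exponents A d)"
proof -
  have "Poly_Mapping.lookup ` exponents A d
      \<subseteq> {f. \<forall>i. (i \<in> A \<longrightarrow> f i \<in> {..d}) \<and> (i \<notin> A \<longrightarrow> f i = 0)}"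
    using assms by (auto simp: exponents_def in_keys_iff intro!: member_le_sum)
  moreover have "finite {f. \<forall>i. (i \<in> A \<longrightarrow> f i \<in> {..d}) \<and> (i \<notin> A \<longrightarrow> f i = 0)}"
    by (rule finite_set_of_finite_funs) (use assms in auto)
  ultimately have "finite (Poly_Mapping.lookup ` exponents A d)"
    by (rule finite_subset)
  then show ?thesis
    by (rule finite_imageD) (auto simp: inj_on_def intro: poly_mapping_eqI)
qed

text \<open>A monomial either avoids the variable \<open>i\<close> or is divisible by it.\<close>

lemma exponents_insert:
  assumes "finite A" "i \<notin> A"
  shows "exponents (insert i A) (Suc d)
       = exponents A (Suc d) \<union> (+) (Poly_Mapping.single i 1) ` exponents (insert i A) d"
    (is "?L = ?R1 \<union> ?R2")
proof (intro equalityI subsetI)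
  fix m assume m: "m \<in> ?L"
  show "m \<in> ?R1 \<union> ?R2"
  proof (cases "Poly_Mapping.lookup m i = 0")
    case True
    then have "Poly_Mapping.keys m \<subseteq> A"
      using m by (auto simp: exponents_def in_keys_iff)
    then show ?thesis
      using m True assms by (auto simp: exponents_def)
  next
    case False
    define m' where "m' = m - Poly_Mapping.single i 1"
    have lk: "Poly_Mapping.lookup m' j = (if j = i then Poly_Mapping.lookup m i - 1 else Poly_Mapping.lookup m j)" for j
      by (simp add: m'_def lookup_minus lookup_single)
    have eq: "m = Poly_Mapping.single i 1 + m'"
      by (rule poly_mapping_eqI) (use False in \<open>auto simp: lookup_add lookup_single lk when_def\<close>)
    have "(\<Sum>j\<in>A. Poly_Mapping.lookup m' j) = (\<Sum>j\<in>A. Poly_Mapping.lookup m j)"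
      by (rule sum.cong) (use assms lk in auto)
    moreover have "Poly_Mapping.keys m' \<subseteq> Poly_Mapping.keys m"
      by (auto simp: in_keys_iff lk split: if_splits)
    ultimately have "m' \<in> exponents (insert i A) d"
      using m assms False by (auto simp: exponents_def lk)
    then show ?thesis using eq by auto
  qed
next
  fix m assume "m \<in> ?R1 \<union> ?R2"
  then show "m \<in> ?L"
  proof
    assume m: "m \<in> ?R1"
    then have "Poly_Mapping.lookup m i = 0"
      using assms by (auto simp: exponents_def in_keys_iff)
    then show ?thesis using m assms by (auto simp: exponents_def)
  next
    assume "m \<in> ?R2"
    then obtain m' where m': "m' \<in> exponents (insert i A) d" "m = Poly_Mapping.single i 1 + m'"
      by auto
    have "(\<Sum>j\<in>A. Poly_Mapping.lookup m j) = (\<Sum>j\<in>A. Poly_Mapping.lookup m' j)"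
      by (rule sum.cong) (use assms m' in \<open>auto simp: lookup_add lookup_single when_def\<close>)
    moreover have "Poly_Mapping.keys m \<subseteq> insert i (Poly_Mapping.keys m')"
      by (auto simp: m' in_keys_iff lookup_add lookup_single when_def split: if_splits)
    ultimately show ?thesis
      using m' assms by (auto simp: exponents_def lookup_add)
  qed
qed

lemma complete_sum_insert:
  assumes "finite A" "i \<notin> A"
  shows "complete_sum (insert i A) (Suc d) = complete_sum A (Suc d) + var i * complete_sum (insert i A) d"
proof -
  have "Poly_Mapping.single i 1 + m \<notin> exponents A (Suc d)" for m
  proof -
    have "i \<in> Poly_Mapping.keys (Poly_Mapping.single i 1 + m)"
      by (simp add: in_keys_iff lookup_add)
    then show ?thesis using assms by (auto simp: exponents_def)
  qed
  then have "exponents A (Suc d) \<inter> (+) (Poly_Mapping.single i 1) ` exponents (insert i A) d = {}"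
    by blast
  then have "complete_sum (insert i A) (Suc d) = complete_sum A (Suc d)
     + (\<Sum>m\<in>(+) (Poly_Mapping.single i 1) ` exponents (insert i A) d. Poly_Mapping.single m 1)"
    unfolding complete_sum_def exponents_insert[OF assms]
    by (intro sum.union_disjoint) (use assms in \<open>auto intro: finite_exponents\<close>)
  also have "(\<Sum>m\<in>(+) (Poly_Mapping.single i 1) ` exponents (insert i A) d. Poly_Mapping.single m (1::rat))
      = var i * complete_sum (insert i A) d"
    by (subst sum.reindex) (auto simp: complete_sum_def sum_distrib_left var_def mult_single inj_on_def)
  finally show ?thesis .
qed

lemma complete_sum_0:
  assumes "finite A" shows "complete_sum A 0 = 1"
proof -
  have "exponents A 0 = {0}"
    using assms by (auto simp: exponents_def in_keys_iff intro!: poly_mapping_eqI)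
  then show ?thesis by (simp add: complete_sum_def)
qed

lemma complete_sum_empty: "complete_sum {} d = (if d = 0 then 1 else 0)"
proof -
  have "exponents {} d = (if d = 0 then {0} else {})"
    by (auto simp: exponents_def)
  then show ?thesis by (auto simp: complete_sum_def)
qed

lemma complete_sum_singleton: "complete_sum {i} d = var i ^ d"
proof (induction d)
  case (Suc d)
  then show ?case
    using complete_sum_insert[of "{}" i d] by (simp add: complete_sum_empty)
qed (simp add: complete_sum_0)

definition complete_gen :: "nat set \<Rightarrow> rat_mpoly fps" where
  "complete_gen A = Abs_fps (complete_sum A)"

text \<open>
  The coefficient at \<open>r\<close> is \<open>(-1)\<^sup>r\<close> times the \<open>r\<close>-th elementary symmetric polynomial in the
  variables \<open>A\<close>.
\<close>

definition signed_elementary_gen :: "nat set \<Rightarrow> rat_mpoly fps" where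
  "signed_elementary_gen A = (\<Prod>i\<in>A. 1 - fps_const (var i) * fps_X)"

lemma complete_gen_insert:
  assumes "finite A" "i \<notin> A"
  shows "complete_gen (insert i A) * (1 - fps_const (var i) * fps_X) = complete_gen A"
proof (rule fps_ext)
  fix d
  show "fps_nth (complete_gen (insert i A) * (1 - fps_const (var i) * fps_X)) d = fps_nth (complete_gen A) d"
  proof (cases d)
    case 0
    then show ?thesis
      using assms by (simp add: complete_gen_def complete_sum_0 algebra_simps)
  next
    case (Suc e)
    have "complete_gen (insert i A) * (1 - fps_const (var i) * fps_X)
        = complete_gen (insert i A) - fps_const (var i) * (fps_X * complete_gen (insert i A))"
      by (simp add: algebra_simps)
    then show ?thesis
      using Suc complete_sum_insert[OF assms] by (simp add: complete_gen_def)
  qed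
qed

text \<open>
  The generating function of the complete homogeneous polynomials is the product of the
  geometric series \<open>1 / (1 - x\<^sub>i t)\<close>, and each factor on the left cancels one of them.
\<close>

lemma complete_gen_mult_signed_elementary_gen:
  assumes "finite A" "B \<subseteq> A"
  shows "complete_gen A * signed_elementary_gen B = complete_gen (A - B)"
proof -
  have "finite B" using assms finite_subset by blast
  then show ?thesis using assms(2)
  proof (induction B)
    case empty
    then show ?case by (simp add: signed_elementary_gen_def)
  next
    case (insert i B)
    have "complete_gen A * signed_elementary_gen (insert i B)
        = (complete_gen A * signed_elementary_gen B) * (1 - fps_const (var i) * fps_X)"
      using insert by (simp add: signed_elementary_gen_def algebra_simps)
    also have "\<dots> = complete_gen (insert i (A - insert i B)) * (1 - fps_const (var i) * fps_X)"
    proof -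
      have "A - B = insert i (A - insert i B)" using insert by auto
      then show ?thesis using insert by simp
    qed
    also have "\<dots> = complete_gen (A - insert i B)"
      by (rule complete_gen_insert) (use assms in auto)
    finally show ?case .
  qed
qed

lemma signed_elementary_gen_nth_large:
  assumes "finite A" "card A < r"
  shows "fps_nth (signed_elementary_gen A) r = 0"
  using assms
proof (induction A arbitrary: r)
  case empty
  then show ?case by (simp add: signed_elementary_gen_def fps_one_nth)
next
  case (insert i A)
  then obtain s where r: "r = Suc s" by (cases r) auto
  have "signed_elementary_gen (insert i A)
      = signed_elementary_gen A - fps_const (var i) * (fps_X * signed_elementary_gen A)"
    using insert by (simp add: signed_elementary_gen_def algebra_simps)
  then show ?case using insert r by simp
qed

lemma complete_homogeneous_eq:
  "complete_homogeneous N d = (if d < 0 then 0 else complete_sum {..<N} (nat d))"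
proof (cases "d < 0")
  case False
  then have "{m. Poly_Mapping.keys m \<subseteq> {..<N} \<and> int (\<Sum>i<N. Poly_Mapping.lookup m i) = d}
      = exponents {..<N} (nat d)"
    by (auto simp: exponents_def simp flip: of_nat_sum)
  then show ?thesis using False by (simp add: complete_homogeneous_def complete_sum_def)
qed (simp add: complete_homogeneous_def)

text \<open>
  The case \<open>B = A - {l}\<close> of the cancellation above leaves the geometric series of \<open>x\<^sub>l\<close>.  This
  writes every power of \<open>x\<^sub>l\<close> in terms of complete homogeneous polynomials with \<open>N\<close> coefficients
  that do not depend on the exponent, which is what makes the Jacobi-Trudi matrix a factor of
  the matrix of powers.
\<close>

lemma var_power_expansion:
  assumes "l < N"
  shows "var l ^ p = (\<Sum>j<N. complete_homogeneous N (int p - int (N - 1) + int j)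
                         * fps_nth (signed_elementary_gen ({..<N} - {l})) (N - 1 - j))"
proof -
  define q where "q = fps_nth (signed_elementary_gen ({..<N} - {l}))"
  have q0: "q r = 0" if "r \<ge> N" for r
    unfolding q_def by (rule signed_elementary_gen_nth_large) (use that assms in auto)
  have "complete_gen {..<N} * signed_elementary_gen ({..<N} - {l}) = complete_gen {l}"
    using complete_gen_mult_signed_elementary_gen[of "{..<N}" "{..<N} - {l}"] assms
    by (simp add: double_diff)
  then have "var l ^ p = fps_nth (signed_elementary_gen ({..<N} - {l}) * complete_gen {..<N}) p"
    by (simp add: mult.commute complete_gen_def complete_sum_singleton)
  also have "\<dots> = (\<Sum>r=0..p. q r * complete_sum {..<N} (p - r))"
    by (simp add: fps_mult_nth q_def complete_gen_def)
  also have "\<dots> = (\<Sum>r=0..p. q r * complete_homogeneous N (int p - int r))"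
    by (intro sum.cong refl) (auto simp: complete_homogeneous_eq nat_diff_distrib)
  also have "\<dots> = (\<Sum>r<N. q r * complete_homogeneous N (int p - int r))"
    by (intro sum.mono_neutral_cong) (auto simp: q0 complete_homogeneous_eq)
  also have "\<dots> = (\<Sum>j<N. q (N - 1 - j) * complete_homogeneous N (int p - int (N - 1) + int j))"
  proof (subst sum.nat_diff_reindex[symmetric], rule sum.cong)
    fix j assume "j \<in> {..<N}"
    then have "N - Suc j = N - 1 - j" "int p - int (N - 1 - j) = int p - int (N - 1) + int j"
      by (auto simp: of_nat_diff)
    then show "q (N - Suc j) * complete_homogeneous N (int p - int (N - Suc j))
       = q (N - 1 - j) * complete_homogeneous N (int p - int (N - 1) + int j)"
      by (simp only:)
  qed simp
  finally show ?thesis by (simp add: q_def mult.commute)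
qed

definition var_matrix :: "nat \<Rightarrow> (nat \<Rightarrow> nat) \<Rightarrow> rat_mpoly mat" where
  "var_matrix N \<alpha> = mat N N (\<lambda>(i, j). var j ^ \<alpha> i)"

text \<open>
  The factor \<open>D\<close> is the determinant of the coefficients in \<open>var_power_expansion\<close>; it is identified
  with the Vandermonde determinant by the case where all parts are zero.
\<close>

lemma det_var_matrix_eq_schur_mult:
  obtains D where "\<And>\<mu>. length \<mu> = N \<Longrightarrow> det (var_matrix N (\<lambda>i. \<mu> ! i + (N - 1 - i))) = schur N \<mu> * D"
proof -
  define Q where "Q = mat N N (\<lambda>(j, l). fps_nth (signed_elementary_gen ({..<N} - {l})) (N - 1 - j))"
  have "det (var_matrix N (\<lambda>i. \<mu> ! i + (N - 1 - i))) = schur N \<mu> * det Q" if "length \<mu> = N" for \<mu>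
  proof -
    define H where "H = mat N N (\<lambda>(i, j). complete_homogeneous N (int (\<mu> ! i) - int i + int j))"
    have "var_matrix N (\<lambda>i. \<mu> ! i + (N - 1 - i)) = H * Q"
    proof (rule eq_matI)
      fix i l assume "i < dim_row (H * Q)" "l < dim_col (H * Q)"
      then have il: "i < N" "l < N" by (auto simp: H_def Q_def)
      then have "int (\<mu> ! i + (N - 1 - i)) - int (N - 1) = int (\<mu> ! i) - int i"
        by auto
      then show "var_matrix N (\<lambda>i. \<mu> ! i + (N - 1 - i)) $$ (i, l) = (H * Q) $$ (i, l)"
        using il by (simp add: var_matrix_def H_def Q_def scalar_prod_def var_power_expansion
            del: of_nat_add of_nat_diff flip: lessThan_atLeast0)
    qed (auto simp: var_matrix_def H_def Q_def)
    moreover have "H \<in> carrier_mat N N" "Q \<in> carrier_mat N N" by (auto simp: H_def Q_def)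
    moreover have "schur N \<mu> = det H"
      by (simp add: schur_def H_def)
    ultimately show ?thesis
      by (simp add: det_mult)
  qed
  then show ?thesis using that by blast
qed

lemma schur_replicate_0: "schur N (replicate N 0) = 1"
proof -
  define H where "H = mat N N (\<lambda>(i, j). complete_homogeneous N (int (replicate N 0 ! i) - int i + int j))"
  have "upper_triangular H"
    by (auto simp: H_def upper_triangular_def complete_homogeneous_eq)
  moreover have "H \<in> carrier_mat N N" by (simp add: H_def)
  ultimately have "det H = prod_list (diag_mat H)"
    by (rule det_upper_triangular)
  also have "diag_mat H = replicate N 1"
    by (rule nth_equalityI) (auto simp: diag_mat_def H_def complete_homogeneous_eq complete_sum_0)
  finally show ?thesis by (simp add: schur_def H_def)
qed

lemma schur_mult_vandermonde:
  assumes "length \<mu> = N"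
  shows "schur N \<mu> * det (var_matrix N (\<lambda>i. N - 1 - i)) = det (var_matrix N (\<lambda>i. \<mu> ! i + (N - 1 - i)))"
proof -
  obtain D where D: "\<And>\<mu>. length \<mu> = N \<Longrightarrow> det (var_matrix N (\<lambda>i. \<mu> ! i + (N - 1 - i))) = schur N \<mu> * D"
    using det_var_matrix_eq_schur_mult by blast
  have "var_matrix N (\<lambda>i. replicate N 0 ! i + (N - 1 - i)) = var_matrix N (\<lambda>i. N - 1 - i)"
    by (rule eq_matI) (auto simp: var_matrix_def)
  with D[of "replicate N 0"] have "det (var_matrix N (\<lambda>i. N - 1 - i)) = D"
    by (simp add: schur_replicate_0)
  with D[OF assms] show ?thesis by simp
qed

section \<open>Points on a circle up to congruence\<close>

text \<open>
  For \<open>A = \<mu> + \<rho>\<close> and \<open>n = N + k\<close> these inequalities say that \<open>\<mu>\<close> is a partition with \<open>\<mu>\<^sub>1 - \<mu>\<^sub>N \<le> k\<close>.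
  They describe an open alcove of the affine Weyl group, so that distinct sequences of this
  kind are inequivalent under permutations and under shifts by multiples of \<open>n\<close> that preserve
  the sum.
\<close>

definition alcove :: "nat \<Rightarrow> nat \<Rightarrow> (nat \<Rightarrow> int) \<Rightarrow> bool" where
  "alcove N n A \<longleftrightarrow> (\<forall>i j. i < j \<longrightarrow> j < N \<longrightarrow> A j < A i) \<and> (\<forall>i<N. \<forall>j<N. A i < A j + int n)"

lemma alcove_decreasing: "alcove N n A \<Longrightarrow> i < j \<Longrightarrow> j < N \<Longrightarrow> A j < A i"
  by (simp add: alcove_def)

lemma alcove_span: "alcove N n A \<Longrightarrow> i < N \<Longrightarrow> j < N \<Longrightarrow> A i < A j + int n"
  by (simp add: alcove_def)

lemma alcove_inj_mod:
  assumes "alcove N n A" "i < N" "j < N" "(A i - A j) mod int n = 0"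
  shows "i = j"
proof (rule ccontr)
  assume "i \<noteq> j"
  then have "A i \<noteq> A j"
    using alcove_decreasing[OF assms(1)] assms(2,3) by (metis less_irrefl linorder_neqE_nat)
  moreover have "\<bar>A i - A j\<bar> < int n"
    using alcove_span[OF assms(1) assms(2,3)] alcove_span[OF assms(1) assms(3,2)] by linarith
  moreover have "int n dvd A i - A j" using assms(4) by (simp add: dvd_eq_mod_eq_0)
  ultimately show False
    using dvd_imp_le_int[of "A i - A j" "int n"] by auto
qed

lemma permutes_fixing_imp_id:
  fixes p :: "nat \<Rightarrow> nat"
  assumes p: "p permutes {..<N}" and fixed: "\<And>i. i < N \<Longrightarrow> p i = i"
  shows "p = id"
proof
  fix j show "p j = id j"
  proof (cases "j < N")
    case False
    then show ?thesis using permutes_not_in[OF p, of j] by simp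
  qed (simp add: fixed)
qed

lemma permutes_strict_mono_imp_id:
  fixes p :: "nat \<Rightarrow> nat"
  assumes p: "p permutes {..<N}" and mono: "\<And>i j. i < j \<Longrightarrow> j < N \<Longrightarrow> p i < p j"
  shows "p = id"
proof -
  have le: "i \<le> p i" if "i < N" for i
    using that
  proof (induction i)
    case (Suc i)
    then show ?case using mono[of i "Suc i"] by simp
  qed simp
  have "(\<Sum>i<N. p i) = (\<Sum>i<N. i)"
    using sum.permute[OF p, of id] by (simp add: o_def)
  have eq: "p i = i" if "i < N" for i
  proof (rule ccontr)
    assume "p i \<noteq> i"
    with le[OF that] have "i < p i" by simp
    then have "(\<Sum>i<N. i) < (\<Sum>i<N. p i)"
      by (intro sum_strict_mono_ex1) (use le that in auto)
    with \<open>(\<Sum>i<N. p i) = (\<Sum>i<N. i)\<close> show False by simp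
  qed
  then show ?thesis by (rule permutes_fixing_imp_id[OF p])
qed

text \<open>
  If the smallest entry of \<open>A\<close> is at most that of \<open>B\<close>, then each entry of \<open>A\<close> is the least number
  congruent to itself that is not below this smallest entry, hence at most its partner in \<open>B\<close>.
  Equality of the sums forces equality throughout.
\<close>

lemma alcove_unique_aux:
  assumes A: "alcove N n A" and B: "alcove N n B" and p: "p permutes {..<N}"
    and cong: "\<And>i. i < N \<Longrightarrow> (A i - B (p i)) mod int n = 0"
    and sum: "(\<Sum>i<N. A i) = (\<Sum>i<N. B i)"
    and le: "A (N - 1) \<le> B (N - 1)"
  shows "\<forall>i<N. A i = B i"
proof -
  have pN: "p i < N" if "i < N" for i
    using permutes_in_image[OF p, of i] that by simp
  have AB: "A i \<le> B (p i)" if i: "i < N" for i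
  proof -
    \<comment> \<open>both \<open>A i\<close> and \<open>B (p i)\<close> are at least \<open>a\<close>, and \<open>A i\<close> is less than \<open>a + n\<close>\<close>
    define a where "a = A (N - 1)"
    have "a \<le> A i"
      using alcove_decreasing[OF A, of i "N - 1"] i by (cases "i = N - 1") (auto simp: a_def less_imp_le)
    moreover have "A i < a + int n" using alcove_span[OF A i, of "N - 1"] i by (simp add: a_def)
    moreover have "a \<le> B (p i)"
      using alcove_decreasing[OF B, of "p i" "N - 1"] pN[OF i] le
      by (cases "p i = N - 1") (force simp: a_def)+
    moreover have "(A i - a) mod int n = (B (p i) - a) mod int n"
      using cong[OF i] by (simp add: mod_eq_dvd_iff mod_0_imp_dvd)
    ultimately have "A i - a = (B (p i) - a) mod int n"
      using mod_pos_pos_trivial[of "A i - a" "int n"] by linarith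
    also have "\<dots> \<le> B (p i) - a"
      by (rule zmod_le_nonneg_dividend) (use \<open>a \<le> B (p i)\<close> in simp)
    finally show ?thesis by simp
  qed
  have sumB: "(\<Sum>i<N. B (p i)) = (\<Sum>i<N. B i)"
    using sum.permute[OF p, of B] by (simp add: o_def)
  have eq: "A i = B (p i)" if i: "i < N" for i
  proof (rule ccontr)
    assume "A i \<noteq> B (p i)"
    with AB[OF i] have "A i < B (p i)" by simp
    then have "(\<Sum>i<N. A i) < (\<Sum>i<N. B (p i))"
      by (intro sum_strict_mono_ex1) (use AB i in auto)
    with sum sumB show False by simp
  qed
  have "p = id"
  proof (rule permutes_strict_mono_imp_id[OF p])
    fix i j assume ij: "i < j" "j < N"
    then have "B (p j) < B (p i)"
      using alcove_decreasing[OF A ij] eq[of i] eq[of j] by simp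
    then show "p i < p j"
      using alcove_decreasing[OF B, of "p j" "p i"] pN[of i] ij
      by (metis less_asym less_irrefl linorder_neqE_nat less_trans)
  qed
  with eq show ?thesis by simp
qed

lemma alcove_unique:
  assumes A: "alcove N n A" and B: "alcove N n B" and p: "p permutes {..<N}"
    and cong: "\<And>i. i < N \<Longrightarrow> (A i - B (p i)) mod int n = 0"
    and sum: "(\<Sum>i<N. A i) = (\<Sum>i<N. B i)"
  shows "(\<forall>i<N. A i = B i) \<and> p = id"
proof -
  have eq: "\<forall>i<N. A i = B i"
  proof (cases "A (N - 1) \<le> B (N - 1)")
    case True
    then show ?thesis using alcove_unique_aux[OF A B p cong sum] by blast
  next
    case False
    have q: "inv' p permutes {..<N}" by (rule permutes_inv[OF p])
    have "(B i - A (inv' p i)) mod int n = 0" if "i < N" for i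
    proof -
      have "inv' p i < N" using permutes_in_image[OF q, of i] that by simp
      from cong[OF this] have "int n dvd A (inv' p i) - B i"
        unfolding permutes_inverses(1)[OF p] by (rule mod_0_imp_dvd)
      then have "int n dvd B i - A (inv' p i)" by (rule dvd_diff_commute[THEN iffD1])
      then show ?thesis by (rule dvd_imp_mod_0)
    qed
    moreover have "B (N - 1) \<le> A (N - 1)" using False by linarith
    ultimately have "\<forall>i<N. B i = A i"
      using alcove_unique_aux[OF B A q _ sum[symmetric]] by blast
    then show ?thesis by (auto dest: sym)
  qed
  have "p i = i" if "i < N" for i
  proof -
    have "p i < N" using permutes_in_image[OF p, of i] that by simp
    moreover have "(B i - B (p i)) mod int n = 0"
      using cong[OF that] eq[rule_format, OF that] by argo
    ultimately show ?thesis
      by (rule alcove_inj_mod[OF B that _ _, symmetric])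
  qed
  then have "p = id" by (rule permutes_fixing_imp_id[OF p])
  with eq show ?thesis by (intro conjI)
qed

text \<open>The sum of the signs of the permutations \<open>p\<close> with \<open>A i\<close> congruent to \<open>B (p i)\<close> for all \<open>i\<close>.\<close>

definition congruence_det :: "nat \<Rightarrow> nat \<Rightarrow> (nat \<Rightarrow> int) \<Rightarrow> (nat \<Rightarrow> int) \<Rightarrow> rat" where
  "congruence_det N n A B = det (mat N N (\<lambda>(i, j). if (A i - B j) mod int n = 0 then 1 else 0))"

lemma congruence_det_expand:
  "congruence_det N n A B = (\<Sum>p | p permutes {..<N}. of_int (sign p) *
      (if \<forall>i<N. (A i - B (p i)) mod int n = 0 then 1 else 0))"
proof -
  have "congruence_det N n A B = (\<Sum>p | p permutes {..<N}. of_int (sign p) *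
      (\<Prod>i<N. (if (A i - B (p i)) mod int n = 0 then 1 else 0)))"
    unfolding congruence_det_def
  proof (subst det_def'[of _ N], simp, unfold lessThan_atLeast0, intro sum.cong refl)
    fix p assume "p \<in> {p. p permutes {0..<N}}"
    then have "p i < N" if "i < N" for i
      using that permutes_in_image[of p "{0..<N}" i] by simp
    then show "of_int (sign p) * (\<Prod>i = 0..<N. mat N N (\<lambda>(i, j). if (A i - B j) mod int n = 0 then 1 else 0) $$ (i, p i))
       = (of_int (sign p) * (\<Prod>i = 0..<N. if (A i - B (p i)) mod int n = 0 then 1 else 0) :: rat)"
      by (intro arg_cong2[of _ _ _ _ "(*)"] refl prod.cong) auto
  qed
  moreover have "(\<Prod>i<N. (if (A i - B (p i)) mod int n = 0 then 1 else 0))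
      = (if \<forall>i<N. (A i - B (p i)) mod int n = 0 then 1 else (0::rat))" for p
  proof (cases "\<forall>i<N. (A i - B (p i)) mod int n = 0")
    case False
    then obtain i where i: "i < N" "(A i - B (p i)) mod int n \<noteq> 0" by blast
    have "(\<Prod>i<N. (if (A i - B (p i)) mod int n = 0 then 1 else 0)) = (0::rat)"
      by (rule prod_zero) (use i in auto)
    then show ?thesis by (simp only: if_not_P[OF False])
  qed (simp add: prod.neutral)
  ultimately show ?thesis by (simp only:)
qed

lemma congruence_det_alcove:
  assumes "alcove N n A" "alcove N n B" "(\<Sum>i<N. A i) = (\<Sum>i<N. B i)"
  shows "congruence_det N n A B = (if \<forall>i<N. A i = B i then 1 else 0)"
proof -
  define equal where "equal \<longleftrightarrow> (\<forall>i<N. A i = B i)"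
  define good where "good p \<longleftrightarrow> (\<forall>i<N. (A i - B (p i)) mod int n = 0)" for p
  have good: "good p \<longleftrightarrow> p = id \<and> equal" if "p permutes {..<N}" for p
  proof
    assume "good p"
    then show "p = id \<and> equal"
      using alcove_unique[OF assms(1,2) that _ assms(3)] unfolding equal_def good_def by blast
  next
    assume "p = id \<and> equal"
    then show "good p"
      by (auto simp: equal_def good_def)
  qed
  have "congruence_det N n A B = (\<Sum>p | p permutes {..<N}. of_int (sign p) * (if good p then 1 else 0))"
    unfolding congruence_det_expand good_def ..
  also have "\<dots> = (\<Sum>p | p permutes {..<N}. if p = id then (if equal then 1 else 0) else 0)"
    by (rule sum.cong) (auto simp: good)
  also have "\<dots> = (if equal then 1 else 0)"
    by (subst sum.delta) (auto simp: permutes_id finite_permutations)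
  finally show ?thesis by (simp only: equal_def)
qed

section \<open>The determinant of distances on a circle\<close>

text \<open>The number of steps in the positive direction from \<open>a\<close> to \<open>b\<close> on a circle with \<open>n\<close> points.\<close>

definition circle_dist :: "nat \<Rightarrow> int \<Rightarrow> int \<Rightarrow> nat" where
  "circle_dist n a b = nat ((b - a) mod int n)"

lemma int_circle_dist: "n > 0 \<Longrightarrow> int (circle_dist n a b) = (b - a) mod int n"
  by (simp add: circle_dist_def)

lemma circle_dist_less: "n > 0 \<Longrightarrow> circle_dist n a b < n"
  by (simp add: circle_dist_def nat_less_iff)

lemma circle_dist_eqI:
  assumes "int d = b - a" "d < n"
  shows "circle_dist n a b = d"
  using assms by (simp add: circle_dist_def flip: assms(1))

lemma circle_dist_eq_iff:
  assumes "d < n"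
  shows "circle_dist n a b = d \<longleftrightarrow> (a + int d - b) mod int n = 0"
proof -
  have "circle_dist n a b = d \<longleftrightarrow> int (circle_dist n a b) = int d" by simp
  also have "\<dots> \<longleftrightarrow> (b - a) mod int n = int d mod int n"
    using assms by (simp add: int_circle_dist)
  also have "\<dots> \<longleftrightarrow> int n dvd (b - a) - int d" by (rule mod_eq_dvd_iff)
  also have "\<dots> \<longleftrightarrow> int n dvd a + int d - b"
    by (metis (no_types, opaque_lifting) diff_diff_eq dvd_diff_commute)
  finally show ?thesis by (simp only: dvd_eq_mod_eq_0)
qed

lemma circle_dist_triangle:
  assumes n: "n > 0" and le: "circle_dist n c b \<le> circle_dist n a b"
  shows "circle_dist n a c + circle_dist n c b = circle_dist n a b"
proof -
  define d where "d = circle_dist n a b - circle_dist n c b"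
  have "int d = (b - a) mod int n - (b - c) mod int n"
    using le n by (simp add: d_def of_nat_diff int_circle_dist)
  moreover have "(b - a - (b - c)) mod int n = ((b - a) mod int n - (b - c) mod int n) mod int n"
    by (rule mod_diff_eq[symmetric])
  ultimately have "(c - a) mod int n = int d mod int n" by simp
  moreover have "d < n" using circle_dist_less[OF n, of a b] by (simp add: d_def)
  ultimately have "int (circle_dist n a c) = int d" using n by (simp add: int_circle_dist)
  then show ?thesis using le by (simp add: d_def)
qed

lemma coeff_det_monomial_matrix:
  fixes e :: "nat \<Rightarrow> nat \<Rightarrow> nat"
  shows "coeff (det (mat N N (\<lambda>(i, j). if Q i j then monom (1::rat) (e i j) else 0))) r
    = (\<Sum>p | p permutes {..<N}. of_int (sign p) *
        (if (\<forall>i<N. Q i (p i)) \<and> (\<Sum>i<N. e i (p i)) = r then 1 else 0))"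
proof -
  define M where "M = mat N N (\<lambda>(i, j). if Q i j then monom (1::rat) (e i j) else 0)"
  have "det M = (\<Sum>p | p permutes {..<N}. of_int (sign p) * (\<Prod>i<N. M $$ (i, p i)))"
    by (subst det_def'[of M N]) (auto simp: M_def lessThan_atLeast0)
  moreover have "(\<Prod>i<N. M $$ (i, p i)) = (if \<forall>i<N. Q i (p i) then monom 1 (\<Sum>i<N. e i (p i)) else 0)"
    if p: "p permutes {..<N}" for p
  proof -
    have pN: "p i < N" if "i < N" for i
      using permutes_in_image[OF p, of i] that by simp
    have "(\<Prod>i<N. M $$ (i, p i)) = (\<Prod>i<N. if Q i (p i) then monom (1::rat) (e i (p i)) else 0)"
      by (rule prod.cong) (auto simp: M_def pN)
    also have "\<dots> = (if \<forall>i<N. Q i (p i) then monom 1 (\<Sum>i<N. e i (p i)) else 0)"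
    proof (cases "\<forall>i<N. Q i (p i)")
      case True
      then have "(\<Prod>i<N. if Q i (p i) then monom (1::rat) (e i (p i)) else 0) = (\<Prod>i<N. monom 1 (e i (p i)))"
        by (intro prod.cong) auto
      also have "\<dots> = monom 1 (\<Sum>i<N. e i (p i))"
        by (induction N) (simp_all add: mult_monom)
      finally show ?thesis using True by simp
    next
      case False
      then obtain i where "i < N" "\<not> Q i (p i)" by blast
      then have "(\<Prod>i<N. if Q i (p i) then monom (1::rat) (e i (p i)) else 0) = 0"
        by (intro prod_zero) auto
      then show ?thesis using False by (simp only: if_False)
    qed
    finally show ?thesis .
  qed
  ultimately have "det M = (\<Sum>p | p permutes {..<N}. of_int (sign p) *
      (if \<forall>i<N. Q i (p i) then monom 1 (\<Sum>i<N. e i (p i)) else 0))"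
    by simp
  then have "coeff (det M) r = (\<Sum>p | p permutes {..<N}. coeff (of_int (sign p) *
      (if \<forall>i<N. Q i (p i) then monom 1 (\<Sum>i<N. e i (p i)) else 0)) r)"
    by (simp only: coeff_sum)
  also have "\<dots> = (\<Sum>p | p permutes {..<N}. of_int (sign p) *
        (if (\<forall>i<N. Q i (p i)) \<and> (\<Sum>i<N. e i (p i)) = r then 1 else 0))"
    by (rule sum.cong) (auto simp: of_int_poly)
  finally show ?thesis by (simp only: M_def)
qed

definition exponent_vec :: "nat \<Rightarrow> (nat \<Rightarrow> nat) \<Rightarrow> nat \<Rightarrow>\<^sub>0 nat" where
  "exponent_vec N f = (\<Sum>i<N. Poly_Mapping.single i (f i))"

lemma lookup_exponent_vec [simp]:
  "Poly_Mapping.lookup (exponent_vec N f) i = (if i < N then f i else 0)"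
proof -
  have "Poly_Mapping.lookup (exponent_vec N f) i = (\<Sum>j<N. if j = i then f j else 0)"
    unfolding exponent_vec_def lookup_sum by (intro sum.cong) (auto simp: lookup_single when_def)
  also have "\<dots> = (if i < N then f i else 0)"
    by (simp add: sum.delta)
  finally show ?thesis .
qed

lemma keys_exponent_vec: "Poly_Mapping.keys (exponent_vec N f) \<subseteq> {..<N}"
  by (auto simp: in_keys_iff split: if_splits)

text \<open>
  Because \<open>m < n\<close>, an exponent of degree \<open>m\<close> that moves \<open>A\<close> to a given permutation of \<open>B\<close> modulo \<open>n\<close>
  must consist of the distances on the circle.
\<close>

lemma sum_congruence_det_eq_coeff:
  assumes "m < n"
  shows "(\<Sum>\<beta>\<in>exponents {..<N} m. congruence_det N n (\<lambda>i. A i + int (Poly_Mapping.lookup \<beta> i)) B)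
    = coeff (det (mat N N (\<lambda>(i, j). monom 1 (circle_dist n (A i) (B j))))) m"
proof -
  define good where "good p \<beta> \<longleftrightarrow> (\<forall>i<N. (A i + int (Poly_Mapping.lookup \<beta> i) - B (p i)) mod int n = 0)" for p \<beta>
  have "(\<Sum>\<beta>\<in>exponents {..<N} m. if good p \<beta> then 1 else 0)
      = (if (\<Sum>i<N. circle_dist n (A i) (B (p i))) = m then 1 else (0::rat))" for p
  proof -
    define d where "d i = circle_dist n (A i) (B (p i))" for i
    have iff: "good p \<beta> \<longleftrightarrow> \<beta> = exponent_vec N d" if \<beta>: "\<beta> \<in> exponents {..<N} m" for \<beta>
    proof -
      have "Poly_Mapping.lookup \<beta> i < n" if "i < N" for i
      proof -
        have "Poly_Mapping.lookup \<beta> i \<le> (\<Sum>i<N. Poly_Mapping.lookup \<beta> i)"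
          by (rule member_le_sum) (use that in auto)
        then show ?thesis using \<beta> assms by (simp add: exponents_def)
      qed
      then have "good p \<beta> \<longleftrightarrow> (\<forall>i<N. d i = Poly_Mapping.lookup \<beta> i)"
        by (simp add: good_def d_def circle_dist_eq_iff)
      also have "\<dots> \<longleftrightarrow> \<beta> = exponent_vec N d"
      proof
        assume *: "\<forall>i<N. d i = Poly_Mapping.lookup \<beta> i"
        show "\<beta> = exponent_vec N d"
        proof (rule poly_mapping_eqI)
          fix i
          have "Poly_Mapping.lookup \<beta> i = 0" if "\<not> i < N"
            using \<beta> that by (auto simp: exponents_def in_keys_iff)
          then show "Poly_Mapping.lookup \<beta> i = Poly_Mapping.lookup (exponent_vec N d) i"
            using * by simp
        qed
      qed simp
      finally show ?thesis .
    qed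
    have mem: "exponent_vec N d \<in> exponents {..<N} m \<longleftrightarrow> (\<Sum>i<N. d i) = m"
      using keys_exponent_vec by (auto simp: exponents_def)
    have "(\<Sum>\<beta>\<in>exponents {..<N} m. if good p \<beta> then 1 else 0)
        = (\<Sum>\<beta>\<in>exponents {..<N} m. if \<beta> = exponent_vec N d then 1 else (0::rat))"
      by (rule sum.cong) (auto simp: iff)
    also have "\<dots> = (if (\<Sum>i<N. d i) = m then 1 else 0)"
      by (simp add: sum.delta finite_exponents mem)
    finally show ?thesis by (simp only: d_def)
  qed
  note count = this
  have "(\<Sum>\<beta>\<in>exponents {..<N} m. congruence_det N n (\<lambda>i. A i + int (Poly_Mapping.lookup \<beta> i)) B)
      = (\<Sum>\<beta>\<in>exponents {..<N} m. \<Sum>p | p permutes {..<N}. of_int (sign p) * (if good p \<beta> then 1 else 0))"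
    unfolding congruence_det_expand good_def ..
  also have "\<dots> = (\<Sum>p | p permutes {..<N}. of_int (sign p) * (\<Sum>\<beta>\<in>exponents {..<N} m. if good p \<beta> then 1 else 0))"
    by (subst sum.swap) (simp only: sum_distrib_left)
  also have "\<dots> = coeff (det (mat N N (\<lambda>(i, j). monom 1 (circle_dist n (A i) (B j))))) m"
    using coeff_det_monomial_matrix[of N "\<lambda>_ _. True" "\<lambda>i j. circle_dist n (A i) (B j)" m]
    by (simp add: count)
  finally show ?thesis .
qed

text \<open>\<open>A l\<close> is the last point of \<open>A\<close> that is met on the way to \<open>b\<close>.\<close>

definition nearest :: "nat \<Rightarrow> nat \<Rightarrow> (nat \<Rightarrow> int) \<Rightarrow> nat \<Rightarrow> int \<Rightarrow> bool" where
  "nearest N n A l b \<longleftrightarrow> (\<forall>i<N. circle_dist n (A l) b \<le> circle_dist n (A i) b)"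

lemma ex1_nearest:
  assumes A: "alcove N n A" and "N > 0" "n > 0"
  shows "\<exists>!l. l < N \<and> nearest N n A l b"
proof -
  obtain l where l: "l \<in> {..<N}" and min: "\<And>i. i \<in> {..<N} \<Longrightarrow> circle_dist n (A l) b \<le> circle_dist n (A i) b"
    using ex_is_arg_min_if_finite[of "{..<N}" "\<lambda>l. circle_dist n (A l) b"] assms(2)
    unfolding is_arg_min_linorder by blast
  show ?thesis
  proof (rule ex1I[of _ l])
    show "l < N \<and> nearest N n A l b" using l min by (auto simp: nearest_def)
  next
    fix l' assume l': "l' < N \<and> nearest N n A l' b"
    then have "circle_dist n (A l') b = circle_dist n (A l) b"
      using l min[of l'] by (auto simp: nearest_def intro: antisym)
    then have "(b - A l') mod int n = (b - A l) mod int n"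
      using assms(3) by (metis int_circle_dist)
    then have "int n dvd (b - A l') - (b - A l)" by (simp only: mod_eq_dvd_iff)
    then have "(A l - A l') mod int n = 0" by simp
    then show "l' = l" using alcove_inj_mod[OF A, of l l'] l l' by simp
  qed
qed

text \<open>
  A walk from \<open>A i\<close> to \<open>B j\<close> can be broken at the last point of \<open>A\<close> before \<open>B j\<close>.  This replaces the
  sign-reversing involution by which crossing pairs of walks would be cancelled, and which is
  awkward on a circle.
\<close>

lemma circle_dist_matrix_factor:
  assumes A: "alcove N n A" and "n > 0"
  shows "mat N N (\<lambda>(i, j). monom (1::rat) (circle_dist n (A i) (B j)))
    = mat N N (\<lambda>(i, l). monom 1 (circle_dist n (A i) (A l)))
      * mat N N (\<lambda>(l, j). if nearest N n A l (B j) then monom 1 (circle_dist n (A l) (B j)) else 0)"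
    (is "?D = ?G * ?E")
proof (rule eq_matI)
  fix i j assume "i < dim_row (?G * ?E)" "j < dim_col (?G * ?E)"
  then have ij: "i < N" "j < N" by auto
  obtain l where l: "l < N" "nearest N n A l (B j)"
    and uniq: "\<And>l'. l' < N \<Longrightarrow> nearest N n A l' (B j) \<Longrightarrow> l' = l"
    using ex1_nearest[OF A _ assms(2), of "B j"] ij(1) by (metis gr0I not_less_zero)
  have "(?G * ?E) $$ (i, j) = (\<Sum>l'<N. monom 1 (circle_dist n (A i) (A l')) *
      (if nearest N n A l' (B j) then monom 1 (circle_dist n (A l') (B j)) else 0))"
    using ij by (simp add: scalar_prod_def lessThan_atLeast0)
  also have "\<dots> = (\<Sum>l'<N. if l' = l then monom 1 (circle_dist n (A i) (A l) + circle_dist n (A l) (B j)) else 0)"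
  proof (rule sum.cong)
    fix l' assume "l' \<in> {..<N}"
    then have "nearest N n A l' (B j) \<longleftrightarrow> l' = l" using l uniq by blast
    then show "monom 1 (circle_dist n (A i) (A l')) * (if nearest N n A l' (B j) then monom 1 (circle_dist n (A l') (B j)) else 0)
        = (if l' = l then monom (1::rat) (circle_dist n (A i) (A l) + circle_dist n (A l) (B j)) else 0)"
      by (simp add: mult_monom)
  qed simp
  also have "\<dots> = monom 1 (circle_dist n (A i) (A l) + circle_dist n (A l) (B j))"
    using l by (simp add: sum.delta)
  also have "circle_dist n (A i) (A l) + circle_dist n (A l) (B j) = circle_dist n (A i) (B j)"
    by (rule circle_dist_triangle[OF assms(2)]) (use l ij in \<open>simp add: nearest_def\<close>)
  finally show "?D $$ (i, j) = (?G * ?E) $$ (i, j)" using ij by simp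
qed auto

text \<open>
  Walks that permute the points of \<open>A\<close> have total length divisible by \<open>n\<close>, and length zero only if
  nothing moves.
\<close>

lemma coeff_det_self_circle_dist:
  assumes A: "alcove N n A" and r: "r < n"
  shows "coeff (det (mat N N (\<lambda>(i, j). monom (1::rat) (circle_dist n (A i) (A j))))) r = (if r = 0 then 1 else 0)"
proof -
  have n: "n > 0" using r by simp
  have iff: "(\<Sum>i<N. circle_dist n (A i) (A (p i))) = r \<longleftrightarrow> r = 0 \<and> p = id" if p: "p permutes {..<N}" for p
  proof
    assume sum: "(\<Sum>i<N. circle_dist n (A i) (A (p i))) = r"
    have "int r mod int n = (\<Sum>i<N. (A (p i) - A i) mod int n) mod int n"
      using n by (simp add: int_circle_dist flip: sum)
    also have "\<dots> = (\<Sum>i<N. A (p i) - A i) mod int n"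
      by (rule mod_sum_eq)
    also have "(\<Sum>i<N. A (p i) - A i) = 0"
      using sum.permute[OF p, of A] by (simp add: sum_subtractf o_def)
    finally have "r = 0" using r by simp
    have "p i = i" if i: "i < N" for i
    proof -
      have "circle_dist n (A i) (A (p i)) = 0"
        using sum \<open>r = 0\<close> i by simp
      then have "(A (p i) - A i) mod int n = 0"
        using int_circle_dist[OF n, of "A i" "A (p i)"] by simp
      moreover have "p i < N" using permutes_in_image[OF p, of i] i by simp
      ultimately show ?thesis using alcove_inj_mod[OF A, of "p i" i] i by simp
    qed
    then have "p = id" by (rule permutes_fixing_imp_id[OF p])
    with \<open>r = 0\<close> show "r = 0 \<and> p = id" by simp
  qed (simp add: circle_dist_def)
  have "coeff (det (mat N N (\<lambda>(i, j). monom (1::rat) (circle_dist n (A i) (A j))))) r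
      = (\<Sum>p | p permutes {..<N}. of_int (sign p) * (if (\<Sum>i<N. circle_dist n (A i) (A (p i))) = r then 1 else 0))"
    using coeff_det_monomial_matrix[of N "\<lambda>_ _. True" "\<lambda>i j. circle_dist n (A i) (A j)" r] by simp
  also have "\<dots> = (\<Sum>p | p permutes {..<N}. if p = id then (if r = 0 then 1 else 0) else 0)"
    by (rule sum.cong) (auto simp: iff)
  also have "\<dots> = (if r = 0 then 1 else 0)"
    by (subst sum.delta) (auto simp: permutes_id finite_permutations)
  finally show ?thesis .
qed

text \<open>
  Each point moves from \<open>A i\<close> up to \<open>B i\<close> without reaching the next point of the periodic
  continuation of \<open>A\<close>.
\<close>

definition interlaces :: "nat \<Rightarrow> nat \<Rightarrow> (nat \<Rightarrow> int) \<Rightarrow> (nat \<Rightarrow> int) \<Rightarrow> bool" where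
  "interlaces N n A B \<longleftrightarrow> (\<forall>i<N. A i \<le> B i \<and> (\<forall>j<i. B i < A j) \<and> (\<forall>j<N. B i < A j + int n))"

text \<open>
  Any point of the periodic continuation of \<open>A\<close> strictly after \<open>A l\<close> and not after the target
  would be nearer to the target.
\<close>

lemma nearest_imp_bounds:
  assumes A: "alcove N n A" and l: "l < N" and near: "nearest N n A l b" and n: "n > 0"
  defines "d \<equiv> int (circle_dist n (A l) b)"
  shows "i < l \<Longrightarrow> A l + d < A i" and "i < N \<Longrightarrow> A l + d < A i + int n"
proof -
  have d: "0 \<le> d" "d < int n"
    using circle_dist_less[OF n, of "A l" b] by (auto simp: d_def)
  have cong: "int n dvd A l + d - b"
    using circle_dist_eq_iff[OF circle_dist_less[OF n], of "A l" b "A l" b]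
    by (simp add: d_def mod_0_imp_dvd)
  have key: False if "i < N" "int n dvd c - A i" "c \<le> A l + d" "A l < c" for i c
  proof -
    define e where "e = nat (A l + d - c)"
    have e: "int e = A l + d - c" "int e < d" using that by (auto simp: e_def)
    have "int n dvd (A l + d - b) + - (c - A i)" by (intro dvd_add dvd_minus_iff[THEN iffD2] cong that(2))
    then have "(A i + int e - b) mod int n = 0" by (simp add: e algebra_simps)
    then have "circle_dist n (A i) b = e"
      by (subst circle_dist_eq_iff) (use e d in auto)
    then have "int (circle_dist n (A i) b) < int (circle_dist n (A l) b)" using e d_def by simp
    with near that(1) show False by (auto simp: nearest_def)
  qed
  show "A l + d < A i" if "i < l"
    using key[of i "A i"] that l alcove_decreasing[OF A that l] by force
  show "A l + d < A i + int n" if "i < N"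
    using key[of i "A i + int n"] that l alcove_span[OF A l that] by force
qed

lemma interlaces_imp_dist:
  assumes "interlaces N n A B" "alcove N n A" "l < N" "n > 0"
  shows "int (circle_dist n (A l) (B l)) = B l - A l" "nearest N n A l (B l)"
proof -
  have b: "A l \<le> B l" "\<And>j. j < l \<Longrightarrow> B l < A j" "\<And>j. j < N \<Longrightarrow> B l < A j + int n"
    using assms by (auto simp: interlaces_def)
  have dl: "circle_dist n (A l) (B l) = nat (B l - A l)"
    by (rule circle_dist_eqI) (use b(1) b(3)[OF assms(3)] in auto)
  then show "int (circle_dist n (A l) (B l)) = B l - A l" using b by simp
  show "nearest N n A l (B l)"
    unfolding nearest_def
  proof (intro allI impI)
    fix i assume i: "i < N"
    show "circle_dist n (A l) (B l) \<le> circle_dist n (A i) (B l)"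
    proof (cases "i < l")
      case True
      have "circle_dist n (A i) (B l) = nat (B l - A i + int n)"
      proof -
        have "circle_dist n (A i) (B l + int n) = nat (B l - A i + int n)"
          by (rule circle_dist_eqI)
            (use b(1) b(2)[OF True] alcove_span[OF assms(2) i assms(3)] in auto)
        moreover have "circle_dist n (A i) (B l + int n) = circle_dist n (A i) (B l)"
        proof -
          have "B l + int n - A i = (B l - A i) + int n" by simp
          then show ?thesis unfolding circle_dist_def by (simp only: mod_add_self2)
        qed
        ultimately show ?thesis by simp
      qed
      then show ?thesis using dl alcove_span[OF assms(2) i assms(3)] by simp
    next
      case False
      then have "A i \<le> A l" using alcove_decreasing[OF assms(2), of l i] i by (cases "i = l") auto
      moreover have "circle_dist n (A i) (B l) = nat (B l - A i)"
        by (rule circle_dist_eqI) (use b(1) b(3)[OF i] \<open>A i \<le> A l\<close> in auto)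
      ultimately show ?thesis using dl by simp
    qed
  qed
qed

text \<open>
  If every point walks to its target without passing another point of \<open>A\<close>, then the end points
  form an alcove sequence with the sum of \<open>B\<close>, hence they are \<open>B\<close> itself; so only the identity
  contributes.
\<close>

lemma coeff_det_nearest:
  assumes A: "alcove N n A" and B: "alcove N n B" and n: "n > 0"
    and sum: "(\<Sum>i<N. B i) = (\<Sum>i<N. A i) + int m"
  shows "coeff (det (mat N N (\<lambda>(l, j). if nearest N n A l (B j) then monom (1::rat) (circle_dist n (A l) (B j)) else 0))) m
     = (if interlaces N n A B then 1 else 0)"
proof -
  define good where "good p \<longleftrightarrow> (\<forall>l<N. nearest N n A l (B (p l))) \<and> (\<Sum>l<N. circle_dist n (A l) (B (p l))) = m" for p
  have good: "good p \<longleftrightarrow> p = id \<and> interlaces N n A B" if p: "p permutes {..<N}" for p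
  proof
    assume "good p"
    then have near: "\<And>l. l < N \<Longrightarrow> nearest N n A l (B (p l))"
      and m: "(\<Sum>l<N. circle_dist n (A l) (B (p l))) = m" by (auto simp: good_def)
    \<comment> \<open>the end points of the walks, as integers\<close>
    define C where "C l = A l + int (circle_dist n (A l) (B (p l)))" for l
    have bounds: "i < l \<Longrightarrow> C l < A i" "i < N \<Longrightarrow> C l < A i + int n" "A l \<le> C l" if "l < N" for i l
      using nearest_imp_bounds[OF A that near[OF that] n, of i] by (auto simp: C_def)
    have "alcove N n C"
      unfolding alcove_def
    proof (intro conjI allI impI)
      fix i j assume "i < j" "j < N"
      then show "C j < C i" using bounds(1)[of j i] bounds(3)[of i] by simp
    next
      fix i j assume "i < N" "j < N"
      then show "C i < C j + int n" using bounds(2)[of i j] bounds(3)[of j] by simp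
    qed
    moreover have "(C i - B (p i)) mod int n = 0" for i
      unfolding C_def using circle_dist_eq_iff[OF circle_dist_less[OF n]] by blast
    moreover have "(\<Sum>i<N. C i) = (\<Sum>i<N. B i)"
      by (simp add: C_def sum.distrib sum flip: m)
    ultimately have *: "\<forall>i<N. C i = B i" "p = id"
      using alcove_unique[OF _ B p, of C] by blast+
    have "interlaces N n A C"
      unfolding interlaces_def using bounds by blast
    then have "interlaces N n A B"
      using *(1) by (simp add: interlaces_def)
    then show "p = id \<and> interlaces N n A B" using * by simp
  next
    assume *: "p = id \<and> interlaces N n A B"
    then have il: "interlaces N n A B" by simp
    have "int (\<Sum>l<N. circle_dist n (A l) (B l)) = (\<Sum>l<N. B l - A l)"
      unfolding of_nat_sum by (rule sum.cong) (use interlaces_imp_dist(1)[OF il A _ n] in auto)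
    also have "\<dots> = int m" using sum by (simp add: sum_subtractf)
    finally have "(\<Sum>l<N. circle_dist n (A l) (B l)) = m" by (simp only: of_nat_eq_iff)
    then show "good p" using * interlaces_imp_dist(2)[OF il A _ n] by (auto simp: good_def)
  qed
  have "coeff (det (mat N N (\<lambda>(l, j). if nearest N n A l (B j) then monom (1::rat) (circle_dist n (A l) (B j)) else 0))) m
      = (\<Sum>p | p permutes {..<N}. of_int (sign p) * (if good p then 1 else 0))"
    unfolding coeff_det_monomial_matrix good_def ..
  also have "\<dots> = (\<Sum>p | p permutes {..<N}. if p = id then (if interlaces N n A B then 1 else 0) else 0)"
    by (rule sum.cong) (auto simp: good)
  also have "\<dots> = (if interlaces N n A B then 1 else 0)"
    by (subst sum.delta) (auto simp: permutes_id finite_permutations)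
  finally show ?thesis .
qed

text \<open>
  In the factorization \<open>circle_dist_matrix_factor\<close> the determinant of the first factor is \<open>1\<close>
  modulo \<open>q\<^sup>n\<close>, so that it does not affect the coefficient of \<open>q\<^sup>m\<close>.
\<close>

lemma sum_congruence_det_eq_interlaces:
  assumes A: "alcove N n A" and B: "alcove N n B" and m: "m < n"
    and sum: "(\<Sum>i<N. B i) = (\<Sum>i<N. A i) + int m"
  shows "(\<Sum>\<beta>\<in>exponents {..<N} m. congruence_det N n (\<lambda>i. A i + int (Poly_Mapping.lookup \<beta> i)) B)
    = (if interlaces N n A B then 1 else 0)"
proof -
  define G where "G = mat N N (\<lambda>(i, l). monom (1::rat) (circle_dist n (A i) (A l)))"
  define E where "E = mat N N (\<lambda>(l, j). if nearest N n A l (B j) then monom (1::rat) (circle_dist n (A l) (B j)) else 0)"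
  have n: "n > 0" using m by simp
  have "(\<Sum>\<beta>\<in>exponents {..<N} m. congruence_det N n (\<lambda>i. A i + int (Poly_Mapping.lookup \<beta> i)) B)
      = coeff (det (G * E)) m"
    by (simp only: sum_congruence_det_eq_coeff[OF m] G_def E_def flip: circle_dist_matrix_factor[OF A n])
  also have "det (G * E) = det G * det E"
    by (rule det_mult) (auto simp: G_def E_def)
  also have "coeff (det G * det E) m = (\<Sum>r\<le>m. coeff (det G) r * coeff (det E) (m - r))"
    by (rule coeff_mult)
  also have "\<dots> = (\<Sum>r\<le>m. if r = 0 then coeff (det E) m else 0)"
    by (rule sum.cong) (use coeff_det_self_circle_dist[OF A] m in \<open>auto simp: G_def\<close>)
  also have "\<dots> = coeff (det E) m" by simp
  also have "\<dots> = (if interlaces N n A B then 1 else 0)"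
    unfolding E_def by (rule coeff_det_nearest[OF A B n sum])
  finally show ?thesis .
qed

section \<open>The ring of symmetric polynomials\<close>

lemma lookup_map_key: "inj \<pi> \<Longrightarrow> Poly_Mapping.lookup (Poly_Mapping.map_key \<pi> m) i = Poly_Mapping.lookup m (\<pi> i)"
  by (simp add: map_key.rep_eq)

lemma map_key_inverse:
  assumes "\<pi> permutes S"
  shows "Poly_Mapping.map_key \<pi> (Poly_Mapping.map_key (inv' \<pi>) m) = m"
    "Poly_Mapping.map_key (inv' \<pi>) (Poly_Mapping.map_key \<pi> m) = m"
proof -
  have inj: "inj \<pi>" "inj (inv' \<pi>)"
    using assms permutes_inv[OF assms] permutes_inj by blast+
  show "Poly_Mapping.map_key \<pi> (Poly_Mapping.map_key (inv' \<pi>) m) = m"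
    by (rule poly_mapping_eqI) (simp add: lookup_map_key inj permutes_inverses[OF assms])
  show "Poly_Mapping.map_key (inv' \<pi>) (Poly_Mapping.map_key \<pi> m) = m"
    by (rule poly_mapping_eqI) (simp add: lookup_map_key inj permutes_inverses[OF assms])
qed

lemma inj_map_key:
  assumes "\<pi> permutes S" shows "inj (Poly_Mapping.map_key \<pi> :: (nat \<Rightarrow>\<^sub>0 nat) \<Rightarrow> _)"
  by (rule inj_on_inverseI[where g = "Poly_Mapping.map_key (inv' \<pi>)"]) (rule map_key_inverse[OF assms])

lemma keys_map_key_permutes:
  assumes "\<pi> permutes {..<N}" "Poly_Mapping.keys m \<subseteq> {..<N}"
  shows "Poly_Mapping.keys (Poly_Mapping.map_key \<pi> m) \<subseteq> {..<N}"
  using assms permutes_in_image[OF assms(1)] permutes_inj[OF assms(1)]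
  by (auto simp: keys_map_key subset_iff)

lemma sum_lookup_map_key:
  assumes "\<pi> permutes {..<N}"
  shows "(\<Sum>i<N. Poly_Mapping.lookup (Poly_Mapping.map_key \<pi> m) i) = (\<Sum>i<N. Poly_Mapping.lookup m i)"
  using sum.permute[OF assms, of "Poly_Mapping.lookup m"] permutes_inj[OF assms]
  by (simp add: lookup_map_key o_def)

lemma poly_mapping_sum_single:
  "f = (\<Sum>m\<in>Poly_Mapping.keys f. Poly_Mapping.single m (Poly_Mapping.lookup f m))"
proof (rule poly_mapping_eqI)
  fix k
  have "Poly_Mapping.lookup (\<Sum>m\<in>Poly_Mapping.keys f. Poly_Mapping.single m (Poly_Mapping.lookup f m)) k
      = (\<Sum>m\<in>Poly_Mapping.keys f. if m = k then Poly_Mapping.lookup f m else 0)"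
    unfolding lookup_sum by (intro sum.cong) (auto simp: lookup_single when_def)
  also have "\<dots> = Poly_Mapping.lookup f k"
    by (simp add: sum.delta in_keys_iff)
  finally show "Poly_Mapping.lookup f k
     = Poly_Mapping.lookup (\<Sum>m\<in>Poly_Mapping.keys f. Poly_Mapping.single m (Poly_Mapping.lookup f m)) k" by simp
qed

lemma lookup_permute_vars:
  assumes "\<pi> permutes S"
  shows "Poly_Mapping.lookup (permute_vars \<pi> f) m = Poly_Mapping.lookup f (Poly_Mapping.map_key \<pi> m)"
  by (simp add: permute_vars_def lookup_map_key inj_map_key[OF assms])

lemma permute_vars_add:
  assumes "\<pi> permutes S"
  shows "permute_vars \<pi> (f + g) = permute_vars \<pi> f + permute_vars \<pi> g"
  unfolding permute_vars_def by (rule map_key_plus[OF inj_map_key[OF assms]])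

lemma permute_vars_sum:
  assumes "\<pi> permutes S"
  shows "permute_vars \<pi> (\<Sum>i\<in>I. f i) = (\<Sum>i\<in>I. permute_vars \<pi> (f i))"
  by (induction I rule: infinite_finite_induct)
    (simp_all add: permute_vars_add[OF assms], simp_all add: permute_vars_def map_key_zero[OF inj_map_key[OF assms]])

lemma permute_vars_single:
  assumes "\<pi> permutes S"
  shows "permute_vars \<pi> (Poly_Mapping.single m c) = Poly_Mapping.single (Poly_Mapping.map_key (inv' \<pi>) m) c"
  unfolding permute_vars_def
  using map_key_single[OF inj_map_key[OF assms], of "Poly_Mapping.map_key (inv' \<pi>) m" c]
  by (simp only: map_key_inverse[OF assms])

lemma permute_vars_mult:
  assumes "\<pi> permutes S"
  shows "permute_vars \<pi> (f * g) = permute_vars \<pi> f * permute_vars \<pi> g"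
proof -
  have inj: "inj (inv' \<pi>)"
    using permutes_inv[OF assms] permutes_inj by blast
  have "permute_vars \<pi> ((\<Sum>a\<in>A. Poly_Mapping.single a (x a)) * (\<Sum>b\<in>B. Poly_Mapping.single b (y b)))
      = permute_vars \<pi> (\<Sum>a\<in>A. Poly_Mapping.single a (x a)) * permute_vars \<pi> (\<Sum>b\<in>B. Poly_Mapping.single b (y b))"
    for A B x y
    by (simp add: sum_product mult_single permute_vars_sum[OF assms] permute_vars_single[OF assms] map_key_plus[OF inj])
  from this[where A = "Poly_Mapping.keys f" and x = "Poly_Mapping.lookup f"
      and B = "Poly_Mapping.keys g" and y = "Poly_Mapping.lookup g"]
  show ?thesis by (simp only: flip: poly_mapping_sum_single)
qed

lemma carrier_sym_ring:
  "carrier (sym_ring N) = {f. (\<forall>m\<in>Poly_Mapping.keys f. Poly_Mapping.keys m \<subseteq> {..<N}) \<and>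
     (\<forall>\<pi>. \<pi> permutes {..<N} \<longrightarrow> permute_vars \<pi> f = f)}"
  by (simp add: sym_ring_def)

lemma sym_ring_lookup_map_key:
  assumes "f \<in> carrier (sym_ring N)" "\<pi> permutes {..<N}"
  shows "Poly_Mapping.lookup f (Poly_Mapping.map_key \<pi> m) = Poly_Mapping.lookup f m"
  using assms lookup_permute_vars[OF assms(2), of f m] by (simp add: carrier_sym_ring)

lemma sym_ring_add: "f \<in> carrier (sym_ring N) \<Longrightarrow> g \<in> carrier (sym_ring N) \<Longrightarrow> f + g \<in> carrier (sym_ring N)"
proof -
  assume f: "f \<in> carrier (sym_ring N)" and g: "g \<in> carrier (sym_ring N)"
  have "Poly_Mapping.keys m \<subseteq> {..<N}" if "m \<in> Poly_Mapping.keys (f + g)" for m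
  proof -
    have "m \<in> Poly_Mapping.keys f \<or> m \<in> Poly_Mapping.keys g"
      using Poly_Mapping.keys_add[of f g] that by auto
    then show ?thesis using f g by (auto simp: carrier_sym_ring)
  qed
  then show ?thesis using f g by (simp add: carrier_sym_ring permute_vars_add)
qed

lemma sym_ring_mult: "f \<in> carrier (sym_ring N) \<Longrightarrow> g \<in> carrier (sym_ring N) \<Longrightarrow> f * g \<in> carrier (sym_ring N)"
proof -
  assume f: "f \<in> carrier (sym_ring N)" and g: "g \<in> carrier (sym_ring N)"
  have "Poly_Mapping.keys m \<subseteq> {..<N}" if m: "m \<in> Poly_Mapping.keys (f * g)" for m
  proof -
    obtain a b where "m = a + b" "a \<in> Poly_Mapping.keys f" "b \<in> Poly_Mapping.keys g"
      using keys_mult[of f g] m by auto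
    then show ?thesis
      using f g Poly_Mapping.keys_add[of a b] by (force simp: carrier_sym_ring)
  qed
  then show ?thesis using f g by (simp add: carrier_sym_ring permute_vars_mult)
qed

lemma sym_ring_const: "Poly_Mapping.single 0 c \<in> carrier (sym_ring N)"
  by (auto simp: carrier_sym_ring permute_vars_single map_key_zero permutes_inj[OF permutes_inv])

lemma sym_ring_0: "0 \<in> carrier (sym_ring N)"
  using sym_ring_const[of 0] by simp

lemma sym_ring_1: "1 \<in> carrier (sym_ring N)"
  using sym_ring_const[of 1] by simp

lemma sym_ring_uminus: "f \<in> carrier (sym_ring N) \<Longrightarrow> - f \<in> carrier (sym_ring N)"
  using sym_ring_mult[OF sym_ring_const[of "-1" N], of f] by (simp add: single_uminus)

lemma sym_ring_diff: "f \<in> carrier (sym_ring N) \<Longrightarrow> g \<in> carrier (sym_ring N) \<Longrightarrow> f - g \<in> carrier (sym_ring N)"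
  using sym_ring_add[OF _ sym_ring_uminus, of f N g] by simp

lemma sym_ring_sum: "(\<And>i. i \<in> I \<Longrightarrow> f i \<in> carrier (sym_ring N)) \<Longrightarrow> (\<Sum>i\<in>I. f i) \<in> carrier (sym_ring N)"
  by (induction I rule: infinite_finite_induct) (auto intro: sym_ring_0 sym_ring_add)

lemma sym_ring_prod: "(\<And>i. i \<in> I \<Longrightarrow> f i \<in> carrier (sym_ring N)) \<Longrightarrow> (\<Prod>i\<in>I. f i) \<in> carrier (sym_ring N)"
  by (induction I rule: infinite_finite_induct) (auto intro: sym_ring_1 sym_ring_mult)

lemma mult_sym_ring [simp]: "x \<otimes>\<^bsub>sym_ring N\<^esub> y = x * y"
  and add_sym_ring [simp]: "x \<oplus>\<^bsub>sym_ring N\<^esub> y = x + y"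
  and zero_sym_ring [simp]: "\<zero>\<^bsub>sym_ring N\<^esub> = 0"
  and one_sym_ring [simp]: "\<one>\<^bsub>sym_ring N\<^esub> = 1"
  by (simp_all add: sym_ring_def)

lemma cring_sym_ring: "cring (sym_ring N)"
proof (rule cringI)
  show "abelian_group (sym_ring N)"
  proof (rule abelian_groupI)
    fix f assume "f \<in> carrier (sym_ring N)"
    then show "\<exists>g\<in>carrier (sym_ring N). g \<oplus>\<^bsub>sym_ring N\<^esub> f = \<zero>\<^bsub>sym_ring N\<^esub>"
      using sym_ring_uminus[of f] by (intro bexI[of _ "- f"]) auto
  qed (auto simp: sym_ring_add sym_ring_0)
  show "Group.comm_monoid (sym_ring N)"
    by (rule comm_monoidI) (auto simp: sym_ring_mult sym_ring_1 mult_ac)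
qed (simp add: algebra_simps)

lemma det_in_sym_ring:
  assumes "\<And>i j. i < N' \<Longrightarrow> j < N' \<Longrightarrow> M i j \<in> carrier (sym_ring N)"
  shows "det (mat N' N' (\<lambda>(i, j). M i j)) \<in> carrier (sym_ring N)"
proof -
  have "det (mat N' N' (\<lambda>(i, j). M i j))
     = (\<Sum>p | p permutes {0..<N'}. signof p * (\<Prod>i = 0..<N'. mat N' N' (\<lambda>(i, j). M i j) $$ (i, p i)))"
    by (rule det_def') simp
  also have "\<dots> \<in> carrier (sym_ring N)"
  proof (intro sym_ring_sum sym_ring_mult sym_ring_prod)
    fix p i assume "p \<in> {p. p permutes {0..<N'}}" "i \<in> {0..<N'}"
    then have "i < N'" "p i < N'" using permutes_in_image[of p "{0..<N'}" i] by auto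
    then show "mat N' N' (\<lambda>(i, j). M i j) $$ (i, p i) \<in> carrier (sym_ring N)"
      using assms by simp
  next
    fix p show "of_int (sign p) \<in> carrier (sym_ring N)"
      using sym_ring_1 sym_ring_uminus[OF sym_ring_1] by (simp add: sign_def)
  qed
  finally show ?thesis .
qed

definition monomial_sum :: "(nat \<Rightarrow>\<^sub>0 nat) set \<Rightarrow> rat_mpoly" where
  "monomial_sum S = (\<Sum>m\<in>S. Poly_Mapping.single m 1)"

lemma lookup_monomial_sum:
  assumes "finite S"
  shows "Poly_Mapping.lookup (monomial_sum S) m = (if m \<in> S then 1 else 0)"
proof -
  have "Poly_Mapping.lookup (monomial_sum S) m = (\<Sum>k\<in>S. if k = m then 1 else 0)"
    unfolding monomial_sum_def lookup_sum by (intro sum.cong) (auto simp: lookup_single when_def)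
  also have "\<dots> = (if m \<in> S then 1 else 0)"
    using assms by (simp add: sum.delta)
  finally show ?thesis .
qed

lemma keys_monomial_sum: "finite S \<Longrightarrow> Poly_Mapping.keys (monomial_sum S) = S"
  by (auto simp: in_keys_iff lookup_monomial_sum split: if_splits)

text \<open>The source of all symmetric polynomials below, apart from determinants of these.\<close>

lemma monomial_sum_in_sym_ring:
  assumes fin: "finite S" and keys: "\<And>m. m \<in> S \<Longrightarrow> Poly_Mapping.keys m \<subseteq> {..<N}"
    and perm: "\<And>\<pi> m. \<pi> permutes {..<N} \<Longrightarrow> m \<in> S \<Longrightarrow> Poly_Mapping.map_key \<pi> m \<in> S"
  shows "monomial_sum S \<in> carrier (sym_ring N)"
proof -
  have "permute_vars \<pi> (monomial_sum S) = monomial_sum S" if \<pi>: "\<pi> permutes {..<N}" for \<pi>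
  proof (rule poly_mapping_eqI)
    fix m
    have "Poly_Mapping.map_key \<pi> m \<in> S \<longleftrightarrow> m \<in> S"
      using perm[OF \<pi>, of m] perm[OF permutes_inv[OF \<pi>], of "Poly_Mapping.map_key \<pi> m"]
      by (auto simp: map_key_inverse[OF \<pi>])
    then show "Poly_Mapping.lookup (permute_vars \<pi> (monomial_sum S)) m = Poly_Mapping.lookup (monomial_sum S) m"
      by (simp add: lookup_permute_vars[OF \<pi>] lookup_monomial_sum[OF fin])
  qed
  then show ?thesis using keys by (auto simp: carrier_sym_ring keys_monomial_sum[OF fin])
qed

lemma complete_sum_eq_monomial_sum: "complete_sum A d = monomial_sum (exponents A d)"
  by (simp add: complete_sum_def monomial_sum_def)

lemma complete_sum_in_sym_ring: "complete_sum {..<N} d \<in> carrier (sym_ring N)"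
  unfolding complete_sum_eq_monomial_sum
  by (rule monomial_sum_in_sym_ring)
    (auto simp: exponents_def sum_lookup_map_key finite_exponents[unfolded exponents_def]
      dest: keys_map_key_permutes)

lemma schur_in_sym_ring: "schur N \<mu> \<in> carrier (sym_ring N)"
  unfolding schur_def complete_homogeneous_eq
  by (rule det_in_sym_ring) (simp add: complete_sum_in_sym_ring sym_ring_0)

section \<open>Alternants and linear functionals\<close>

definition alternant :: "nat \<Rightarrow> (nat \<Rightarrow>\<^sub>0 nat) \<Rightarrow> rat_mpoly" where
  "alternant N \<alpha> = (\<Sum>\<pi> | \<pi> permutes {..<N}. Poly_Mapping.single (Poly_Mapping.map_key \<pi> \<alpha>) (of_int (sign \<pi>)))"

lemma var_power: "var i ^ d = Poly_Mapping.single (Poly_Mapping.single i d) 1"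
  by (induction d) (simp_all add: var_def mult_single flip: single_add)

lemma prod_var_power: "(\<Prod>i\<in>I. var i ^ f i) = Poly_Mapping.single (\<Sum>i\<in>I. Poly_Mapping.single i (f i)) 1"
  by (induction I rule: infinite_finite_induct) (simp_all add: var_power mult_single)

text \<open>
  Expansion along columns makes the sum over permutations one over the rearrangements of \<open>\<alpha>\<close>.
\<close>

lemma det_var_matrix: "det (var_matrix N \<alpha>) = alternant N (exponent_vec N \<alpha>)"
proof -
  have "det (var_matrix N \<alpha>)
      = (\<Sum>p | p permutes {0..<N}. signof p * (\<Prod>j<N. var_matrix N \<alpha> $$ (p j, j)))"
    by (rule det_col) (simp add: var_matrix_def)
  also have "\<dots> = alternant N (exponent_vec N \<alpha>)"
    unfolding alternant_def lessThan_atLeast0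
  proof (intro sum.cong refl)
    fix p assume "p \<in> {p. p permutes {0..<N}}"
    then have p: "p permutes {..<N}" by (simp add: lessThan_atLeast0)
    have pN: "p j < N \<longleftrightarrow> j < N" for j using permutes_in_image[OF p, of j] by simp
    have "(\<Prod>j = 0..<N. var_matrix N \<alpha> $$ (p j, j)) = (\<Prod>j<N. var j ^ \<alpha> (p j))"
      by (intro prod.cong) (auto simp: var_matrix_def pN)
    also have "\<dots> = Poly_Mapping.single (exponent_vec N (\<lambda>j. \<alpha> (p j))) 1"
      by (simp add: prod_var_power exponent_vec_def)
    also have "exponent_vec N (\<lambda>j. \<alpha> (p j)) = Poly_Mapping.map_key p (exponent_vec N \<alpha>)"
      by (rule poly_mapping_eqI) (simp add: lookup_map_key permutes_inj[OF p] pN)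
    finally show "signof p * (\<Prod>j = 0..<N. var_matrix N \<alpha> $$ (p j, j))
        = Poly_Mapping.single (Poly_Mapping.map_key p (exponent_vec N \<alpha>)) (of_int (sign p))"
      by (simp add: mult_single flip: single_of_int)
  qed
  finally show ?thesis .
qed

definition staircase :: "nat \<Rightarrow> nat \<Rightarrow>\<^sub>0 nat" where
  "staircase N = exponent_vec N (\<lambda>i. N - 1 - i)"

lemma schur_mult_alternant_staircase:
  assumes "length \<mu> = N"
  shows "schur N \<mu> * alternant N (staircase N) = alternant N (exponent_vec N ((!) \<mu>) + staircase N)"
proof -
  have "exponent_vec N ((!) \<mu>) + staircase N = exponent_vec N (\<lambda>i. \<mu> ! i + (N - 1 - i))"
    by (rule poly_mapping_eqI) (simp add: staircase_def lookup_add)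
  then show ?thesis
    using schur_mult_vandermonde[OF assms] by (simp add: det_var_matrix staircase_def)
qed

lemma single_mult_single: "Poly_Mapping.single (0::nat \<Rightarrow>\<^sub>0 nat) c * Poly_Mapping.single m d = Poly_Mapping.single m (c * d :: rat)"
  by (simp add: mult_single)

text \<open>
  The coefficients of \<open>g\<close> are constant on rearrangements, so in the term of \<open>\<pi>\<close> each exponent of \<open>g\<close>
  may be rearranged by \<open>\<pi>\<close> as well.
\<close>

lemma sym_ring_mult_alternant:
  assumes g: "g \<in> carrier (sym_ring N)"
  shows "g * alternant N \<alpha>
    = (\<Sum>\<beta>\<in>Poly_Mapping.keys g. Poly_Mapping.single 0 (Poly_Mapping.lookup g \<beta>) * alternant N (\<alpha> + \<beta>))"
proof -
  have key: "g * Poly_Mapping.single (Poly_Mapping.map_key \<pi> \<alpha>) c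
      = (\<Sum>\<beta>\<in>Poly_Mapping.keys g. Poly_Mapping.single (Poly_Mapping.map_key \<pi> (\<alpha> + \<beta>)) (Poly_Mapping.lookup g \<beta> * c))"
    if \<pi>: "\<pi> permutes {..<N}" for \<pi> c
  proof -
    have mem: "Poly_Mapping.map_key \<sigma> m \<in> Poly_Mapping.keys g \<longleftrightarrow> m \<in> Poly_Mapping.keys g"
      if "\<sigma> permutes {..<N}" for \<sigma> m
      using sym_ring_lookup_map_key[OF g that] by (simp add: in_keys_iff)
    have bij: "bij_betw (Poly_Mapping.map_key \<pi>) (Poly_Mapping.keys g) (Poly_Mapping.keys g)"
      by (rule bij_betw_byWitness[where f' = "Poly_Mapping.map_key (inv' \<pi>)"])
        (auto simp: map_key_inverse[OF \<pi>] mem[OF \<pi>] mem[OF permutes_inv[OF \<pi>]])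
    have "g * Poly_Mapping.single (Poly_Mapping.map_key \<pi> \<alpha>) c
        = (\<Sum>\<beta>\<in>Poly_Mapping.keys g. Poly_Mapping.single \<beta> (Poly_Mapping.lookup g \<beta>)) * Poly_Mapping.single (Poly_Mapping.map_key \<pi> \<alpha>) c"
      by (simp only: flip: poly_mapping_sum_single)
    also have "\<dots> = (\<Sum>\<beta>\<in>Poly_Mapping.keys g. Poly_Mapping.single (\<beta> + Poly_Mapping.map_key \<pi> \<alpha>) (Poly_Mapping.lookup g \<beta> * c))"
      by (simp only: sum_distrib_right mult_single)
    also have "\<dots> = (\<Sum>\<beta>\<in>Poly_Mapping.keys g. Poly_Mapping.single (Poly_Mapping.map_key \<pi> \<beta> + Poly_Mapping.map_key \<pi> \<alpha>)
        (Poly_Mapping.lookup g (Poly_Mapping.map_key \<pi> \<beta>) * c))"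
      by (rule sum.reindex_bij_betw[OF bij, symmetric])
    also have "\<dots> = (\<Sum>\<beta>\<in>Poly_Mapping.keys g. Poly_Mapping.single (Poly_Mapping.map_key \<pi> (\<alpha> + \<beta>)) (Poly_Mapping.lookup g \<beta> * c))"
      by (simp only: sym_ring_lookup_map_key[OF g \<pi>] map_key_plus[OF permutes_inj[OF \<pi>]] add.commute)
    finally show ?thesis .
  qed
  have "g * alternant N \<alpha> = (\<Sum>\<pi> | \<pi> permutes {..<N}. \<Sum>\<beta>\<in>Poly_Mapping.keys g.
      Poly_Mapping.single (Poly_Mapping.map_key \<pi> (\<alpha> + \<beta>)) (Poly_Mapping.lookup g \<beta> * of_int (sign \<pi>)))"
    unfolding alternant_def sum_distrib_left by (rule sum.cong) (simp_all add: key)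
  also have "\<dots> = (\<Sum>\<beta>\<in>Poly_Mapping.keys g. \<Sum>\<pi> | \<pi> permutes {..<N}.
      Poly_Mapping.single (Poly_Mapping.map_key \<pi> (\<alpha> + \<beta>)) (Poly_Mapping.lookup g \<beta> * of_int (sign \<pi>)))"
    by (rule sum.swap)
  also have "\<dots> = (\<Sum>\<beta>\<in>Poly_Mapping.keys g. Poly_Mapping.single 0 (Poly_Mapping.lookup g \<beta>) * alternant N (\<alpha> + \<beta>))"
    by (simp only: alternant_def sum_distrib_left single_mult_single)
  finally show ?thesis .
qed

lemma monomial_sum_mult_alternant:
  assumes "monomial_sum S \<in> carrier (sym_ring N)" "finite S"
  shows "monomial_sum S * alternant N \<alpha> = (\<Sum>\<beta>\<in>S. alternant N (\<alpha> + \<beta>))"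
  using sym_ring_mult_alternant[OF assms(1), of \<alpha>]
  by (simp add: keys_monomial_sum lookup_monomial_sum assms(2))

text \<open>The linear functional whose value at the monomial with exponent \<open>m\<close> is \<open>F m\<close>.\<close>

definition pairing :: "((nat \<Rightarrow>\<^sub>0 nat) \<Rightarrow> rat) \<Rightarrow> rat_mpoly \<Rightarrow> rat" where
  "pairing F f = (\<Sum>m\<in>Poly_Mapping.keys f. Poly_Mapping.lookup f m * F m)"

lemma pairing_superset:
  assumes "finite S" "Poly_Mapping.keys f \<subseteq> S"
  shows "pairing F f = (\<Sum>m\<in>S. Poly_Mapping.lookup f m * F m)"
  unfolding pairing_def by (rule sum.mono_neutral_left) (use assms in \<open>auto simp: in_keys_iff\<close>)

lemma pairing_add: "pairing F (f + g) = pairing F f + pairing F g"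
proof -
  define S where "S = Poly_Mapping.keys f \<union> Poly_Mapping.keys g"
  have "finite S" "Poly_Mapping.keys f \<subseteq> S" "Poly_Mapping.keys g \<subseteq> S" "Poly_Mapping.keys (f + g) \<subseteq> S"
    using Poly_Mapping.keys_add[of f g] by (auto simp: S_def)
  then show ?thesis
    by (simp add: pairing_superset[of S] lookup_add algebra_simps sum.distrib)
qed

lemma pairing_single [simp]: "pairing F (Poly_Mapping.single m c) = c * F m"
  by (simp add: pairing_superset[of "{m}"])

lemma pairing_0 [simp]: "pairing F 0 = 0"
  by (simp add: pairing_def)

lemma pairing_sum: "pairing F (\<Sum>i\<in>I. f i) = (\<Sum>i\<in>I. pairing F (f i))"
  by (induction I rule: infinite_finite_induct) (simp_all add: pairing_add)

lemma pairing_scale: "pairing F (Poly_Mapping.single 0 c * f) = c * pairing F f"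
proof -
  have "Poly_Mapping.single 0 c * f
      = (\<Sum>m\<in>Poly_Mapping.keys f. Poly_Mapping.single m (c * Poly_Mapping.lookup f m))"
    by (subst poly_mapping_sum_single[of f]) (simp only: sum_distrib_left single_mult_single)
  then show ?thesis
    by (simp add: pairing_sum sum_distrib_left mult.assoc pairing_def[of F f])
qed

lemma pairing_diff: "pairing F (f - g) = pairing F f - pairing F g"
  using pairing_add[of F "f - g" g] by simp

definition antisymmetric :: "nat \<Rightarrow> ((nat \<Rightarrow>\<^sub>0 nat) \<Rightarrow> rat) \<Rightarrow> bool" where
  "antisymmetric N F \<longleftrightarrow> (\<forall>\<pi> m. \<pi> permutes {..<N} \<longrightarrow> F (Poly_Mapping.map_key \<pi> m) = of_int (sign \<pi>) * F m)"

lemma pairing_alternant: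
  assumes "antisymmetric N F"
  shows "pairing F (alternant N \<alpha>) = fact N * F \<alpha>"
proof -
  have "pairing F (alternant N \<alpha>) = (\<Sum>\<pi> | \<pi> permutes {..<N}. F \<alpha>)"
    unfolding alternant_def pairing_sum
  proof (rule sum.cong)
    fix \<pi> assume "\<pi> \<in> {\<pi>. \<pi> permutes {..<N}}"
    then have "F (Poly_Mapping.map_key \<pi> \<alpha>) = of_int (sign \<pi>) * F \<alpha>"
      using assms by (simp add: antisymmetric_def)
    then show "pairing F (Poly_Mapping.single (Poly_Mapping.map_key \<pi> \<alpha>) (of_int (sign \<pi>))) = F \<alpha>"
      by (simp add: sign_def)
  qed simp
  also have "\<dots> = fact N * F \<alpha>"
    using card_permutations[of "{..<N}" N] by simp
  finally show ?thesis .
qed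

lemma pairing_sym_ring_mult_alternant:
  assumes "antisymmetric N F" "g \<in> carrier (sym_ring N)"
  shows "pairing F (g * alternant N \<alpha>)
    = fact N * (\<Sum>\<beta>\<in>Poly_Mapping.keys g. Poly_Mapping.lookup g \<beta> * F (\<alpha> + \<beta>))"
  unfolding sym_ring_mult_alternant[OF assms(2)] pairing_sum pairing_scale
  by (simp add: pairing_alternant[OF assms(1)] sum_distrib_left mult_ac)

section \<open>Functionals that vanish on the fusion ideal\<close>

lemma congruence_det_permute:
  assumes "\<pi> permutes {..<N}"
  shows "congruence_det N n (\<lambda>i. A (\<pi> i)) B = of_int (sign \<pi>) * congruence_det N n A B"
proof -
  define M where "M = mat N N (\<lambda>(i, j). if (A i - B j) mod int n = 0 then 1 else (0::rat))"
  have "\<pi> i < N" if "i < N" for i using permutes_in_image[OF assms, of i] that by simp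
  then have "mat N N (\<lambda>(i, j). if (A (\<pi> i) - B j) mod int n = 0 then 1 else 0) = mat N N (\<lambda>(i, j). M $$ (\<pi> i, j))"
    by (intro eq_matI) (auto simp: M_def)
  moreover have "det (mat N N (\<lambda>(i, j). M $$ (\<pi> i, j))) = of_int (sign \<pi>) * det M"
    by (rule det_permute_rows) (use assms in \<open>auto simp: M_def lessThan_atLeast0\<close>)
  ultimately show ?thesis by (simp add: congruence_det_def M_def)
qed

lemma congruence_det_cong:
  assumes "\<And>i j. i < N \<Longrightarrow> j < N \<Longrightarrow> (A i - B j) mod int n = (A' i - B' j) mod int n"
  shows "congruence_det N n A B = congruence_det N n A' B'"
  unfolding congruence_det_def by (intro arg_cong[where f = det] eq_matI) (auto simp: assms)

text \<open>
  Translation by \<open>s / N\<close> in each coordinate is the only uniform translation that gives \<open>B\<close> the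
  same sum as \<open>m\<close>; the determinant then compares the two sequences up to permutation and modulo
  \<open>n\<close>, with sign.  Fixing the sum besides the residues distinguishes sequences that differ by a
  rotation of the circle.
\<close>

definition fusion_functional :: "nat \<Rightarrow> nat \<Rightarrow> (nat \<Rightarrow> int) \<Rightarrow> (nat \<Rightarrow>\<^sub>0 nat) \<Rightarrow> rat" where
  "fusion_functional N n B m =
     (let s = (\<Sum>i<N. int (Poly_Mapping.lookup m i)) - (\<Sum>i<N. B i)
      in if int N dvd s then congruence_det N n (\<lambda>i. int (Poly_Mapping.lookup m i)) (\<lambda>j. B j + s div int N) else 0)"

lemma antisymmetric_fusion_functional: "antisymmetric N (fusion_functional N n B)"
  unfolding antisymmetric_def
proof (intro allI impI)
  fix \<pi> m assume \<pi>: "\<pi> permutes {..<N}"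
  have "(\<Sum>i<N. int (Poly_Mapping.lookup (Poly_Mapping.map_key \<pi> m) i)) = (\<Sum>i<N. int (Poly_Mapping.lookup m i))"
    using sum_lookup_map_key[OF \<pi>, of m] by (simp only: flip: of_nat_sum)
  then show "fusion_functional N n B (Poly_Mapping.map_key \<pi> m) = of_int (sign \<pi>) * fusion_functional N n B m"
    using congruence_det_permute[OF \<pi>, of n "\<lambda>i. int (Poly_Mapping.lookup m i)"]
    by (simp add: fusion_functional_def Let_def lookup_map_key permutes_inj[OF \<pi>])
qed

lemma fusion_functional_cong:
  assumes "(\<Sum>i<N. Poly_Mapping.lookup m i) = (\<Sum>i<N. Poly_Mapping.lookup m' i)"
    and "\<And>i. i < N \<Longrightarrow> int (Poly_Mapping.lookup m i) mod int n = int (Poly_Mapping.lookup m' i) mod int n"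
  shows "fusion_functional N n B m = fusion_functional N n B m'"
proof -
  have "(\<Sum>i<N. int (Poly_Mapping.lookup m i)) = (\<Sum>i<N. int (Poly_Mapping.lookup m' i))"
    using assms(1) by (simp only: flip: of_nat_sum)
  moreover have "congruence_det N n (\<lambda>i. int (Poly_Mapping.lookup m i)) C = congruence_det N n (\<lambda>i. int (Poly_Mapping.lookup m' i)) C" for C
    by (rule congruence_det_cong) (rule mod_diff_cong[OF assms(2) refl])
  ultimately show ?thesis by (simp add: fusion_functional_def Let_def)
qed

lemma fusion_functional_add_one:
  assumes "N > 0"
  shows "fusion_functional N n B (m + exponent_vec N (\<lambda>_. 1)) = fusion_functional N n B m"
proof -
  define s where "s = (\<Sum>i<N. int (Poly_Mapping.lookup m i)) - (\<Sum>i<N. B i)"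
  have s': "(\<Sum>i<N. int (Poly_Mapping.lookup (m + exponent_vec N (\<lambda>_. 1)) i)) - (\<Sum>i<N. B i) = s + int N"
    by (simp add: s_def lookup_add sum.distrib)
  have "(s + int N) div int N = s div int N + 1" using assms by simp
  then have "congruence_det N n (\<lambda>i. int (Poly_Mapping.lookup (m + exponent_vec N (\<lambda>_. 1)) i)) (\<lambda>j. B j + (s + int N) div int N)
    = congruence_det N n (\<lambda>i. int (Poly_Mapping.lookup m i)) (\<lambda>j. B j + s div int N)"
    by (intro congruence_det_cong arg_cong[where f = "\<lambda>x. x mod int n"]) (simp add: lookup_add)
  then have "fusion_functional N n B (m + exponent_vec N (\<lambda>_. 1))
      = (if int N dvd s then congruence_det N n (\<lambda>i. int (Poly_Mapping.lookup m i)) (\<lambda>j. B j + s div int N) else 0)"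
    unfolding fusion_functional_def Let_def s' by (simp only: dvd_add_triv_right_iff)
  then show ?thesis
    by (simp only: fusion_functional_def Let_def s_def)
qed

lemma alcove_shift: "alcove N n (\<lambda>i. B i + t) \<longleftrightarrow> alcove N n B"
  by (simp add: alcove_def)

text \<open>
  The last entries agree, so the translation that equalizes the sums is zero if the sequences
  are equivalent at all.
\<close>

lemma fusion_functional_alcove:
  assumes A: "alcove N n (\<lambda>i. int (Poly_Mapping.lookup m i))" and B: "alcove N n B"
    and last: "int (Poly_Mapping.lookup m (N - 1)) = B (N - 1)" and "N > 0"
  shows "fusion_functional N n B m = (if \<forall>i<N. int (Poly_Mapping.lookup m i) = B i then 1 else 0)"
proof -
  define A where "A = (\<lambda>i. int (Poly_Mapping.lookup m i))"
  define s where "s = (\<Sum>i<N. A i) - (\<Sum>i<N. B i)"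
  define equal where "equal \<longleftrightarrow> (\<forall>i<N. A i = B i)"
  have eq0: "s = 0" if equal using that by (simp add: equal_def s_def)
  have F: "fusion_functional N n B m = (if int N dvd s then congruence_det N n A (\<lambda>j. B j + s div int N) else 0)"
    by (simp only: fusion_functional_def Let_def A_def s_def)
  have "fusion_functional N n B m = (if equal then 1 else 0)"
  proof (cases "int N dvd s")
    case False
    then have "\<not> equal" using eq0 by auto
    then show ?thesis using False by (simp add: F)
  next
    case True
    define t where "t = s div int N"
    have s: "s = int N * t" using True by (simp add: t_def)
    have "(\<Sum>i<N. A i) = (\<Sum>i<N. B i + t)"
      using s by (simp add: sum.distrib s_def)
    then have "congruence_det N n A (\<lambda>j. B j + t) = (if \<forall>i<N. A i = B i + t then 1 else 0)"
      using A B by (intro congruence_det_alcove) (simp_all add: alcove_shift A_def)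
    moreover have "(\<forall>i<N. A i = B i + t) \<longleftrightarrow> equal"
    proof
      assume *: "\<forall>i<N. A i = B i + t"
      then have "A (N - 1) = B (N - 1) + t" using assms(4) by simp
      then have "t = 0" using last by (simp add: A_def)
      then show equal using * by (simp add: equal_def)
    next
      assume equal
      moreover have "t = 0" using eq0[OF \<open>equal\<close>] s assms(4) by simp
      ultimately show "\<forall>i<N. A i = B i + t" by (simp add: equal_def)
    qed
    ultimately show ?thesis
      using True by (simp add: F t_def)
  qed
  then show ?thesis by (simp only: equal_def A_def)
qed

lemma sum_fusion_functional_exponents:
  assumes A: "alcove N n (\<lambda>i. int (Poly_Mapping.lookup \<alpha> i))" and B: "alcove N n B" and m: "m < n"
    and N: "N > 0"
  shows "(\<Sum>\<beta>\<in>exponents {..<N} m. fusion_functional N n B (\<alpha> + \<beta>))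
    = (if \<exists>t. interlaces N n (\<lambda>i. int (Poly_Mapping.lookup \<alpha> i)) (\<lambda>i. B i + t)
            \<and> (\<Sum>i<N. B i) + int N * t = (\<Sum>i<N. int (Poly_Mapping.lookup \<alpha> i)) + int m then 1 else 0)"
proof -
  define A where "A = (\<lambda>i. int (Poly_Mapping.lookup \<alpha> i))"
  define s where "s = (\<Sum>i<N. A i) + int m - (\<Sum>i<N. B i)"
  have s: "(\<Sum>i<N. int (Poly_Mapping.lookup (\<alpha> + \<beta>) i)) - (\<Sum>i<N. B i) = s" if "\<beta> \<in> exponents {..<N} m" for \<beta>
    using that by (simp add: exponents_def s_def A_def lookup_add sum.distrib flip: of_nat_sum)
  have *: "(\<Sum>\<beta>\<in>exponents {..<N} m. fusion_functional N n B (\<alpha> + \<beta>))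
    = (\<Sum>\<beta>\<in>exponents {..<N} m. if int N dvd s then congruence_det N n (\<lambda>i. A i + int (Poly_Mapping.lookup \<beta> i)) (\<lambda>j. B j + s div int N) else 0)"
    unfolding fusion_functional_def Let_def
    by (rule sum.cong[OF refl]) (simp only: s, simp add: A_def lookup_add)
  have "(\<Sum>\<beta>\<in>exponents {..<N} m. fusion_functional N n B (\<alpha> + \<beta>))
    = (if \<exists>t. interlaces N n A (\<lambda>i. B i + t) \<and> (\<Sum>i<N. B i) + int N * t = (\<Sum>i<N. A i) + int m then 1 else 0)"
  proof (cases "int N dvd s")
    case False
    then have "\<nexists>t. (\<Sum>i<N. B i) + int N * t = (\<Sum>i<N. A i) + int m"
      by (metis add_diff_cancel_left' dvd_triv_left s_def)
    then show ?thesis unfolding * using False by auto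
  next
    case True
    then obtain t where t: "s = int N * t" by blast
    then have div: "s div int N = t" using N by simp
    have "(\<Sum>i<N. B i + t) = (\<Sum>i<N. A i) + int m"
      using t by (simp add: s_def sum.distrib)
    then have "(\<Sum>\<beta>\<in>exponents {..<N} m. congruence_det N n (\<lambda>i. A i + int (Poly_Mapping.lookup \<beta> i)) (\<lambda>j. B j + t))
      = (if interlaces N n A (\<lambda>j. B j + t) then 1 else 0)"
      using A B by (intro sum_congruence_det_eq_interlaces m) (simp_all add: alcove_shift A_def)
    moreover have "(\<Sum>i<N. B i) + int N * t' = (\<Sum>i<N. A i) + int m \<longleftrightarrow> t' = t" for t'
    proof -
      have "(\<Sum>i<N. B i) + int N * t' = (\<Sum>i<N. A i) + int m \<longleftrightarrow> int N * t' = int N * t"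
        using t unfolding s_def by (intro iffI) linarith+
      also have "\<dots> \<longleftrightarrow> t' = t" using N by simp
      finally show ?thesis .
    qed
    ultimately show ?thesis unfolding * using True by (simp add: div)
  qed
  then show ?thesis by (simp only: A_def)
qed

text \<open>
  Quantifying over all multiples makes the kernel of a functional into an ideal, so that only
  generators have to be tested.
\<close>

lemma ideal_annihilated:
  "ideal {f \<in> carrier (sym_ring N). \<forall>g\<in>carrier (sym_ring N). pairing F (g * f * d) = 0} (sym_ring N)"
    (is "ideal ?K _")
proof (rule idealI)
  interpret R: cring "sym_ring N" by (rule cring_sym_ring)
  show "ring (sym_ring N)" by (rule R.ring_axioms)
  have minus: "\<ominus>\<^bsub>sym_ring N\<^esub> x = - x" if "x \<in> carrier (sym_ring N)" for x
    by (rule R.minus_equality) (use that in \<open>auto intro: sym_ring_uminus\<close>)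
  show "subgroup ?K (add_monoid (sym_ring N))"
  proof (rule group.subgroupI)
    show "Group.group (add_monoid (sym_ring N))" by (rule R.a_group)
    show "?K \<noteq> {}" using sym_ring_0 by (auto intro!: exI[of _ 0])
    show "inv\<^bsub>add_monoid (sym_ring N)\<^esub> a \<in> ?K" if "a \<in> ?K" for a
    proof -
      have "inv\<^bsub>add_monoid (sym_ring N)\<^esub> a = - a"
        using minus that by (simp add: a_inv_def)
      moreover have "pairing F (g * - a * d) = 0" if "g \<in> carrier (sym_ring N)" for g
        using \<open>a \<in> ?K\<close> sym_ring_uminus[OF that] by force
      ultimately show ?thesis using that sym_ring_uminus by auto
    qed
  qed (auto simp: sym_ring_add distrib_left distrib_right pairing_add)
next
  fix a x assume a: "a \<in> ?K" and x: "x \<in> carrier (sym_ring N)"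
  have "pairing F (g * (x * a) * d) = 0" if "g \<in> carrier (sym_ring N)" for g
    using a sym_ring_mult[OF that x] by (auto simp: mult.assoc)
  then show "x \<otimes>\<^bsub>sym_ring N\<^esub> a \<in> ?K" "a \<otimes>\<^bsub>sym_ring N\<^esub> x \<in> ?K"
    using a x by (auto simp: sym_ring_mult mult.commute)
qed

lemma lookup_staircase: "Poly_Mapping.lookup (staircase N) i = (if i < N then N - 1 - i else 0)"
  by (simp add: staircase_def)

text \<open>
  The exponent \<open>\<alpha> = \<mu> + \<rho>\<close> lies on a wall: its first and last coordinates differ by exactly
  \<open>N + k\<close>, so exchanging them does not change residues modulo \<open>N + k\<close>.  Hence the functional
  changes sign when these two coordinates of \<open>\<beta>\<close> are exchanged, while the coefficients of \<open>g\<close> stay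
  the same.
\<close>

lemma fusion_functional_wall:
  assumes N: "N \<ge> 2" and wall: "\<mu> ! 0 = \<mu> ! (N - 1) + (k + 1)" and g: "g \<in> carrier (sym_ring N)"
  defines "\<alpha> \<equiv> exponent_vec N ((!) \<mu>) + staircase N"
  shows "(\<Sum>\<beta>\<in>Poly_Mapping.keys g. Poly_Mapping.lookup g \<beta> * fusion_functional N (N + k) B (\<alpha> + \<beta>)) = 0"
proof -
  define F where "F = fusion_functional N (N + k) B"
  \<comment> \<open>the linear part of the affine reflection that fixes \<open>\<alpha>\<close>\<close>
  define \<tau> where "\<tau> = Transposition.transpose 0 (N - 1)"
  have \<tau>: "\<tau> permutes {..<N}" unfolding \<tau>_def by (rule permutes_swap_id) (use N in auto)
  have sign: "sign \<tau> = -1" unfolding \<tau>_def using N by (simp add: sign_swap_id)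
  have inj: "inj \<tau>" by (rule permutes_inj[OF \<tau>])
  have \<tau>\<tau>: "Poly_Mapping.map_key \<tau> (Poly_Mapping.map_key \<tau> x) = x" for x :: "nat \<Rightarrow>\<^sub>0 nat"
    by (rule poly_mapping_eqI) (simp add: lookup_map_key inj \<tau>_def)
  have bij: "bij_betw (Poly_Mapping.map_key \<tau>) (Poly_Mapping.keys g) (Poly_Mapping.keys g)"
    by (rule bij_betw_byWitness[where f' = "Poly_Mapping.map_key \<tau>"])
      (auto simp: \<tau>\<tau> in_keys_iff sym_ring_lookup_map_key[OF g \<tau>])
  have refl: "F (\<alpha> + Poly_Mapping.map_key \<tau> \<beta>) = - F (\<alpha> + \<beta>)" for \<beta>
  proof -
    have "F (\<alpha> + Poly_Mapping.map_key \<tau> \<beta>) = F (Poly_Mapping.map_key \<tau> (Poly_Mapping.map_key \<tau> \<alpha> + \<beta>))"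
      by (simp add: map_key_plus[OF inj] \<tau>\<tau>)
    also have "\<dots> = - F (Poly_Mapping.map_key \<tau> \<alpha> + \<beta>)"
      using antisymmetric_fusion_functional[of N "N + k" B] \<tau> sign
      by (simp add: antisymmetric_def F_def)
    also have "F (Poly_Mapping.map_key \<tau> \<alpha> + \<beta>) = F (\<alpha> + \<beta>)"
      unfolding F_def
    proof (rule fusion_functional_cong)
      show "(\<Sum>i<N. Poly_Mapping.lookup (Poly_Mapping.map_key \<tau> \<alpha> + \<beta>) i) = (\<Sum>i<N. Poly_Mapping.lookup (\<alpha> + \<beta>) i)"
        by (simp add: lookup_add sum.distrib sum_lookup_map_key[OF \<tau>])
      fix i assume i: "i < N"
      have 0: "int (Poly_Mapping.lookup \<alpha> 0) = int (Poly_Mapping.lookup \<alpha> (N - 1)) + int (N + k)"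
        using N wall by (simp add: \<alpha>_def lookup_add lookup_staircase)
      then have "int (Poly_Mapping.lookup \<alpha> (\<tau> i)) mod int (N + k) = int (Poly_Mapping.lookup \<alpha> i) mod int (N + k)"
        by (auto simp: \<tau>_def Transposition.transpose_def simp del: of_nat_add)
      then show "int (Poly_Mapping.lookup (Poly_Mapping.map_key \<tau> \<alpha> + \<beta>) i) mod int (N + k)
          = int (Poly_Mapping.lookup (\<alpha> + \<beta>) i) mod int (N + k)"
        unfolding lookup_add lookup_map_key[OF inj] of_nat_add[of "Poly_Mapping.lookup _ _"]
        by (rule mod_add_cong) simp
    qed
    finally show ?thesis .
  qed
  have "(\<Sum>\<beta>\<in>Poly_Mapping.keys g. Poly_Mapping.lookup g \<beta> * F (\<alpha> + \<beta>))
      = (\<Sum>\<beta>\<in>Poly_Mapping.keys g. Poly_Mapping.lookup g (Poly_Mapping.map_key \<tau> \<beta>) * F (\<alpha> + Poly_Mapping.map_key \<tau> \<beta>))"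
    by (rule sum.reindex_bij_betw[OF bij, symmetric])
  also have "\<dots> = - (\<Sum>\<beta>\<in>Poly_Mapping.keys g. Poly_Mapping.lookup g \<beta> * F (\<alpha> + \<beta>))"
    by (simp add: refl sym_ring_lookup_map_key[OF g \<tau>] sum_negf)
  finally show ?thesis by (simp add: F_def)
qed

lemma fusion_ideal_annihilated:
  assumes N: "N \<ge> 2" and f: "f \<in> fusion_ideal N k"
  shows "pairing (fusion_functional N (N + k) B) (f * alternant N (staircase N)) = 0"
proof -
  define F where "F = fusion_functional N (N + k) B"
  define K where "K = {f \<in> carrier (sym_ring N). \<forall>g\<in>carrier (sym_ring N). pairing F (g * f * alternant N (staircase N)) = 0}"
  interpret R: cring "sym_ring N" by (rule cring_sym_ring)
  have anti: "antisymmetric N F" unfolding F_def by (rule antisymmetric_fusion_functional)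
  have "ideal K (sym_ring N)"
    unfolding K_def by (rule ideal_annihilated)
  moreover have "schur N (replicate N 1) - 1 \<in> K"
  proof -
    have one: "exponent_vec N ((!) (replicate N 1)) = exponent_vec N (\<lambda>_. 1)"
      by (rule poly_mapping_eqI) simp
    have "pairing F (g * (schur N (replicate N 1) - 1) * alternant N (staircase N)) = 0"
      if g: "g \<in> carrier (sym_ring N)" for g
    proof -
      have "schur N (replicate N 1) * alternant N (staircase N) = alternant N (staircase N + exponent_vec N (\<lambda>_. 1))"
        using schur_mult_alternant_staircase[of "replicate N 1" N]
        unfolding one by (simp only: length_replicate add.commute)
      then have "g * (schur N (replicate N 1) - 1) * alternant N (staircase N)
          = g * alternant N (staircase N + exponent_vec N (\<lambda>_. 1)) - g * alternant N (staircase N)"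
        by (simp only: mult.assoc left_diff_distrib right_diff_distrib mult_1)
      moreover have "F (staircase N + exponent_vec N (\<lambda>_. 1) + \<beta>) = F (staircase N + \<beta>)" for \<beta>
        using fusion_functional_add_one[of N "N + k" B "staircase N + \<beta>"] N
        by (simp add: F_def ac_simps)
      ultimately show ?thesis
        by (simp add: pairing_diff pairing_sym_ring_mult_alternant[OF anti g])
    qed
    then show ?thesis
      by (simp add: K_def sym_ring_diff schur_in_sym_ring sym_ring_1)
  qed
  moreover have "schur N \<mu> \<in> K" if \<mu>: "\<mu> \<in> partitions N" "\<mu> ! 0 = \<mu> ! (N - 1) + (k + 1)" for \<mu>
  proof -
    have "pairing F (g * schur N \<mu> * alternant N (staircase N)) = 0" if g: "g \<in> carrier (sym_ring N)" for g
      using fusion_functional_wall[OF N \<mu>(2) g, of B] \<mu>(1)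
      by (simp add: mult.assoc schur_mult_alternant_staircase partitions_def
          pairing_sym_ring_mult_alternant[OF anti g] flip: F_def)
    then show ?thesis by (simp add: K_def schur_in_sym_ring)
  qed
  ultimately have "fusion_ideal N k \<subseteq> K"
    unfolding fusion_ideal_def by (intro R.genideal_minimal) auto
  then have "f \<in> K" using f by blast
  then show ?thesis
    using sym_ring_1[of N] by (auto simp: K_def F_def dest: bspec[of _ _ 1])
qed

section \<open>Weights as partitions\<close>

lemma length_weight_partition [simp]: "length (weight_partition N \<kappa>) = N"
  by (simp add: weight_partition_def)

lemma nth_weight_partition:
  "i < N \<Longrightarrow> weight_partition N \<kappa> ! i = (\<Sum>j = Suc i..N - 1. Poly_Mapping.lookup \<kappa> j)"
  by (simp add: weight_partition_def del: upt_Suc)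

lemma weight_partition_last: "N > 0 \<Longrightarrow> weight_partition N \<kappa> ! (N - 1) = 0"
  by (simp add: nth_weight_partition)

lemma weight_partition_step:
  assumes "Suc i < N"
  shows "weight_partition N \<kappa> ! i = Poly_Mapping.lookup \<kappa> (Suc i) + weight_partition N \<kappa> ! Suc i"
proof -
  have "{Suc i..N - 1} = insert (Suc i) {Suc (Suc i)..N - 1}" using assms by auto
  then show ?thesis using assms by (simp add: nth_weight_partition)
qed

lemma weight_partition_antimono:
  assumes "i \<le> j" "j < N"
  shows "weight_partition N \<kappa> ! j \<le> weight_partition N \<kappa> ! i"
  using assms
  by (induction j rule: dec_induct) (auto simp: weight_partition_step intro: le_trans)

lemma weight_partition_head:
  assumes "\<kappa> \<in> weights N k" "N > 0"
  shows "weight_partition N \<kappa> ! 0 \<le> k"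
  using assms by (simp add: nth_weight_partition weights_def)

lemma finite_weights: "finite (weights N k)"
proof -
  have "weights N k \<subseteq> (\<Union>d\<le>k. exponents {1..N - 1} d)"
    by (auto simp: weights_def exponents_def)
  then show ?thesis by (rule finite_subset) (auto simp: finite_exponents)
qed

lemma weights_eqI:
  assumes "\<kappa> \<in> weights N k" "\<nu> \<in> weights N k" and eq: "\<And>i. i < N \<Longrightarrow> weight_partition N \<kappa> ! i = weight_partition N \<nu> ! i"
  shows "\<kappa> = \<nu>"
proof (rule poly_mapping_eqI)
  fix j show "Poly_Mapping.lookup \<kappa> j = Poly_Mapping.lookup \<nu> j"
  proof (cases "j \<in> {1..N - 1}")
    case True
    then obtain i where i: "j = Suc i" "Suc i < N" by (cases j) auto
    then show ?thesis
      using weight_partition_step[OF i(2), of \<kappa>] weight_partition_step[OF i(2), of \<nu>] eq[of i] eq[of "Suc i"]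
      by simp
  next
    case False
    then have "j \<notin> Poly_Mapping.keys \<kappa>" "j \<notin> Poly_Mapping.keys \<nu>"
      using assms(1,2) by (auto simp: weights_def)
    then show ?thesis by (simp add: in_keys_iff)
  qed
qed

lemma obtain_weight:
  assumes len: "length \<mu> = N" and dec: "\<And>i. Suc i < N \<Longrightarrow> \<mu> ! Suc i \<le> \<mu> ! i"
    and last: "\<mu> ! (N - 1) = 0" and head: "\<mu> ! 0 \<le> k" and N: "N > 0"
  obtains \<kappa> where "\<kappa> \<in> weights N k" "weight_partition N \<kappa> = \<mu>"
proof -
  \<comment> \<open>the index 0 belongs to no fundamental weight\<close>
  define \<kappa> where "\<kappa> = exponent_vec N (\<lambda>j. if j = 0 then 0 else \<mu> ! (j - 1) - \<mu> ! j)"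
  have tele: "(\<Sum>j = Suc i..N - 1. Poly_Mapping.lookup \<kappa> j) = \<mu> ! i" if "i \<le> N - 1" for i
    using that
  proof (induction rule: inc_induct)
    case base
    then show ?case using last by simp
  next
    case (step i)
    then have "{Suc i..N - 1} = insert (Suc i) {Suc (Suc i)..N - 1}" by auto
    moreover have "Suc i < N" using step by simp
    ultimately show ?case using step dec[of i] by (simp add: \<kappa>_def)
  qed
  have "\<kappa> \<in> weights N k"
    using tele[of 0] head by (auto simp: weights_def \<kappa>_def in_keys_iff split: if_splits)
  moreover have "weight_partition N \<kappa> = \<mu>"
    by (rule nth_equalityI) (use len tele in \<open>auto simp: nth_weight_partition\<close>)
  ultimately show ?thesis by (rule that)
qed

text \<open>The vector \<open>\<kappa> + \<rho>\<close>.\<close>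

definition shifted_partition :: "nat \<Rightarrow> weight \<Rightarrow> nat \<Rightarrow>\<^sub>0 nat" where
  "shifted_partition N \<kappa> = exponent_vec N ((!) (weight_partition N \<kappa>)) + staircase N"

lemma lookup_shifted_partition:
  "i < N \<Longrightarrow> Poly_Mapping.lookup (shifted_partition N \<kappa>) i = weight_partition N \<kappa> ! i + (N - 1 - i)"
  by (simp add: shifted_partition_def lookup_add lookup_staircase)

lemma alcove_shifted_partition:
  assumes "\<kappa> \<in> weights N k" "N > 0"
  shows "alcove N (N + k) (\<lambda>i. int (Poly_Mapping.lookup (shifted_partition N \<kappa>) i))"
  unfolding alcove_def
proof (intro conjI allI impI)
  fix i j assume "i < j" "j < N"
  then show "int (Poly_Mapping.lookup (shifted_partition N \<kappa>) j) < int (Poly_Mapping.lookup (shifted_partition N \<kappa>) i)"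
    using weight_partition_antimono[of i j N \<kappa>] by (simp add: lookup_shifted_partition)
next
  fix i j assume "i < N" "j < N"
  then show "int (Poly_Mapping.lookup (shifted_partition N \<kappa>) i)
      < int (Poly_Mapping.lookup (shifted_partition N \<kappa>) j) + int (N + k)"
    using weight_partition_antimono[of 0 i N \<kappa>] weight_partition_head[OF assms]
    by (simp add: lookup_shifted_partition)
qed

text \<open>
  Up to the factor \<open>N!\<close>, the composite of this functional with multiplication by \<open>a\<^sub>\<rho>\<close> is the
  coordinate of a symmetric polynomial at \<open>\<nu>\<close> modulo the fusion ideal.
\<close>

definition weight_functional :: "nat \<Rightarrow> nat \<Rightarrow> weight \<Rightarrow> (nat \<Rightarrow>\<^sub>0 nat) \<Rightarrow> rat" where
  "weight_functional N k \<nu> = fusion_functional N (N + k) (\<lambda>i. int (Poly_Mapping.lookup (shifted_partition N \<nu>) i))"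

lemma weight_functional_shifted_partition:
  assumes "\<kappa> \<in> weights N k" "\<nu> \<in> weights N k" "N > 0"
  shows "weight_functional N k \<nu> (shifted_partition N \<kappa>) = (if \<kappa> = \<nu> then 1 else 0)"
proof -
  have "weight_functional N k \<nu> (shifted_partition N \<kappa>)
    = (if \<forall>i<N. int (Poly_Mapping.lookup (shifted_partition N \<kappa>) i) = int (Poly_Mapping.lookup (shifted_partition N \<nu>) i) then 1 else 0)"
    unfolding weight_functional_def
    by (rule fusion_functional_alcove)
      (use assms in \<open>simp_all add: alcove_shifted_partition del: of_nat_add\<close>,
       use assms in \<open>simp add: lookup_shifted_partition weight_partition_last[unfolded One_nat_def]\<close>)
  moreover have "(\<forall>i<N. int (Poly_Mapping.lookup (shifted_partition N \<kappa>) i) = int (Poly_Mapping.lookup (shifted_partition N \<nu>) i)) \<longleftrightarrow> \<kappa> = \<nu>"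
    using weights_eqI[OF assms(1,2)] by (auto simp: lookup_shifted_partition)
  ultimately show ?thesis by simp
qed

lemma pairing_schur_mult:
  assumes "antisymmetric N F"
  shows "pairing F (schur N (weight_partition N \<kappa>) * alternant N (staircase N)) = fact N * F (shifted_partition N \<kappa>)"
  by (simp add: schur_mult_alternant_staircase pairing_alternant[OF assms] shifted_partition_def)

definition schur_combination :: "nat \<Rightarrow> nat \<Rightarrow> (weight \<Rightarrow> rat) \<Rightarrow> rat_mpoly" where
  "schur_combination N k c = (\<Sum>\<nu>\<in>weights N k. Poly_Mapping.single 0 (c \<nu>) * schur N (weight_partition N \<nu>))"

lemma pairing_schur_combination:
  assumes "\<nu> \<in> weights N k" "N > 0"
  shows "pairing (weight_functional N k \<nu>) (schur_combination N k c * alternant N (staircase N)) = fact N * c \<nu>"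
proof -
  have anti: "antisymmetric N (weight_functional N k \<nu>)"
    unfolding weight_functional_def by (rule antisymmetric_fusion_functional)
  have "pairing (weight_functional N k \<nu>) (schur_combination N k c * alternant N (staircase N))
      = (\<Sum>\<kappa>\<in>weights N k. c \<kappa> * (fact N * weight_functional N k \<nu> (shifted_partition N \<kappa>)))"
    by (simp add: schur_combination_def sum_distrib_right pairing_sum mult.assoc pairing_scale pairing_schur_mult[OF anti])
  also have "\<dots> = (\<Sum>\<kappa>\<in>weights N k. if \<kappa> = \<nu> then fact N * c \<nu> else 0)"
    by (rule sum.cong) (auto simp: weight_functional_shifted_partition assms)
  also have "\<dots> = fact N * c \<nu>"
    using assms by (simp add: sum.delta finite_weights)
  finally show ?thesis .
qed

lemma schur_combination_in_sym_ring: "schur_combination N k c \<in> carrier (sym_ring N)"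
  unfolding schur_combination_def
  by (intro sym_ring_sum sym_ring_mult sym_ring_const schur_in_sym_ring)

text \<open>The functional of the zero weight takes the value \<open>N!\<close> on it.\<close>

lemma alternant_staircase_nonzero:
  assumes "N > 0" shows "alternant N (staircase N) \<noteq> 0"
proof
  assume "alternant N (staircase N) = 0"
  moreover have "(0::weight) \<in> weights N 0" by (simp add: weights_def)
  ultimately have "fact N * weight_functional N 0 0 (shifted_partition N 0) = 0"
    using pairing_schur_mult[of N "weight_functional N 0 0" 0] antisymmetric_fusion_functional
    by (simp add: weight_functional_def)
  then show False
    using weight_functional_shifted_partition[OF \<open>0 \<in> weights N 0\<close> \<open>0 \<in> weights N 0\<close> assms] by simp
qed

lemma eq_if_mult_alternant_eq:
  assumes "N > 0" "f * alternant N (staircase N) = g * alternant N (staircase N)"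
  shows "f = g"
  using assms alternant_staircase_nonzero[OF assms(1)] by simp

lemma schur_replicate_1_mult_alternant:
  assumes "N > 0"
  shows "schur N (replicate N 1) * alternant N \<alpha> = alternant N (\<alpha> + exponent_vec N (\<lambda>_. 1))"
proof -
  define u where "u = exponent_vec N (\<lambda>_. 1)"
  have "monomial_sum {u} \<in> carrier (sym_ring N)"
  proof (rule monomial_sum_in_sym_ring)
    fix \<pi> m assume \<pi>: "\<pi> permutes {..<N}" and m: "m \<in> {u}"
    have "Poly_Mapping.map_key \<pi> u = u"
      using permutes_in_image[OF \<pi>]
      by (intro poly_mapping_eqI) (simp add: u_def lookup_map_key permutes_inj[OF \<pi>])
    then show "Poly_Mapping.map_key \<pi> m \<in> {u}" using m by simp
  qed (auto simp: u_def dest: subsetD[OF keys_exponent_vec])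
  then have *: "monomial_sum {u} * alternant N \<beta> = alternant N (\<beta> + u)" for \<beta>
    using monomial_sum_mult_alternant[of "{u}" N \<beta>] by simp
  have "exponent_vec N ((!) (replicate N 1)) = u"
    unfolding u_def by (rule poly_mapping_eqI) simp
  then have "schur N (replicate N 1) * alternant N (staircase N) = monomial_sum {u} * alternant N (staircase N)"
    using schur_mult_alternant_staircase[of "replicate N 1" N]
    by (simp only: * length_replicate add.commute)
  then have "schur N (replicate N 1) = monomial_sum {u}"
    by (rule eq_if_mult_alternant_eq[OF assms])
  then show ?thesis unfolding u_def[symmetric] by (simp only: *)
qed

lemma schur_map_Suc:
  assumes "length \<mu> = N" "N > 0"
  shows "schur N (map Suc \<mu>) = schur N (replicate N 1) * schur N \<mu>"
proof (rule eq_if_mult_alternant_eq[OF assms(2)])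
  have "exponent_vec N ((!) (map Suc \<mu>)) + staircase N = exponent_vec N ((!) \<mu>) + staircase N + exponent_vec N (\<lambda>_. 1)"
    by (rule poly_mapping_eqI) (use assms in \<open>simp add: lookup_add\<close>)
  then show "schur N (map Suc \<mu>) * alternant N (staircase N) = schur N (replicate N 1) * schur N \<mu> * alternant N (staircase N)"
    using assms by (simp add: mult.assoc schur_mult_alternant_staircase schur_replicate_1_mult_alternant[unfolded One_nat_def])
qed

text \<open>Two consecutive rows of the Jacobi-Trudi matrix coincide.\<close>

lemma schur_eq_0:
  assumes "Suc i < N" "\<mu> ! Suc i = Suc (\<mu> ! i)"
  shows "schur N \<mu> = 0"
  unfolding schur_def
proof (rule det_identical_rows[of _ N i "Suc i"])
  show "row (mat N N (\<lambda>(i, j). complete_homogeneous N (int (\<mu> ! i) - int i + int j))) i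
      = row (mat N N (\<lambda>(i, j). complete_homogeneous N (int (\<mu> ! i) - int i + int j))) (Suc i)"
    using assms by (intro eq_vecI) auto
qed (use assms in auto)

section \<open>Elementary symmetric polynomials and vertical strips\<close>

definition subset_vec :: "nat set \<Rightarrow> nat \<Rightarrow>\<^sub>0 nat" where
  "subset_vec B = (\<Sum>i\<in>B. Poly_Mapping.single i 1)"

lemma lookup_subset_vec:
  assumes "finite B"
  shows "Poly_Mapping.lookup (subset_vec B) i = (if i \<in> B then 1 else 0)"
proof -
  have "Poly_Mapping.lookup (subset_vec B) i = (\<Sum>j\<in>B. if j = i then 1 else 0)"
    unfolding subset_vec_def lookup_sum by (intro sum.cong) (auto simp: lookup_single when_def)
  then show ?thesis using assms by (simp add: sum.delta)
qed

definition elementary :: "nat \<Rightarrow> nat \<Rightarrow> rat_mpoly" where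
  "elementary N r = monomial_sum (subset_vec ` {B. B \<subseteq> {..<N} \<and> card B = r})"

lemma finite_subsets_of_card: "finite {B. B \<subseteq> {..<N::nat} \<and> card B = r}"
  by (rule finite_subset[of _ "Pow {..<N}"]) auto

lemma inj_on_subset_vec: "inj_on subset_vec {B. B \<subseteq> {..<N} \<and> card B = r}"
proof (rule inj_onI)
  fix B C :: "nat set" assume "B \<in> {B. B \<subseteq> {..<N} \<and> card B = r}" "C \<in> {B. B \<subseteq> {..<N} \<and> card B = r}"
    and eq: "subset_vec B = subset_vec C"
  then have fin: "finite B" "finite C" using finite_subset by auto
  show "B = C"
  proof (rule Set.set_eqI)
    fix i show "i \<in> B \<longleftrightarrow> i \<in> C"
      using arg_cong[OF eq, of "\<lambda>m. Poly_Mapping.lookup m i"]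
      by (simp add: lookup_subset_vec fin split: if_splits)
  qed
qed

lemma elementary_in_sym_ring: "elementary N r \<in> carrier (sym_ring N)"
  unfolding elementary_def
proof (rule monomial_sum_in_sym_ring)
  show "finite (subset_vec ` {B. B \<subseteq> {..<N} \<and> card B = r})"
    by (rule finite_imageI[OF finite_subsets_of_card])
next
  fix m assume "m \<in> subset_vec ` {B. B \<subseteq> {..<N} \<and> card B = r}"
  then obtain B where B: "B \<subseteq> {..<N}" "m = subset_vec B" by auto
  then have "finite B" using finite_subset by auto
  then show "Poly_Mapping.keys m \<subseteq> {..<N}"
    using B by (auto simp: in_keys_iff lookup_subset_vec split: if_splits)
next
  fix \<pi> m assume \<pi>: "\<pi> permutes {..<N}" and "m \<in> subset_vec ` {B. B \<subseteq> {..<N} \<and> card B = r}"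
  then obtain B where B: "B \<subseteq> {..<N}" "card B = r" "m = subset_vec B" by auto
  then have fin: "finite B" using finite_subset by auto
  define C where "C = inv' \<pi> ` B"
  have "inv' \<pi> permutes {..<N}" by (rule permutes_inv[OF \<pi>])
  then have "C \<subseteq> {..<N}" using B unfolding C_def by (metis image_mono permutes_image)
  moreover have "card C = r"
    unfolding C_def using B permutes_inj[OF permutes_inv[OF \<pi>]] by (simp add: card_image inj_on_subset)
  moreover have "Poly_Mapping.map_key \<pi> m = subset_vec C"
  proof (rule poly_mapping_eqI)
    fix i
    have "\<pi> i \<in> B \<longleftrightarrow> i \<in> C"
      unfolding C_def using permutes_inverses[OF \<pi>] by (metis image_iff)
    then show "Poly_Mapping.lookup (Poly_Mapping.map_key \<pi> m) i = Poly_Mapping.lookup (subset_vec C) i"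
      using B fin by (simp add: lookup_map_key permutes_inj[OF \<pi>] lookup_subset_vec C_def)
  qed
  ultimately show "Poly_Mapping.map_key \<pi> m \<in> subset_vec ` {B. B \<subseteq> {..<N} \<and> card B = r}" by blast
qed

lemma signed_elementary_gen_nth:
  "fps_nth (signed_elementary_gen {..<N}) r = Poly_Mapping.single 0 ((-1) ^ r) * elementary N r"
proof -
  have prod: "(\<Prod>i\<in>B. - (fps_const (var i) * fps_X)) = fps_const (Poly_Mapping.single (subset_vec B) ((-1) ^ card B)) * fps_X ^ card B"
    if "finite B" for B
    using that
  proof (induction B)
    case (insert i B)
    then have "subset_vec (insert i B) = Poly_Mapping.single i 1 + subset_vec B"
      by (simp add: subset_vec_def)
    then have "Poly_Mapping.single (subset_vec (insert i B)) ((-1) ^ card (insert i B))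
        = - (var i * Poly_Mapping.single (subset_vec B) ((-1) ^ card B))"
      using insert by (simp add: var_def mult_single single_uminus)
    then show ?case
      using insert by (simp add: mult_ac flip: fps_const_mult fps_const_neg)
  qed (simp add: subset_vec_def)
  have "signed_elementary_gen {..<N} = (\<Prod>i<N. - (fps_const (var i) * fps_X) + 1)"
    by (simp add: signed_elementary_gen_def)
  also have "\<dots> = (\<Sum>B\<in>Pow {..<N}. \<Prod>i\<in>B. - (fps_const (var i) * fps_X))"
    by (subst prod_add) simp_all
  also have "\<dots> = (\<Sum>B\<in>Pow {..<N}. fps_const (Poly_Mapping.single (subset_vec B) ((-1) ^ card B)) * fps_X ^ card B)"
    by (intro sum.cong refl prod) (auto intro: finite_subset)
  finally have "fps_nth (signed_elementary_gen {..<N}) r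
      = (\<Sum>B\<in>Pow {..<N}. if card B = r then Poly_Mapping.single (subset_vec B) ((-1) ^ r) else 0)"
    by (simp add: fps_sum_nth if_distrib[of "(*) _"] eq_commute[of r] cong: if_cong)
  also have "\<dots> = (\<Sum>B | B \<subseteq> {..<N} \<and> card B = r. Poly_Mapping.single (subset_vec B) ((-1) ^ r))"
    by (subst sum.inter_filter[symmetric]) (auto intro!: sum.cong)
  also have "\<dots> = Poly_Mapping.single 0 ((-1) ^ r) * elementary N r"
    unfolding elementary_def monomial_sum_def
    by (subst sum.reindex[OF inj_on_subset_vec]) (simp add: sum_distrib_left mult_single)
  finally show ?thesis .
qed

text \<open>
  The coefficient of \<open>t\<close> to the power \<open>d + 1\<close> in the identity of formal power series
  \<open>(\<Sum> (-1)\<^sup>r e\<^sub>r t\<^sup>r) (\<Sum> h\<^sub>r t\<^sup>r) = 1\<close>.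
\<close>

lemma complete_sum_recursion:
  "complete_sum {..<N} (Suc d)
    = (\<Sum>i\<le>d. Poly_Mapping.single 0 ((-1) ^ i) * elementary N (Suc i) * complete_sum {..<N} (d - i))"
proof -
  define q where "q r = fps_nth (signed_elementary_gen {..<N}) r" for r
  have "signed_elementary_gen {..<N} * complete_gen {..<N} = complete_gen {}"
    using complete_gen_mult_signed_elementary_gen[of "{..<N}" "{..<N}"] by (simp add: mult.commute)
  then have "0 = fps_nth (signed_elementary_gen {..<N} * complete_gen {..<N}) (Suc d)"
    by (simp add: complete_gen_def complete_sum_empty)
  also have "\<dots> = (\<Sum>i=0..Suc d. q i * complete_sum {..<N} (Suc d - i))"
    by (simp add: fps_mult_nth q_def complete_gen_def)
  also have "\<dots> = q 0 * complete_sum {..<N} (Suc d) + (\<Sum>i=0..d. q (Suc i) * complete_sum {..<N} (d - i))"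
    by (simp add: sum.atLeast0_atMost_Suc_shift del: sum.atLeast0_atMost_Suc sum.cl_ivl_Suc)
  also have "q 0 = 1"
    unfolding q_def signed_elementary_gen_def
    by (induction N) (simp_all add: lessThan_Suc)
  finally have "complete_sum {..<N} (Suc d) = - (\<Sum>i=0..d. q (Suc i) * complete_sum {..<N} (d - i))"
    by (simp add: eq_neg_iff_add_eq_0)
  also have "\<dots> = (\<Sum>i\<le>d. Poly_Mapping.single 0 ((-1) ^ i) * elementary N (Suc i) * complete_sum {..<N} (d - i))"
    unfolding sum_negf[symmetric] atLeast0AtMost
    by (rule sum.cong) (simp_all add: q_def signed_elementary_gen_nth single_uminus)
  finally show ?thesis .
qed

text \<open>
  After multiplication by \<open>a\<^sub>\<rho>\<close> this is \<open>sym_ring_mult_alternant\<close>; terms in which the parts fail to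
  decrease are kept here and vanish by \<open>schur_eq_0\<close>.
\<close>

lemma elementary_mult_schur:
  assumes "length \<mu> = N" "N > 0"
  shows "elementary N r * schur N \<mu>
    = (\<Sum>B | B \<subseteq> {..<N} \<and> card B = r. schur N (map (\<lambda>i. \<mu> ! i + (if i \<in> B then 1 else 0)) [0..<N]))"
proof (rule eq_if_mult_alternant_eq[OF assms(2)])
  define \<alpha> where "\<alpha> = exponent_vec N ((!) \<mu>) + staircase N"
  have "elementary N r * schur N \<mu> * alternant N (staircase N) = elementary N r * alternant N \<alpha>"
    by (simp add: mult.assoc schur_mult_alternant_staircase assms \<alpha>_def)
  also have "\<dots> = (\<Sum>\<beta>\<in>subset_vec ` {B. B \<subseteq> {..<N} \<and> card B = r}. alternant N (\<alpha> + \<beta>))"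
    unfolding elementary_def
    by (rule monomial_sum_mult_alternant)
      (use elementary_in_sym_ring[of N r] in \<open>auto simp: elementary_def finite_subsets_of_card\<close>)
  also have "\<dots> = (\<Sum>B | B \<subseteq> {..<N} \<and> card B = r. alternant N (\<alpha> + subset_vec B))"
    by (subst sum.reindex[OF inj_on_subset_vec]) simp
  also have "\<dots> = (\<Sum>B | B \<subseteq> {..<N} \<and> card B = r.
      schur N (map (\<lambda>i. \<mu> ! i + (if i \<in> B then 1 else 0)) [0..<N]) * alternant N (staircase N))"
  proof (intro sum.cong refl)
    fix B assume "B \<in> {B. B \<subseteq> {..<N} \<and> card B = r}"
    then have B: "B \<subseteq> {..<N}" "finite B" using finite_subset by auto
    have "\<alpha> + subset_vec B = exponent_vec N ((!) (map (\<lambda>i. \<mu> ! i + (if i \<in> B then 1 else 0)) [0..<N])) + staircase N"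
      by (rule poly_mapping_eqI) (use B in \<open>auto simp: \<alpha>_def lookup_add lookup_subset_vec\<close>)
    then show "alternant N (\<alpha> + subset_vec B)
        = schur N (map (\<lambda>i. \<mu> ! i + (if i \<in> B then 1 else 0)) [0..<N]) * alternant N (staircase N)"
      by (simp add: schur_mult_alternant_staircase)
  qed
  finally show "elementary N r * schur N \<mu> * alternant N (staircase N)
    = (\<Sum>B | B \<subseteq> {..<N} \<and> card B = r. schur N (map (\<lambda>i. \<mu> ! i + (if i \<in> B then 1 else 0)) [0..<N])) * alternant N (staircase N)"
    by (simp only: sum_distrib_right)
qed

section \<open>Schur polynomials of weights span modulo the fusion ideal\<close>

lemma ideal_fusion_ideal: "ideal (fusion_ideal N k) (sym_ring N)"
  and schur_column_in_fusion_ideal: "schur N (replicate N 1) - 1 \<in> fusion_ideal N k"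
  and schur_wall_in_fusion_ideal:
    "\<mu> \<in> partitions N \<Longrightarrow> \<mu> ! 0 = \<mu> ! (N - 1) + (k + 1) \<Longrightarrow> schur N \<mu> \<in> fusion_ideal N k"
proof -
  interpret R: cring "sym_ring N" by (rule cring_sym_ring)
  define S where "S = insert (schur N (replicate N 1) - 1)
     {schur N \<mu> | \<mu>. \<mu> \<in> partitions N \<and> \<mu> ! 0 = \<mu> ! (N - 1) + (k + 1)}"
  have S: "S \<subseteq> carrier (sym_ring N)"
    by (auto simp: S_def sym_ring_diff sym_ring_1 schur_in_sym_ring)
  have eq: "fusion_ideal N k = Idl\<^bsub>sym_ring N\<^esub> S"
    by (simp add: fusion_ideal_def S_def)
  show "ideal (fusion_ideal N k) (sym_ring N)"
    unfolding eq by (rule R.genideal_ideal[OF S])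
  have "S \<subseteq> fusion_ideal N k"
    unfolding eq by (rule R.genideal_self[OF S])
  then show "schur N (replicate N 1) - 1 \<in> fusion_ideal N k"
    and "\<mu> \<in> partitions N \<Longrightarrow> \<mu> ! 0 = \<mu> ! (N - 1) + (k + 1) \<Longrightarrow> schur N \<mu> \<in> fusion_ideal N k"
    by (auto simp: S_def)
qed

lemma fusion_ideal_0: "0 \<in> fusion_ideal N k"
proof -
  have "additive_subgroup (fusion_ideal N k) (sym_ring N)"
    by (rule ideal.axioms(1)[OF ideal_fusion_ideal])
  from additive_subgroup.zero_closed[OF this] show ?thesis by simp
qed

lemma fusion_ideal_add: "f \<in> fusion_ideal N k \<Longrightarrow> g \<in> fusion_ideal N k \<Longrightarrow> f + g \<in> fusion_ideal N k"
proof -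
  have "additive_subgroup (fusion_ideal N k) (sym_ring N)"
    by (rule ideal.axioms(1)[OF ideal_fusion_ideal])
  from additive_subgroup.a_closed[OF this, of f g]
  show "f \<in> fusion_ideal N k \<Longrightarrow> g \<in> fusion_ideal N k \<Longrightarrow> f + g \<in> fusion_ideal N k" by simp
qed

lemma fusion_ideal_mult: "g \<in> carrier (sym_ring N) \<Longrightarrow> f \<in> fusion_ideal N k \<Longrightarrow> g * f \<in> fusion_ideal N k"
proof -
  interpret ideal "fusion_ideal N k" "sym_ring N" by (rule ideal_fusion_ideal)
  show "g \<in> carrier (sym_ring N) \<Longrightarrow> f \<in> fusion_ideal N k \<Longrightarrow> g * f \<in> fusion_ideal N k"
    using I_l_closed[of f g] by simp
qed

definition spanned :: "nat \<Rightarrow> nat \<Rightarrow> rat_mpoly set" where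
  "spanned N k = {f. \<exists>c. f - schur_combination N k c \<in> fusion_ideal N k}"

lemma spanned_ideal: "f \<in> fusion_ideal N k \<Longrightarrow> f \<in> spanned N k"
proof -
  have "schur_combination N k (\<lambda>_. 0) = 0" by (simp add: schur_combination_def)
  then show "f \<in> fusion_ideal N k \<Longrightarrow> f \<in> spanned N k"
    unfolding spanned_def by (intro CollectI exI[of _ "\<lambda>_. 0"]) simp
qed

lemma spanned_add:
  assumes "f \<in> spanned N k" "g \<in> spanned N k"
  shows "f + g \<in> spanned N k"
proof -
  obtain c d where "f - schur_combination N k c \<in> fusion_ideal N k" "g - schur_combination N k d \<in> fusion_ideal N k"
    using assms by (auto simp: spanned_def)
  then have "f - schur_combination N k c + (g - schur_combination N k d) \<in> fusion_ideal N k"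
    by (rule fusion_ideal_add)
  moreover have "f - schur_combination N k c + (g - schur_combination N k d)
      = f + g - schur_combination N k (\<lambda>\<nu>. c \<nu> + d \<nu>)"
    by (simp add: schur_combination_def single_add distrib_right sum.distrib)
  ultimately show ?thesis unfolding spanned_def by auto
qed

lemma spanned_scale:
  assumes "f \<in> spanned N k"
  shows "Poly_Mapping.single 0 q * f \<in> spanned N k"
proof -
  obtain c where "f - schur_combination N k c \<in> fusion_ideal N k"
    using assms by (auto simp: spanned_def)
  then have "Poly_Mapping.single 0 q * (f - schur_combination N k c) \<in> fusion_ideal N k"
    by (rule fusion_ideal_mult[OF sym_ring_const])
  moreover have "Poly_Mapping.single 0 q * (f - schur_combination N k c)
      = Poly_Mapping.single 0 q * f - schur_combination N k (\<lambda>\<nu>. q * c \<nu>)"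
    by (simp add: schur_combination_def right_diff_distrib sum_distrib_left mult.assoc[symmetric] single_mult_single)
  ultimately show ?thesis unfolding spanned_def by auto
qed

lemma spanned_sum: "(\<And>i. i \<in> I \<Longrightarrow> f i \<in> spanned N k) \<Longrightarrow> (\<Sum>i\<in>I. f i) \<in> spanned N k"
  by (induction I rule: infinite_finite_induct) (auto intro: spanned_add spanned_ideal fusion_ideal_0)

lemma spanned_cong:
  assumes "f - g \<in> fusion_ideal N k" "g \<in> spanned N k"
  shows "f \<in> spanned N k"
  using spanned_add[OF spanned_ideal[OF assms(1)] assms(2)] by simp

lemma spanned_schur:
  assumes "\<kappa> \<in> weights N k"
  shows "schur N (weight_partition N \<kappa>) \<in> spanned N k"
proof -
  have "schur_combination N k (\<lambda>\<nu>. if \<nu> = \<kappa> then 1 else 0)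
      = (\<Sum>\<nu>\<in>weights N k. if \<nu> = \<kappa> then schur N (weight_partition N \<kappa>) else 0)"
    unfolding schur_combination_def by (rule sum.cong) auto
  also have "\<dots> = schur N (weight_partition N \<kappa>)"
    using assms by (simp add: sum.delta finite_weights)
  finally show ?thesis
    unfolding spanned_def by (intro CollectI exI[of _ "\<lambda>\<nu>. if \<nu> = \<kappa> then 1 else 0"]) (simp add: fusion_ideal_0)
qed

text \<open>
  Adding a vertical strip raises every part by at most one.  If the parts no longer decrease,
  the determinant vanishes; if the last part has become positive, a full column can be removed
  by means of the generator \<open>S\<^bsub>(1^N)\<^esub> - 1\<close>; and otherwise the first part is at most \<open>k + 1\<close>, with
  equality only for another generator.
\<close>

lemma spanned_schur_vertical_strip:
  fixes B :: "nat set"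
  assumes \<kappa>: "\<kappa> \<in> weights N k" and N: "N > 0"
  defines "\<mu> \<equiv> map (\<lambda>i. weight_partition N \<kappa> ! i + (if i \<in> B then 1 else 0)) [0..<N]"
  shows "schur N \<mu> \<in> spanned N k"
proof (cases "\<forall>i. Suc i < N \<longrightarrow> \<mu> ! Suc i \<le> \<mu> ! i")
  case False
  then obtain i where i: "Suc i < N" "\<mu> ! i < \<mu> ! Suc i" by (auto simp: not_le)
  then have "\<mu> ! Suc i = Suc (\<mu> ! i)"
    using weight_partition_antimono[of i "Suc i" N \<kappa>] by (auto simp: \<mu>_def split: if_splits)
  then show ?thesis
    using schur_eq_0[OF i(1)] by (simp add: spanned_ideal fusion_ideal_0)
next
  case True
  have nth: "\<mu> ! i = weight_partition N \<kappa> ! i + (if i \<in> B then 1 else 0)" if "i < N" for i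
    using that by (simp add: \<mu>_def)
  have len: "length \<mu> = N" by (simp add: \<mu>_def)
  have head: "\<mu> ! 0 \<le> Suc k" using weight_partition_head[OF \<kappa> N] N by (simp add: nth)
  have last: "\<mu> ! (N - 1) = (if N - 1 \<in> B then 1 else 0)"
    using nth[of "N - 1"] weight_partition_last[OF N, of \<kappa>] N by simp
  show ?thesis
  proof (cases "N - 1 \<in> B")
    \<comment> \<open>the last part is one: remove a full column\<close>
    case in_B: True
    have pos: "\<mu> ! i > 0" if "i < N" for i
    proof -
      have "i \<le> N - 1" using that by simp
      then have "\<mu> ! (N - 1) \<le> \<mu> ! i"
      proof (induction rule: inc_induct)
        case (step j)
        then have "Suc j < N" by simp
        then show ?case using True step.IH le_trans by blast
      qed simp
      then show ?thesis using last in_B by simp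
    qed
    define \<mu>' where "\<mu>' = map (\<lambda>x. x - 1) \<mu>"
    have \<mu>: "\<mu> = map Suc \<mu>'"
      by (rule nth_equalityI) (use pos len in \<open>auto simp: \<mu>'_def\<close>)
    have nth': "\<mu>' ! i = \<mu> ! i - 1" if "i < N" for i using that len by (simp add: \<mu>'_def)
    have len': "length \<mu>' = N" using len by (simp add: \<mu>'_def)
    obtain \<kappa>' where \<kappa>': "\<kappa>' \<in> weights N k" "weight_partition N \<kappa>' = \<mu>'"
    proof (rule obtain_weight[OF len'])
      show "\<mu>' ! Suc i \<le> \<mu>' ! i" if "Suc i < N" for i
        using True that by (simp add: nth' diff_le_mono)
      show "\<mu>' ! (N - 1) = 0" using last in_B N by (simp add: nth')
      show "\<mu>' ! 0 \<le> k" using head N by (simp add: nth')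
    qed (use N in auto)
    have "schur N \<mu>' * (schur N (replicate N 1) - 1) \<in> fusion_ideal N k"
      by (rule fusion_ideal_mult[OF schur_in_sym_ring schur_column_in_fusion_ideal])
    moreover have "schur N \<mu>' * (schur N (replicate N 1) - 1) = schur N \<mu> - schur N \<mu>'"
      unfolding \<mu> schur_map_Suc[OF len' N] by (simp add: algebra_simps)
    ultimately show ?thesis
      using spanned_cong spanned_schur[OF \<kappa>'(1)] \<kappa>'(2) by metis
  next
    case not_in_B: False
    then have last0: "\<mu> ! (N - 1) = 0" using last by simp
    show ?thesis
    proof (cases "\<mu> ! 0 = Suc k")
      \<comment> \<open>a generator of the ideal\<close>
      case wall: True
      have "\<mu> \<in> partitions N"
        unfolding partitions_def using len True
        by (auto simp: sorted_wrt_iff_nth_Suc_transp transp_def)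
      then have "schur N \<mu> \<in> fusion_ideal N k"
        by (rule schur_wall_in_fusion_ideal) (simp add: wall last0[unfolded One_nat_def])
      then show ?thesis by (rule spanned_ideal)
    next
      case False
      obtain \<kappa>' where "\<kappa>' \<in> weights N k" "weight_partition N \<kappa>' = \<mu>"
        by (rule obtain_weight[OF len _ last0 _ N, of k]) (use True head False in auto)
      then show ?thesis using spanned_schur[of \<kappa>' N k] by simp
    qed
  qed
qed

lemma spanned_elementary_mult:
  assumes f: "f \<in> spanned N k" and N: "N > 0"
  shows "elementary N r * f \<in> spanned N k"
proof -
  obtain c where "f - schur_combination N k c \<in> fusion_ideal N k"
    using f by (auto simp: spanned_def)
  then have "elementary N r * (f - schur_combination N k c) \<in> fusion_ideal N k"
    by (rule fusion_ideal_mult[OF elementary_in_sym_ring])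
  moreover have "elementary N r * schur_combination N k c \<in> spanned N k"
  proof -
    have "elementary N r * schur_combination N k c
        = (\<Sum>\<nu>\<in>weights N k. Poly_Mapping.single 0 (c \<nu>) * (elementary N r * schur N (weight_partition N \<nu>)))"
      by (simp add: schur_combination_def sum_distrib_left mult.left_commute)
    also have "\<dots> \<in> spanned N k"
      unfolding elementary_mult_schur[OF length_weight_partition N]
      by (intro spanned_sum spanned_scale spanned_schur_vertical_strip N)
    finally show ?thesis .
  qed
  ultimately show ?thesis
    by (intro spanned_cong[of "elementary N r * f" "elementary N r * schur_combination N k c"])
      (simp_all add: right_diff_distrib)
qed

text \<open>
  Adding the \<open>d\<close> boxes of \<open>h\<^sub>d\<close> at once can leave the level-\<open>k\<close> weights far behind, whereas
  elementary symmetric polynomials stay close to them; so \<open>h\<^sub>d\<close> is reduced to these recursively.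
\<close>

lemma spanned_complete_sum_mult:
  assumes f: "f \<in> spanned N k" and N: "N > 0"
  shows "complete_sum {..<N} d * f \<in> spanned N k"
proof (induction d rule: less_induct)
  case (less d)
  show ?case
  proof (cases d)
    case 0
    then show ?thesis using f by (simp add: complete_sum_0)
  next
    case (Suc e)
    have "complete_sum {..<N} d * f
        = (\<Sum>i\<le>e. Poly_Mapping.single 0 ((-1) ^ i) * (elementary N (Suc i) * (complete_sum {..<N} (e - i) * f)))"
      unfolding Suc complete_sum_recursion by (simp only: sum_distrib_right mult.assoc)
    also have "\<dots> \<in> spanned N k"
      by (intro spanned_sum spanned_scale spanned_elementary_mult N less) (simp add: Suc)
    finally show ?thesis .
  qed
qed

section \<open>Fusion coefficients for multiples of the first fundamental weight\<close>

lemma schur_row: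
  assumes "N \<ge> 2"
  shows "schur N (weight_partition N (fundamental_multiple m 1)) = complete_sum {..<N} m"
proof -
  define \<kappa> where "\<kappa> = fundamental_multiple m 1"
  define H where "H = mat N N (\<lambda>(i, j). complete_homogeneous N (int (weight_partition N \<kappa> ! i) - int i + int j))"
  have wp: "weight_partition N \<kappa> ! i = (if i = 0 then m else 0)" if "i < N" for i
  proof -
    have "weight_partition N \<kappa> ! i = (\<Sum>j = Suc i..N - 1. if j = 1 then m else 0)"
      unfolding nth_weight_partition[OF that] \<kappa>_def fundamental_multiple_def
      by (rule sum.cong) (auto simp: lookup_single when_def)
    also have "\<dots> = (if i = 0 then m else 0)"
      using assms by (simp add: sum.delta)
    finally show ?thesis .
  qed
  have "upper_triangular H"
    by (auto simp: H_def upper_triangular_def complete_homogeneous_eq wp)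
  moreover have "H \<in> carrier_mat N N" by (simp add: H_def)
  ultimately have "det H = prod_list (diag_mat H)"
    by (rule det_upper_triangular)
  also have "diag_mat H = complete_sum {..<N} m # replicate (N - 1) 1"
    by (rule nth_equalityI)
      (use assms in \<open>auto simp: diag_mat_def H_def complete_homogeneous_eq complete_sum_0 wp nth_Cons' simp del: upt_Suc\<close>)
  finally have "det H = complete_sum {..<N} m" by simp
  then show ?thesis by (simp only: schur_def H_def \<kappa>_def)
qed

lemma fusion_class_eq_iff:
  assumes "f \<in> carrier (sym_ring N)" "g \<in> carrier (sym_ring N)"
  shows "fusion_class N k f = fusion_class N k g \<longleftrightarrow> f - g \<in> fusion_ideal N k"
proof -
  interpret R: cring "sym_ring N" by (rule cring_sym_ring)
  have "\<ominus>\<^bsub>sym_ring N\<^esub> g = - g"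
    by (rule R.minus_equality) (use assms in \<open>auto intro: sym_ring_uminus\<close>)
  then have "f \<ominus>\<^bsub>sym_ring N\<^esub> g = f - g" by (simp add: a_minus_def)
  then show ?thesis
    using R.quotient_eq_iff_same_a_r_cos[OF ideal_fusion_ideal assms] by (simp add: fusion_class_def)
qed

lemma fusion_class_mult:
  assumes "f \<in> carrier (sym_ring N)" "g \<in> carrier (sym_ring N)"
  shows "fusion_class N k f \<otimes>\<^bsub>fusion_algebra N k\<^esub> fusion_class N k g = fusion_class N k (f * g)"
proof -
  interpret ideal "fusion_ideal N k" "sym_ring N" by (rule ideal_fusion_ideal)
  show ?thesis
    using rcoset_mult_add[OF assms] by (simp add: fusion_class_def fusion_algebra_def FactRing_def)
qed

text \<open>
  Existence of an expansion comes from \<open>spanned_complete_sum_mult\<close>; applying the functional of \<open>\<kappa>\<close>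
  to any such expansion computes its coefficient at \<open>\<kappa>\<close>, which also gives uniqueness.
\<close>

lemma fusion_coeff_eq_sum:
  assumes N: "N \<ge> 2" and \<mu>: "\<mu> \<in> weights N k" and \<nu>: "\<nu> \<in> weights N k"
  shows "fusion_coeff N k \<mu> (fundamental_multiple m 1) \<nu>
    = (\<Sum>\<beta>\<in>exponents {..<N} m. weight_functional N k \<nu> (shifted_partition N \<mu> + \<beta>))"
proof -
  define h where "h = complete_sum {..<N} m"
  define S where "S = schur N (weight_partition N \<mu>)"
  have N0: "N > 0" using N by simp
  have h: "h \<in> carrier (sym_ring N)" unfolding h_def by (rule complete_sum_in_sym_ring)
  have S: "S \<in> carrier (sym_ring N)" unfolding S_def by (rule schur_in_sym_ring)
  define is_coeff where "is_coeff c \<longleftrightarrow> (\<forall>\<kappa>. \<kappa> \<notin> weights N k \<longrightarrow> c \<kappa> = 0) \<and>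
      S * h - schur_combination N k c \<in> fusion_ideal N k" for c
  have coeff: "c \<kappa> = (\<Sum>\<beta>\<in>exponents {..<N} m. weight_functional N k \<kappa> (shifted_partition N \<mu> + \<beta>))"
    if c: "is_coeff c" and \<kappa>: "\<kappa> \<in> weights N k" for c \<kappa>
  proof -
    have anti: "antisymmetric N (weight_functional N k \<kappa>)"
      unfolding weight_functional_def by (rule antisymmetric_fusion_functional)
    have "pairing (weight_functional N k \<kappa>) ((S * h - schur_combination N k c) * alternant N (staircase N)) = 0"
      unfolding weight_functional_def
      by (rule fusion_ideal_annihilated[OF N]) (use c in \<open>simp add: is_coeff_def\<close>)
    then have "fact N * c \<kappa> = pairing (weight_functional N k \<kappa>) (S * h * alternant N (staircase N))"
      by (simp add: left_diff_distrib pairing_diff pairing_schur_combination[OF \<kappa> N0])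
    also have "S * h * alternant N (staircase N) = h * alternant N (shifted_partition N \<mu>)"
      using schur_mult_alternant_staircase[of "weight_partition N \<mu>" N]
      by (simp add: S_def shifted_partition_def mult_ac)
    also have "h * alternant N (shifted_partition N \<mu>) = (\<Sum>\<beta>\<in>exponents {..<N} m. alternant N (shifted_partition N \<mu> + \<beta>))"
      using monomial_sum_mult_alternant[of "exponents {..<N} m" N] h
      by (simp add: h_def complete_sum_eq_monomial_sum finite_exponents)
    finally show ?thesis
      by (simp add: pairing_sum pairing_alternant[OF anti] flip: sum_distrib_left)
  qed
  have "S * h \<in> spanned N k"
    using spanned_complete_sum_mult[OF spanned_schur[OF \<mu>] N0, of m] by (simp add: S_def h_def mult.commute)
  then obtain c where c: "S * h - schur_combination N k c \<in> fusion_ideal N k"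
    by (auto simp: spanned_def)
  define c' where "c' \<kappa> = (if \<kappa> \<in> weights N k then c \<kappa> else 0)" for \<kappa>
  have "schur_combination N k c' = schur_combination N k c"
    unfolding schur_combination_def by (rule sum.cong) (auto simp: c'_def)
  then have c': "is_coeff c'" using c by (simp add: is_coeff_def c'_def)
  have "fusion_coeff N k \<mu> (fundamental_multiple m 1) = (THE c. is_coeff c)"
    unfolding fusion_coeff_def is_coeff_def schur_row[OF N] schur_combination_def[symmetric] S_def[symmetric] h_def[symmetric]
      fusion_class_mult[OF S h] fusion_class_eq_iff[OF sym_ring_mult[OF S h] schur_combination_in_sym_ring] ..
  also have "\<dots> = c'"
  proof (rule the_equality[of is_coeff, OF c'])
    fix d assume d: "is_coeff d"
    show "d = c'"
    proof
      fix \<kappa> show "d \<kappa> = c' \<kappa>"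
        using coeff[OF d, of \<kappa>] coeff[OF c', of \<kappa>] d c' by (cases "\<kappa> \<in> weights N k") (auto simp: is_coeff_def)
    qed
  qed
  finally show ?thesis using coeff[OF c' \<nu>] by simp
qed

section \<open>Orbits of vectors\<close>

definition fibre_card :: "nat \<Rightarrow> (nat \<Rightarrow> 'a) \<Rightarrow> 'a \<Rightarrow> nat" where
  "fibre_card k x v = card {i \<in> {1..k}. x i = v}"

lemma obtain_permutation:
  assumes "\<And>v. fibre_card k x v = fibre_card k y v"
  obtains p where "p permutes {1..k}" "\<And>i. i \<in> {1..k} \<Longrightarrow> x i = y (p i)"
proof -
  have "image_mset x (mset_set {1..k}) = image_mset y (mset_set {1..k})"
    by (rule multiset_eqI) (use assms in \<open>simp add: count_image_mset_eq_card_vimage fibre_card_def\<close>)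
  then show ?thesis
    using image_mset_eq_implies_permutes[of "{1..k}" x y] that by (metis finite_atLeastAtMost)
qed

lemma fibre_card_permute:
  assumes "p permutes {1..k}"
  shows "fibre_card k (x \<circ> p) v = fibre_card k x v"
proof -
  have "{i \<in> {1..k}. (x \<circ> p) i = v} = p -` {i \<in> {1..k}. x i = v}"
    using permutes_in_image[OF assms] by auto
  then show ?thesis
    unfolding fibre_card_def
    using card_vimage_inj[OF permutes_inj[OF assms], of "{i \<in> {1..k}. x i = v}"] permutes_surj[OF assms]
    by simp
qed

lemma permute_vec_compose:
  assumes "g permutes S" "h permutes S"
  shows "permute_vec h (permute_vec g x) = permute_vec (h \<circ> g) x"
  by (simp add: permute_vec_def permutes_inv_o o_assoc o_inv_distrib permutes_bij[OF assms(1)] permutes_bij[OF assms(2)])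

lemma mem_vec_orbit_iff:
  assumes "x0 \<in> extensional {1..k}"
  shows "x \<in> vec_orbit k x0 \<longleftrightarrow> x \<in> extensional {1..k} \<and> (\<forall>v. fibre_card k x v = fibre_card k x0 v)"
proof
  assume "x \<in> vec_orbit k x0"
  then obtain g where g: "g permutes {1..k}" and x: "x = x0 \<circ> inv' g"
    by (auto simp: vec_orbit_def orbit_def sym_group_carrier permute_vec_def)
  have q: "inv' g permutes {1..k}" by (rule permutes_inv[OF g])
  have "x i = undefined" if "i \<notin> {1..k}" for i
    using assms that permutes_not_in[OF q that] by (simp add: x extensional_def)
  then show "x \<in> extensional {1..k} \<and> (\<forall>v. fibre_card k x v = fibre_card k x0 v)"
    using fibre_card_permute[OF q, of x0] by (simp add: x extensional_def)
next
  assume *: "x \<in> extensional {1..k} \<and> (\<forall>v. fibre_card k x v = fibre_card k x0 v)"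
  then obtain p where p: "p permutes {1..k}" and eq: "\<And>i. i \<in> {1..k} \<Longrightarrow> x i = x0 (p i)"
    using obtain_permutation[of k x x0] by blast
  have "x = x0 \<circ> p"
  proof
    fix i show "x i = (x0 \<circ> p) i"
      using eq[of i] permutes_not_in[OF p, of i] * assms
      by (cases "i \<in> {1..k}") (simp_all add: extensional_def)
  qed
  then have "x = permute_vec (inv' p) x0"
    by (simp add: permute_vec_def permutes_inv_inv[OF p])
  then show "x \<in> vec_orbit k x0"
    using permutes_inv[OF p] by (auto simp: vec_orbit_def orbit_def sym_group_carrier)
qed

text \<open>The multiplicity of the residue \<open>j < N\<close> in the orbit of the weight.\<close>

definition content :: "nat \<Rightarrow> nat \<Rightarrow> weight \<Rightarrow> nat \<Rightarrow> nat" where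
  "content N k \<kappa> j = (if j = 0 then k - (\<Sum>j = 1..N - 1. Poly_Mapping.lookup \<kappa> j) else Poly_Mapping.lookup \<kappa> j)"

lemma length_filter_weight_entries:
  assumes "N > 0"
  shows "length (filter ((=) v) (weight_entries N k \<kappa>)) = (\<Sum>j<N. if int j = v then content N k \<kappa> j else 0)"
proof -
  have "length (filter ((=) v) (concat (map (\<lambda>j. replicate (Poly_Mapping.lookup \<kappa> j) (int j)) (rev [1..<N]))))
      = (\<Sum>j\<leftarrow>rev [1..<N]. if int j = v then Poly_Mapping.lookup \<kappa> j else 0)"
    unfolding filter_concat length_concat map_map
    by (intro arg_cong[where f = sum_list] map_cong refl) auto
  also have "\<dots> = (\<Sum>j\<leftarrow>[1..<N]. if int j = v then Poly_Mapping.lookup \<kappa> j else 0)"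
    by (simp only: rev_map[symmetric] sum_list_rev)
  also have "\<dots> = (\<Sum>j\<in>{1..<N}. if int j = v then content N k \<kappa> j else 0)"
  proof -
    have "(\<Sum>j\<leftarrow>[1..<N]. if int j = v then Poly_Mapping.lookup \<kappa> j else 0)
        = (\<Sum>j\<in>{1..<N}. if int j = v then Poly_Mapping.lookup \<kappa> j else 0)"
      by (subst sum_list_distinct_conv_sum_set) (simp_all del: upt_Suc)
    also have "\<dots> = (\<Sum>j\<in>{1..<N}. if int j = v then content N k \<kappa> j else 0)"
      by (rule sum.cong) (simp_all add: content_def)
    finally show ?thesis .
  qed
  finally have *: "length (filter ((=) v) (concat (map (\<lambda>j. replicate (Poly_Mapping.lookup \<kappa> j) (int j)) (rev [1..<N]))))
      = (\<Sum>j\<in>{1..<N}. if int j = v then content N k \<kappa> j else 0)" .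
  have "{..<N} = insert 0 {1..<N}" using assms by auto
  then have "(\<Sum>j<N. if int j = v then content N k \<kappa> j else 0)
     = (\<Sum>j\<in>{1..<N}. if int j = v then content N k \<kappa> j else 0) + (if int 0 = v then content N k \<kappa> 0 else 0)"
    by (simp only:) (subst sum.insert, auto)
  moreover have "length (filter ((=) v) (replicate (k - (\<Sum>j = 1..N - 1. Poly_Mapping.lookup \<kappa> j)) 0))
     = (if int 0 = v then content N k \<kappa> 0 else 0)"
    by (auto simp: content_def)
  ultimately show ?thesis
    unfolding weight_entries_def filter_append length_append * by (simp only:)
qed

lemma length_weight_entries:
  assumes "\<kappa> \<in> weights N k"
  shows "length (weight_entries N k \<kappa>) = k"
proof -
  have "(\<Sum>j\<leftarrow>rev [1..<N]. Poly_Mapping.lookup \<kappa> j) = (\<Sum>j\<leftarrow>[1..<N]. Poly_Mapping.lookup \<kappa> j)"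
    by (simp only: rev_map[symmetric] sum_list_rev)
  also have "\<dots> = (\<Sum>j\<in>{1..<N}. Poly_Mapping.lookup \<kappa> j)"
    by (simp add: sum_list_distinct_conv_sum_set)
  also have "{1..<N} = {1..N - 1}" by auto
  finally have "(\<Sum>j\<leftarrow>rev [1..<N]. Poly_Mapping.lookup \<kappa> j) = (\<Sum>j = 1..N - 1. Poly_Mapping.lookup \<kappa> j)" .
  then show ?thesis
    using assms by (simp add: weight_entries_def weights_def length_concat o_def)
qed

lemma fibre_card_weight_vec:
  assumes "\<kappa> \<in> weights N k" "N > 0"
  shows "fibre_card k (weight_vec N k \<kappa>) v = (\<Sum>j<N. if int j = v then content N k \<kappa> j else 0)"
proof -
  define L where "L = weight_entries N k \<kappa>"
  have "{i \<in> {1..k}. weight_vec N k \<kappa> i = v} = Suc ` {i. i < length L \<and> v = L ! i}"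
  proof (intro equalityI subsetI)
    fix i assume "i \<in> {i \<in> {1..k}. weight_vec N k \<kappa> i = v}"
    then show "i \<in> Suc ` {i. i < length L \<and> v = L ! i}"
      by (intro image_eqI[of _ _ "i - 1"]) (auto simp: weight_vec_def L_def length_weight_entries[OF assms(1)])
  qed (auto simp: weight_vec_def L_def length_weight_entries[OF assms(1)])
  then have "fibre_card k (weight_vec N k \<kappa>) v = length (filter ((=) v) L)"
    by (simp add: fibre_card_def card_image length_filter_conv_card)
  then show ?thesis by (simp add: L_def length_filter_weight_entries[OF assms(2)])
qed

lemma mem_weight_orbit_iff:
  assumes "\<kappa> \<in> weights N k" "N > 0"
  shows "x \<in> weight_orbit N k \<kappa> \<longleftrightarrow> x \<in> extensional {1..k} \<and> (\<forall>i\<in>{1..k}. x i \<in> {0..<int N})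
      \<and> (\<forall>j<N. fibre_card k x (int j) = content N k \<kappa> j)"
proof -
  have ext: "weight_vec N k \<kappa> \<in> extensional {1..k}" by (simp add: weight_vec_def)
  have "(\<forall>v. fibre_card k x v = fibre_card k (weight_vec N k \<kappa>) v)
    \<longleftrightarrow> (\<forall>i\<in>{1..k}. x i \<in> {0..<int N}) \<and> (\<forall>j<N. fibre_card k x (int j) = content N k \<kappa> j)" (is "?L \<longleftrightarrow> ?R")
  proof
    assume L: ?L
    have "x i \<in> {0..<int N}" if i: "i \<in> {1..k}" for i
    proof (rule ccontr)
      assume "x i \<notin> {0..<int N}"
      then have "(\<Sum>j<N. if int j = x i then content N k \<kappa> j else 0) = 0"
        by (intro sum.neutral) auto
      then have "fibre_card k x (x i) = 0" using L by (simp add: fibre_card_weight_vec[OF assms])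
      then show False using i by (auto simp: fibre_card_def)
    qed
    moreover have "fibre_card k x (int j) = content N k \<kappa> j" if "j < N" for j
      using L that by (simp add: fibre_card_weight_vec[OF assms] sum.delta)
    ultimately show ?R by blast
  next
    assume R: ?R
    show ?L
    proof
      fix v
      show "fibre_card k x v = fibre_card k (weight_vec N k \<kappa>) v"
      proof (cases "v \<in> {0..<int N}")
        case True
        then obtain j where "v = int j" "j < N" by (metis atLeastLessThan_iff nonneg_int_cases of_nat_less_iff)
        then show ?thesis using R by (simp add: fibre_card_weight_vec[OF assms] sum.delta)
      next
        case False
        then have "(\<Sum>j<N. if int j = v then content N k \<kappa> j else 0) = 0"
          by (intro sum.neutral) auto
        moreover have "{i \<in> {1..k}. x i = v} = {}" using False R by auto
        ultimately show ?thesis by (simp add: fibre_card_weight_vec[OF assms]) (simp add: fibre_card_def)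
      qed
    qed
  qed
  then show ?thesis unfolding weight_orbit_def mem_vec_orbit_iff[OF ext] by blast
qed

section \<open>Orbits of triples\<close>

definition cyclic_pred :: "nat \<Rightarrow> nat \<Rightarrow> nat" where
  "cyclic_pred N j = (if j = 0 then N - 1 else j - 1)"

lemma cyclic_pred_less: "j < N \<Longrightarrow> cyclic_pred N j < N"
  by (auto simp: cyclic_pred_def)

lemma succ_mod_eq_iff:
  assumes "u \<in> {0..<int N}" "j < N"
  shows "(u + 1) mod int N = int j \<longleftrightarrow> u = int (cyclic_pred N j)"
proof (cases "u = int N - 1")
  case True
  then show ?thesis using assms by (auto simp: cyclic_pred_def)
next
  case False
  then have "(u + 1) mod int N = u + 1" using assms by simp
  then show ?thesis using assms False by (auto simp: cyclic_pred_def)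
qed

text \<open>
  Among the \<open>a j\<close> entries equal to \<open>j\<close>, raise \<open>b j\<close> by one modulo \<open>N\<close>; the resulting multiplicities
  are \<open>c\<close>.
\<close>

definition pieri_vector :: "nat \<Rightarrow> nat \<Rightarrow> (nat \<Rightarrow> nat) \<Rightarrow> (nat \<Rightarrow> nat) \<Rightarrow> (nat \<Rightarrow> nat) \<Rightarrow> bool" where
  "pieri_vector N m a c b \<longleftrightarrow> (\<forall>j<N. b j \<le> a j) \<and> (\<Sum>j<N. b j) = m \<and>
     (\<forall>j<N. c j + b j = a j + b (cyclic_pred N j))"

text \<open>
  The equations fix the differences of consecutive entries, and the total fixes the remaining
  constant.
\<close>

lemma pieri_vector_unique:
  assumes "pieri_vector N m a c b" "pieri_vector N m a c b'" "j < N"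
  shows "b j = b' j"
proof -
  define d where "d j = int (b j) - int (b' j)" for j
  have step: "d (Suc i) = d i" if "Suc i < N" for i
  proof -
    have "c (Suc i) + b (Suc i) = a (Suc i) + b (cyclic_pred N (Suc i))"
      "c (Suc i) + b' (Suc i) = a (Suc i) + b' (cyclic_pred N (Suc i))"
      using assms(1,2) that unfolding pieri_vector_def by blast+
    then show ?thesis by (simp add: d_def cyclic_pred_def)
  qed
  have const: "d i = d 0" if "i < N" for i
    using that by (induction i) (simp_all add: step)
  have "(\<Sum>i<N. d i) = int (\<Sum>i<N. b i) - int (\<Sum>i<N. b' i)"
    by (simp add: d_def sum_subtractf)
  also have "\<dots> = 0" using assms(1,2) by (simp add: pieri_vector_def)
  also have "(\<Sum>i<N. d i) = (\<Sum>i<N. d 0)" by (rule sum.cong) (auto intro: const)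
  finally have "d 0 = 0" using assms(3) by simp
  then show ?thesis using const[OF assms(3)] by (simp add: d_def)
qed

lemma fibre_card_split:
  assumes "\<And>i. i \<in> {1..k} \<Longrightarrow> y i = 0 \<or> y i = (1::int)"
  shows "fibre_card k x u = fibre_card k (\<lambda>i. (x i, y i)) (u, 0) + fibre_card k (\<lambda>i. (x i, y i)) (u, 1)"
proof -
  have "{i \<in> {1..k}. x i = u} = {i \<in> {1..k}. (x i, y i) = (u, 0)} \<union> {i \<in> {1..k}. (x i, y i) = (u, 1)}"
    using assms by auto
  then show ?thesis
    unfolding fibre_card_def by (simp only:) (rule card_Un_disjoint, auto)
qed

text \<open>An entry \<open>j\<close> of the sum arises from \<open>j + 0\<close> or from the preceding residue plus one.\<close>

lemma fibre_card_sum: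
  assumes x: "\<And>i. i \<in> {1..k} \<Longrightarrow> x i \<in> {0..<int N}" and y: "\<And>i. i \<in> {1..k} \<Longrightarrow> y i = 0 \<or> y i = 1"
    and z: "\<And>i. i \<in> {1..k} \<Longrightarrow> z i = (x i + y i) mod int N" and j: "j < N"
  shows "fibre_card k z (int j) = fibre_card k (\<lambda>i. (x i, y i)) (int j, 0)
      + fibre_card k (\<lambda>i. (x i, y i)) (int (cyclic_pred N j), 1)"
proof -
  have "z i = int j \<longleftrightarrow> (x i, y i) = (int j, 0) \<or> (x i, y i) = (int (cyclic_pred N j), 1)"
    if i: "i \<in> {1..k}" for i
    using y[OF i] succ_mod_eq_iff[OF x[OF i] j] x[OF i] z[OF i] by auto
  then have "{i \<in> {1..k}. z i = int j}
      = {i \<in> {1..k}. (x i, y i) = (int j, 0)} \<union> {i \<in> {1..k}. (x i, y i) = (int (cyclic_pred N j), 1)}"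
    by blast
  then show ?thesis
    unfolding fibre_card_def by (simp only:) (rule card_Un_disjoint, auto)
qed

lemma sum_fibre_card:
  assumes "\<And>i. i \<in> {1..k} \<Longrightarrow> x i \<in> {0..<int N}"
  shows "(\<Sum>j<N. fibre_card k (\<lambda>i. (x i, y i)) (int j, v)) = fibre_card k y v"
proof -
  have "{i \<in> {1..k}. y i = v} = (\<Union>j<N. {i \<in> {1..k}. (x i, y i) = (int j, v)})"
  proof (intro equalityI subsetI)
    fix i assume i: "i \<in> {i \<in> {1..k}. y i = v}"
    then have "nat (x i) < N" "int (nat (x i)) = x i" using assms[of i] by auto
    then show "i \<in> (\<Union>j<N. {i \<in> {1..k}. (x i, y i) = (int j, v)})"
      using i by (intro UN_I[of "nat (x i)"]) auto
  qed auto
  then show ?thesis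
    unfolding fibre_card_def by (simp only:) (rule card_UN_disjoint[symmetric], auto)
qed

lemma mem_sum_triples_iff:
  "(x, y, z) \<in> sum_triples N k A B C
    \<longleftrightarrow> x \<in> A \<and> y \<in> B \<and> z \<in> C \<and> z = (\<lambda>i\<in>{1..k}. (x i + y i) mod int N)"
  by (auto simp: sum_triples_def ZNk_def)

lemma content_fundamental_multiple:
  assumes "m \<le> k" "N \<ge> 2"
  shows "fundamental_multiple m 1 \<in> weights N k"
    and "content N k (fundamental_multiple m 1) j = (if j = 0 then k - m else if j = 1 then m else 0)"
proof -
  define \<kappa> where "\<kappa> = fundamental_multiple m 1"
  have lk: "Poly_Mapping.lookup \<kappa> j = (if j = 1 then m else 0)" for j
    by (auto simp: \<kappa>_def fundamental_multiple_def lookup_single when_def)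
  have sum: "(\<Sum>j = 1..N - 1. Poly_Mapping.lookup \<kappa> j) = m"
    unfolding lk using assms by (simp add: sum.delta)
  have "Poly_Mapping.keys \<kappa> \<subseteq> {1..N - 1}"
    using assms by (auto simp: in_keys_iff lk split: if_splits)
  then show "fundamental_multiple m 1 \<in> weights N k"
    using assms sum unfolding weights_def \<kappa>_def by simp
  show "content N k (fundamental_multiple m 1) j = (if j = 0 then k - m else if j = 1 then m else 0)"
    unfolding content_def \<kappa>_def[symmetric] sum lk by auto
qed

lemma mem_row_orbit_iff:
  assumes "m \<le> k" "N \<ge> 2"
  shows "y \<in> weight_orbit N k (fundamental_multiple m 1)
    \<longleftrightarrow> y \<in> extensional {1..k} \<and> (\<forall>i\<in>{1..k}. y i = 0 \<or> y i = 1) \<and> fibre_card k y 1 = m"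
proof -
  define \<kappa> where "\<kappa> = fundamental_multiple m 1"
  have w: "\<kappa> \<in> weights N k" unfolding \<kappa>_def by (rule content_fundamental_multiple(1)[OF assms])
  have content: "content N k \<kappa> j = (if j = 0 then k - m else if j = 1 then m else 0)" for j
    unfolding \<kappa>_def by (rule content_fundamental_multiple(2)[OF assms])
  have "(\<forall>i\<in>{1..k}. y i \<in> {0..<int N}) \<and> (\<forall>j<N. fibre_card k y (int j) = content N k \<kappa> j)
    \<longleftrightarrow> (\<forall>i\<in>{1..k}. y i = 0 \<or> y i = 1) \<and> fibre_card k y 1 = m" (is "?L \<longleftrightarrow> ?R")
  proof
    assume L: ?L
    have "y i = 0 \<or> y i = 1" if i: "i \<in> {1..k}" for i
    proof (rule ccontr)
      assume no: "\<not> (y i = 0 \<or> y i = 1)"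
      have "0 \<le> y i" "y i < int N" using L i by auto
      then have j: "nat (y i) < N" "int (nat (y i)) = y i" by (simp_all add: nat_less_iff)
      have "fibre_card k y (int (nat (y i))) = content N k \<kappa> (nat (y i))"
        using L j(1) by blast
      also have "\<dots> = 0" unfolding content using no j(2) by auto
      finally show False using i j(2) by (auto simp: fibre_card_def)
    qed
    moreover have "fibre_card k y (int 1) = content N k \<kappa> 1"
      using L[THEN conjunct2, rule_format, of 1] assms(2) by simp
    ultimately show ?R by (simp add: content)
  next
    assume R: ?R
    have total: "fibre_card k y 0 + fibre_card k y 1 = k"
    proof -
      have "fibre_card k (\<lambda>_. ()) () = fibre_card k (\<lambda>i. ((), y i)) ((), 0) + fibre_card k (\<lambda>i. ((), y i)) ((), 1)"
        by (rule fibre_card_split) (use R in blast)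
      then show ?thesis by (simp add: fibre_card_def del: atLeastAtMost_iff)
    qed
    have "fibre_card k y (int j) = content N k \<kappa> j" if "j < N" for j
    proof -
      consider "j = 0" | "j = 1" | "j \<ge> 2" by linarith
      then show ?thesis
      proof cases
        case 1
        then show ?thesis using total R by (simp add: content)
      next
        case 2
        then show ?thesis using R by (simp add: content)
      next
        case 3
        then have "{i \<in> {1..k}. y i = int j} = {}" using R by force
        then show ?thesis using 3 unfolding content fibre_card_def by simp
      qed
    qed
    moreover have "y i \<in> {0..<int N}" if "i \<in> {1..k}" for i
      using R that assms(2) by force
    ultimately show ?L by blast
  qed
  moreover have "N > 0" using assms(2) by simp
  ultimately show ?thesis
    unfolding \<kappa>_def[symmetric] mem_weight_orbit_iff[OF w \<open>N > 0\<close>] by blast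
qed

lemma permute_triple_compose:
  assumes "g permutes S" "h permutes S"
  shows "permute_triple h (permute_triple g t) = permute_triple (h \<circ> g) t"
  by (cases t) (simp add: permute_triple_def permute_vec_compose[OF assms])

lemma orbit_permute_triple:
  assumes "g permutes {1..k}"
  shows "orbit (sym_group k) permute_triple (permute_triple g t) = orbit (sym_group k) permute_triple t"
proof (intro equalityI subsetI)
  fix s assume "s \<in> orbit (sym_group k) permute_triple (permute_triple g t)"
  then obtain h where "h permutes {1..k}" "s = permute_triple h (permute_triple g t)"
    by (auto simp: orbit_def sym_group_carrier)
  then show "s \<in> orbit (sym_group k) permute_triple t"
    using permutes_compose[OF assms] permute_triple_compose[OF assms]
    by (auto simp: orbit_def sym_group_carrier)
next
  fix s assume "s \<in> orbit (sym_group k) permute_triple t"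
  then obtain h where h: "h permutes {1..k}" "s = permute_triple h t"
    by (auto simp: orbit_def sym_group_carrier)
  have q: "h \<circ> inv' g permutes {1..k}"
    by (rule permutes_compose[OF permutes_inv[OF assms] h(1)])
  have "permute_triple (h \<circ> inv' g) (permute_triple g t) = permute_triple h t"
    by (simp add: permute_triple_compose[OF assms q] o_assoc[symmetric] permutes_inv_o[OF assms])
  then show "s \<in> orbit (sym_group k) permute_triple (permute_triple g t)"
    using q h(2) by (force simp: orbit_def sym_group_carrier)
qed

context
  fixes N k m :: nat and \<mu> \<nu> :: weight
  assumes N: "N \<ge> 2" and m: "m \<le> k" and \<mu>: "\<mu> \<in> weights N k" and \<nu>: "\<nu> \<in> weights N k"
begin

definition joint_card :: "(nat \<Rightarrow> int) \<Rightarrow> (nat \<Rightarrow> int) \<Rightarrow> nat \<Rightarrow> nat" where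
  "joint_card x y j = fibre_card k (\<lambda>i. (x i, y i)) (int j, 1)"

abbreviation (input) triples where
  "triples \<equiv> sum_triples N k (weight_orbit N k \<mu>) (weight_orbit N k (fundamental_multiple m 1)) (weight_orbit N k \<nu>)"

lemma sum_triples_iff_pieri_vector:
  assumes x: "x \<in> weight_orbit N k \<mu>" and y: "y \<in> weight_orbit N k (fundamental_multiple m 1)"
    and z: "z = (\<lambda>i\<in>{1..k}. (x i + y i) mod int N)"
  shows "(x, y, z) \<in> triples \<longleftrightarrow> pieri_vector N m (content N k \<mu>) (content N k \<nu>) (joint_card x y)"
proof -
  have N0: "N > 0" using N by simp
  have x': "\<And>i. i \<in> {1..k} \<Longrightarrow> x i \<in> {0..<int N}" "\<And>j. j < N \<Longrightarrow> fibre_card k x (int j) = content N k \<mu> j"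
    using x unfolding mem_weight_orbit_iff[OF \<mu> N0] by blast+
  have y': "\<And>i. i \<in> {1..k} \<Longrightarrow> y i = 0 \<or> y i = 1" "fibre_card k y 1 = m"
    using y unfolding mem_row_orbit_iff[OF m N] by blast+
  have z': "z i = (x i + y i) mod int N" if "i \<in> {1..k}" for i using that z by simp
  have split: "content N k \<mu> j = fibre_card k (\<lambda>i. (x i, y i)) (int j, 0) + joint_card x y j" if "j < N" for j
    using fibre_card_split[of k y x "int j", OF y'(1)] x'(2)[OF that] by (simp add: joint_card_def)
  have sum: "fibre_card k z (int j) = fibre_card k (\<lambda>i. (x i, y i)) (int j, 0) + joint_card x y (cyclic_pred N j)" if "j < N" for j
    unfolding joint_card_def by (rule fibre_card_sum[OF x'(1) y'(1) z' that])
  have total: "(\<Sum>j<N. joint_card x y j) = m"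
    using sum_fibre_card[of k x N y 1, OF x'(1)] y'(2) by (simp add: joint_card_def)
  have zmem: "z \<in> extensional {1..k}" "\<And>i. i \<in> {1..k} \<Longrightarrow> z i \<in> {0..<int N}"
    using N by (auto simp: z)
  have "(x, y, z) \<in> triples \<longleftrightarrow> z \<in> weight_orbit N k \<nu>"
    using x y z by (simp add: mem_sum_triples_iff)
  also have "\<dots> \<longleftrightarrow> (\<forall>j<N. fibre_card k z (int j) = content N k \<nu> j)"
    unfolding mem_weight_orbit_iff[OF \<nu> N0] using zmem by blast
  also have "\<dots> \<longleftrightarrow> (\<forall>j<N. content N k \<nu> j + joint_card x y j = content N k \<mu> j + joint_card x y (cyclic_pred N j))"
    using split sum by auto
  also have "\<dots> \<longleftrightarrow> pieri_vector N m (content N k \<mu>) (content N k \<nu>) (joint_card x y)"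
    using split total by (auto simp: pieri_vector_def)
  finally show ?thesis .
qed

text \<open>
  By \<open>pieri_vector_unique\<close> the pairs \<open>(x\<^sub>i, y\<^sub>i)\<close> have the same joint distribution in both triples,
  so one permutation carries \<open>x\<close> and \<open>y\<close>, and with them \<open>z\<close>, to \<open>x\<close>, \<open>y\<close>, \<open>z\<close> of the other triple.
\<close>

lemma sum_triples_same_orbit:
  assumes t: "(x, y, z) \<in> triples" and t': "(x', y', z') \<in> triples"
  shows "\<exists>g. g permutes {1..k} \<and> (x, y, z) = permute_triple g (x', y', z')"
proof -
  have N0: "N > 0" using N by simp
  have mem: "x \<in> weight_orbit N k \<mu>" "y \<in> weight_orbit N k (fundamental_multiple m 1)"
      "z = (\<lambda>i\<in>{1..k}. (x i + y i) mod int N)"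
    and mem': "x' \<in> weight_orbit N k \<mu>" "y' \<in> weight_orbit N k (fundamental_multiple m 1)"
      "z' = (\<lambda>i\<in>{1..k}. (x' i + y' i) mod int N)"
    using t t' by (auto simp: mem_sum_triples_iff)
  have x: "x \<in> extensional {1..k}" "\<And>i. i \<in> {1..k} \<Longrightarrow> x i \<in> {0..<int N}" "\<And>j. j < N \<Longrightarrow> fibre_card k x (int j) = content N k \<mu> j"
    and x': "x' \<in> extensional {1..k}" "\<And>i. i \<in> {1..k} \<Longrightarrow> x' i \<in> {0..<int N}" "\<And>j. j < N \<Longrightarrow> fibre_card k x' (int j) = content N k \<mu> j"
    using mem(1) mem'(1) unfolding mem_weight_orbit_iff[OF \<mu> N0] by blast+
  have y: "y \<in> extensional {1..k}" "\<And>i. i \<in> {1..k} \<Longrightarrow> y i = 0 \<or> y i = 1"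
    and y': "y' \<in> extensional {1..k}" "\<And>i. i \<in> {1..k} \<Longrightarrow> y' i = 0 \<or> y' i = 1"
    using mem(2) mem'(2) unfolding mem_row_orbit_iff[OF m N] by blast+
  have b: "joint_card x y j = joint_card x' y' j" if "j < N" for j
    using pieri_vector_unique[OF _ _ that] t t'
    unfolding sum_triples_iff_pieri_vector[OF mem] sum_triples_iff_pieri_vector[OF mem'] by blast
  have "fibre_card k (\<lambda>i. (x i, y i)) (u, v) = fibre_card k (\<lambda>i. (x' i, y' i)) (u, v)" for u v
  proof (cases "u \<in> {0..<int N} \<and> (v = 0 \<or> v = 1)")
    case True
    define j where "j = nat u"
    have j: "j < N" "u = int j" using True by (auto simp: j_def nat_less_iff)
    have "fibre_card k (\<lambda>i. (x i, y i)) (u, 0) = fibre_card k (\<lambda>i. (x' i, y' i)) (u, 0)"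
      using fibre_card_split[of k y x "int j", OF y(2)] fibre_card_split[of k y' x' "int j", OF y'(2)]
        b[OF j(1)] x(3)[OF j(1)] x'(3)[OF j(1)] by (simp add: j(2) joint_card_def)
    then show ?thesis using True b[OF j(1)] by (auto simp: j(2) joint_card_def)
  next
    case False
    have "{i \<in> {1..k}. (x i, y i) = (u, v)} = {}" "{i \<in> {1..k}. (x' i, y' i) = (u, v)} = {}"
      using False x(2) x'(2) y(2) y'(2) by blast+
    then show ?thesis by (simp only: fibre_card_def)
  qed
  then obtain p where p: "p permutes {1..k}" and eq: "\<And>i. i \<in> {1..k} \<Longrightarrow> (x i, y i) = (x' (p i), y' (p i))"
    using obtain_permutation[of k "\<lambda>i. (x i, y i)" "\<lambda>i. (x' i, y' i)"] by (metis surj_pair)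
  have pin: "p i \<in> {1..k} \<longleftrightarrow> i \<in> {1..k}" for i by (rule permutes_in_image[OF p])
  have ext: "u = u' \<circ> p"
    if "u \<in> extensional {1..k}" "u' \<in> extensional {1..k}" "\<And>i. i \<in> {1..k} \<Longrightarrow> u i = u' (p i)" for u u' :: "nat \<Rightarrow> int"
  proof
    fix i show "u i = (u' \<circ> p) i"
    proof (cases "i \<in> {1..k}")
      case False
      then show ?thesis using that(1,2) permutes_not_in[OF p False] by (simp add: extensional_def)
    qed (simp add: that(3))
  qed
  have "x = x' \<circ> p" "y = y' \<circ> p"
    using eq x(1) x'(1) y(1) y'(1) by (auto intro!: ext)
  moreover have "z = z' \<circ> p"
  proof (rule ext)
    fix i assume i: "i \<in> {1..k}"
    then show "z i = z' (p i)" using eq[OF i] pin[of i] by (simp add: mem(3) mem'(3))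
  qed (simp_all add: mem(3) mem'(3))
  ultimately have "(x, y, z) = permute_triple (inv' p) (x', y', z')"
    by (simp add: permute_triple_def permute_vec_def permutes_inv_inv[OF p])
  then show ?thesis using permutes_inv[OF p] by blast
qed

text \<open>
  Choose \<open>b j\<close> of the positions where \<open>x\<close> has the entry \<open>j\<close>, and let \<open>y\<close> be the indicator function of
  the chosen positions.
\<close>

lemma pieri_vector_imp_triple:
  assumes b: "pieri_vector N m (content N k \<mu>) (content N k \<nu>) b"
  shows "triples \<noteq> {}"
proof -
  have N0: "N > 0" using N by simp
  define x where "x = weight_vec N k \<mu>"
  have "x \<in> extensional {1..k}" by (simp add: x_def weight_vec_def)
  then have xmem: "x \<in> weight_orbit N k \<mu>"
    unfolding weight_orbit_def x_def by (subst mem_vec_orbit_iff) auto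
  then have x: "\<And>i. i \<in> {1..k} \<Longrightarrow> x i \<in> {0..<int N}" "\<And>j. j < N \<Longrightarrow> fibre_card k x (int j) = content N k \<mu> j"
    unfolding mem_weight_orbit_iff[OF \<mu> N0] by blast+
  have "\<exists>Y. Y \<subseteq> {i \<in> {1..k}. x i = int j} \<and> card Y = b j" if "j < N" for j
  proof -
    have "b j \<le> card {i \<in> {1..k}. x i = int j}"
      using b that x(2)[OF that] by (simp add: pieri_vector_def fibre_card_def)
    then show ?thesis by (rule obtain_subset_with_card_n) blast
  qed
  then obtain Y where Y: "\<And>j. j < N \<Longrightarrow> Y j \<subseteq> {i \<in> {1..k}. x i = int j}" "\<And>j. j < N \<Longrightarrow> card (Y j) = b j"
    by metis
  define y where "y = (\<lambda>i\<in>{1..k}. if i \<in> (\<Union>j<N. Y j) then 1 else (0::int))"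
  have joint: "joint_card x y j = b j" if j: "j < N" for j
  proof -
    have "{i \<in> {1..k}. (x i, y i) = (int j, 1)} = Y j"
    proof (intro equalityI subsetI)
      fix i assume i: "i \<in> {i \<in> {1..k}. (x i, y i) = (int j, 1)}"
      then obtain l where l: "l < N" "i \<in> Y l" by (auto simp: y_def split: if_splits)
      then have "x i = int l" using Y(1) by blast
      then show "i \<in> Y j" using i l by simp
    next
      fix i assume "i \<in> Y j"
      then show "i \<in> {i \<in> {1..k}. (x i, y i) = (int j, 1)}"
        using Y(1)[OF j] j by (auto simp: y_def)
    qed
    then show ?thesis by (simp add: joint_card_def fibre_card_def Y(2)[OF j])
  qed
  have "fibre_card k y 1 = (\<Sum>j<N. joint_card x y j)"
    unfolding joint_card_def by (rule sum_fibre_card[OF x(1), symmetric])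
  also have "\<dots> = m" using b by (simp add: joint pieri_vector_def)
  finally have "y \<in> weight_orbit N k (fundamental_multiple m 1)"
    unfolding mem_row_orbit_iff[OF m N] by (simp add: y_def)
  moreover have "pieri_vector N m (content N k \<mu>) (content N k \<nu>) (joint_card x y)"
    using b by (simp add: pieri_vector_def joint cyclic_pred_less)
  ultimately have "(x, y, \<lambda>i\<in>{1..k}. (x i + y i) mod int N) \<in> triples"
    using sum_triples_iff_pieri_vector[OF xmem _ refl] by blast
  then show ?thesis by blast
qed

lemma orbit_coeff_eq_pieri:
  "orbit_coeff N k (weight_orbit N k \<mu>) (weight_orbit N k (fundamental_multiple m 1)) (weight_orbit N k \<nu>)
    = (if \<exists>b. pieri_vector N m (content N k \<mu>) (content N k \<nu>) b then 1 else 0)"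
proof (cases "triples = {}")
  case True
  then have "\<nexists>b. pieri_vector N m (content N k \<mu>) (content N k \<nu>) b"
    using pieri_vector_imp_triple by blast
  then show ?thesis using True by (simp add: orbit_coeff_def orbits_def)
next
  case False
  then obtain x y z where t: "(x, y, z) \<in> triples" by auto
  have "orbits (sym_group k) triples permute_triple = {orbit (sym_group k) permute_triple (x, y, z)}"
  proof (intro equalityI subsetI)
    fix O' assume "O' \<in> orbits (sym_group k) triples permute_triple"
    then obtain x' y' z' where t': "(x', y', z') \<in> triples" "O' = orbit (sym_group k) permute_triple (x', y', z')"
      by (auto simp: orbits_def)
    obtain g where "g permutes {1..k}" "(x', y', z') = permute_triple g (x, y, z)"
      using sum_triples_same_orbit[OF t'(1) t] by blast
    then show "O' \<in> {orbit (sym_group k) permute_triple (x, y, z)}"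
      using t'(2) orbit_permute_triple by simp
  qed (use t in \<open>auto simp: orbits_def\<close>)
  moreover have "x \<in> weight_orbit N k \<mu>" "y \<in> weight_orbit N k (fundamental_multiple m 1)"
      "z = (\<lambda>i\<in>{1..k}. (x i + y i) mod int N)"
    using t by (auto simp: mem_sum_triples_iff)
  then have "pieri_vector N m (content N k \<mu>) (content N k \<nu>) (joint_card x y)"
    using t sum_triples_iff_pieri_vector by blast
  ultimately show ?thesis by (auto simp: orbit_coeff_def)
qed

end

section \<open>Interlacing in terms of multiplicities\<close>

lemma content_step:
  assumes "Suc i < N"
  shows "weight_partition N \<kappa> ! i = content N k \<kappa> (Suc i) + weight_partition N \<kappa> ! Suc i"
  using weight_partition_step[OF assms] by (simp add: content_def)

lemma content_0:
  assumes "\<kappa> \<in> weights N k" "N > 0"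
  shows "content N k \<kappa> 0 + weight_partition N \<kappa> ! 0 = k"
  using assms by (simp add: content_def nth_weight_partition weights_def)

text \<open>
  Summing the equations from index \<open>i + 1\<close> to \<open>N - 1\<close> shows that the part \<open>i\<close> of \<open>\<mu>\<close> grows by \<open>b i\<close>, up
  to the common translation by \<open>b (N - 1)\<close>.  The bound \<open>b i \<le> a i\<close> then keeps the point \<open>i\<close> below
  the preceding one; for \<open>i = 0\<close> this is where the level \<open>k\<close> enters.
\<close>

lemma pieri_vector_imp_interlaces:
  assumes N: "N \<ge> 2" and \<mu>: "\<mu> \<in> weights N k" and \<nu>: "\<nu> \<in> weights N k"
    and b: "pieri_vector N m (content N k \<mu>) (content N k \<nu>) b"
  defines "A \<equiv> \<lambda>i. int (Poly_Mapping.lookup (shifted_partition N \<mu>) i)"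
    and "B \<equiv> \<lambda>i. int (Poly_Mapping.lookup (shifted_partition N \<nu>) i)"
  shows "\<exists>t. interlaces N (N + k) A (\<lambda>i. B i + t) \<and> (\<Sum>i<N. B i) + int N * t = (\<Sum>i<N. A i) + int m"
proof -
  have N0: "N > 0" using N by simp
  have b_le: "\<And>j. j < N \<Longrightarrow> b j \<le> content N k \<mu> j" and b_sum: "(\<Sum>j<N. b j) = m"
    and b_rec: "\<And>j. j < N \<Longrightarrow> content N k \<nu> j + b j = content N k \<mu> j + b (cyclic_pred N j)"
    using b by (auto simp: pieri_vector_def)
  \<comment> \<open>the last parts of both partitions are zero, which leaves only this translation\<close>
  define t where "t = b (N - 1)"
  have parts: "weight_partition N \<nu> ! i + t = weight_partition N \<mu> ! i + b i" if "i \<le> N - 1" for i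
    using that
  proof (induction rule: inc_induct)
    case base
    then show ?case using weight_partition_last[OF N0] by (simp add: t_def)
  next
    case (step i)
    then have i: "Suc i < N" by simp
    have "content N k \<nu> (Suc i) + b (Suc i) = content N k \<mu> (Suc i) + b i"
      using b_rec[OF i] by (simp add: cyclic_pred_def)
    then show ?case
      using step.IH content_step[OF i, of \<nu> k] content_step[OF i, of \<mu> k] by linarith
  qed
  have shifted: "B i + int t = A i + int (b i)" if "i < N" for i
  proof -
    have "weight_partition N \<nu> ! i + t = weight_partition N \<mu> ! i + b i"
      by (rule parts) (use that in simp)
    then have "int (weight_partition N \<nu> ! i) + int t = int (weight_partition N \<mu> ! i) + int (b i)"
      by (simp only: flip: of_nat_add)
    then show ?thesis using that by (simp add: A_def B_def lookup_shifted_partition)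
  qed
  have A: "alcove N (N + k) A" unfolding A_def by (rule alcove_shifted_partition[OF \<mu> N0])
  have A_last: "A (N - 1) = 0"
    using N0 weight_partition_last[OF N0, of \<mu>] by (simp add: A_def lookup_shifted_partition)
  have above: "A i + int (b i) < A j" if "j < i" "i < N" for i j
  proof -
    obtain l where l: "i = Suc l" using \<open>j < i\<close> by (cases i) auto
    have "A l = A i + int (content N k \<mu> i) + 1"
      using content_step[of l N \<mu> k] that l by (simp add: A_def lookup_shifted_partition)
    then have "A i + int (b i) < A l" using b_le[OF that(2)] by simp
    also have "A l \<le> A j"
      using alcove_decreasing[OF A, of j l] that l by (cases "j = l") auto
    finally show ?thesis .
  qed
  have wrap: "A i + int (b i) < A j + int (N + k)" if "i < N" "j < N" for i j
  proof (cases "i = 0")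
    case True
    have "A 0 + int (content N k \<mu> 0) = int (N - 1) + int k"
      using content_0[OF \<mu> N0] N0 by (simp add: A_def lookup_shifted_partition)
    then have "A 0 + int (b 0) < int (N + k)" using b_le[OF N0] N0 by simp
    also have "int (N + k) \<le> A j + int (N + k)" by (simp add: A_def)
    finally show ?thesis using True by simp
  next
    case False
    then show ?thesis using above[of 0 i] alcove_span[OF A N0 that(2)] that by simp
  qed
  have "interlaces N (N + k) A (\<lambda>i. B i + int t)"
    unfolding interlaces_def using above wrap by (simp add: shifted)
  moreover have "(\<Sum>i<N. B i) + int N * int t = (\<Sum>i<N. A i) + int m"
  proof -
    have "(\<Sum>i<N. B i + int t) = (\<Sum>i<N. A i + int (b i))"
      by (rule sum.cong) (simp_all add: shifted)
    then show ?thesis by (simp add: sum.distrib flip: b_sum)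
  qed
  ultimately show ?thesis by blast
qed

lemma interlaces_imp_pieri_vector:
  assumes N: "N \<ge> 2" and \<mu>: "\<mu> \<in> weights N k" and \<nu>: "\<nu> \<in> weights N k"
  defines "A \<equiv> \<lambda>i. int (Poly_Mapping.lookup (shifted_partition N \<mu>) i)"
    and "B \<equiv> \<lambda>i. int (Poly_Mapping.lookup (shifted_partition N \<nu>) i)"
  assumes il: "interlaces N (N + k) A (\<lambda>i. B i + t)"
    and sum: "(\<Sum>i<N. B i) + int N * t = (\<Sum>i<N. A i) + int m"
  shows "\<exists>b. pieri_vector N m (content N k \<mu>) (content N k \<nu>) b"
proof -
  have N0: "N > 0" using N by simp
  define b where "b i = nat (B i + t - A i)" for i
  have b: "int (b i) = B i + t - A i" if "i < N" for i
    using il that by (simp add: b_def interlaces_def)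
  have b': "int (b i) = int (weight_partition N \<nu> ! i) + t - int (weight_partition N \<mu> ! i)" if "i < N" for i
    using b[OF that] that by (simp add: A_def B_def lookup_shifted_partition)
  have above: "B i + t < A j" if "j < i" "i < N" for i j
    using il that by (simp add: interlaces_def)
  have wrap: "B 0 + t < A (N - 1) + int (N + k)"
    using il N0 by (simp add: interlaces_def)
  have step: "int (weight_partition N \<kappa> ! i) = int (content N k \<kappa> (Suc i)) + int (weight_partition N \<kappa> ! Suc i)"
    if "Suc i < N" for i \<kappa>
    using content_step[OF that, of \<kappa> k] by simp
  have first: "int (content N k \<kappa> 0) + int (weight_partition N \<kappa> ! 0) = int k" if "\<kappa> \<in> weights N k" for \<kappa>
    using content_0[OF that N0] by simp
  have last: "weight_partition N \<kappa> ! (N - 1) = 0" for \<kappa> by (rule weight_partition_last[OF N0])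
  have "b j \<le> content N k \<mu> j" if j: "j < N" for j
  proof (cases j)
    case 0
    have "A (N - 1) = 0" using N0 last[of \<mu>] by (simp add: A_def lookup_shifted_partition)
    moreover have "B 0 = int (weight_partition N \<nu> ! 0) + int (N - 1)"
      using N0 by (simp add: B_def lookup_shifted_partition)
    ultimately show ?thesis using 0 wrap b'[OF N0] first[OF \<mu>] N0 by simp
  next
    case (Suc l)
    then have "B j + t < A l" using above[of l j] j by simp
    then show ?thesis
      using Suc j b'[OF j] step[of l \<mu>] by (simp add: A_def B_def lookup_shifted_partition)
  qed
  moreover have "(\<Sum>j<N. b j) = m"
  proof -
    have "int (\<Sum>j<N. b j) = (\<Sum>j<N. B j + t - A j)"
      unfolding of_nat_sum by (rule sum.cong) (simp_all add: b)
    also have "\<dots> = int m" using sum by (simp add: sum.distrib sum_subtractf)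
    finally show ?thesis by (simp only: of_nat_eq_iff)
  qed
  moreover have "content N k \<nu> j + b j = content N k \<mu> j + b (cyclic_pred N j)" if j: "j < N" for j
  proof (cases j)
    case 0
    have "int (b (N - 1)) = t" using b'[of "N - 1"] N0 last by simp
    then have "int (content N k \<nu> 0) + int (b 0) = int (content N k \<mu> 0) + int (b (N - 1))"
      using b'[OF N0] first[OF \<mu>] first[OF \<nu>] by simp
    then show ?thesis using 0 by (simp add: cyclic_pred_def)
  next
    case (Suc l)
    then have "int (content N k \<nu> j) + int (b j) = int (content N k \<mu> j) + int (b l)"
      using b'[OF j] b'[of l] step[of l \<mu>] step[of l \<nu>] j by simp
    then show ?thesis using Suc by (simp add: cyclic_pred_def)
  qed
  ultimately show ?thesis unfolding pieri_vector_def by blast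
qed

theorem theorem5p1p4:
  fixes N k m :: nat and \<mu> \<nu> :: weight
  assumes "N \<ge> 2" and "k \<ge> 1" and "m \<le> k"
    and "\<mu> \<in> weights N k" and "\<nu> \<in> weights N k"
  shows "fusion_coeff N k \<mu> (fundamental_multiple m 1) \<nu>
       = of_nat (orbit_coeff N k (weight_orbit N k \<mu>)
                   (weight_orbit N k (fundamental_multiple m 1)) (weight_orbit N k \<nu>))"
proof -
  define A where "A = (\<lambda>i. int (Poly_Mapping.lookup (shifted_partition N \<mu>) i))"
  define B where "B = (\<lambda>i. int (Poly_Mapping.lookup (shifted_partition N \<nu>) i))"
  have N: "N > 0" using assms(1) by simp
  have alcoves: "alcove N (N + k) A" "alcove N (N + k) B"
    unfolding A_def B_def using assms(4,5) N by (auto intro: alcove_shifted_partition)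
  have m: "m < N + k" using assms(1,3) by simp
  have "fusion_coeff N k \<mu> (fundamental_multiple m 1) \<nu>
      = (if \<exists>t. interlaces N (N + k) A (\<lambda>i. B i + t) \<and> (\<Sum>i<N. B i) + int N * t = (\<Sum>i<N. A i) + int m then 1 else 0)"
    unfolding fusion_coeff_eq_sum[OF assms(1,4,5)] weight_functional_def
    using sum_fusion_functional_exponents[OF alcoves[unfolded A_def] m N] by (simp only: A_def B_def)
  moreover have "(\<exists>t. interlaces N (N + k) A (\<lambda>i. B i + t) \<and> (\<Sum>i<N. B i) + int N * t = (\<Sum>i<N. A i) + int m)
      \<longleftrightarrow> (\<exists>b. pieri_vector N m (content N k \<mu>) (content N k \<nu>) b)"
    using pieri_vector_imp_interlaces[OF assms(1,4,5)] interlaces_imp_pieri_vector[OF assms(1,4,5)]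
    unfolding A_def B_def by blast
  ultimately show ?thesis
    by (simp only: orbit_coeff_eq_pieri[OF assms(1,3,4,5)] of_nat_1 of_nat_0 if_distrib[of of_nat])
qed

end
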